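(* Let $f\colon M\to N$ be a smooth map between manifolds, where $N$ is a Banach manifold. If, for some $m\in M$, the differential $T_mf\colon T_mM\to T_{f(m)}N$ is a regular operator, then $f$ can be brought into a normal form at $m$. In particular, every smooth map $f\colon M\to N$ with finite-dimensional target $N$ can be brought into a normal form at every point.
   Context: Manifolds are smooth manifolds without boundary, modeled on (possibly infinite-dimensional) locally convex spaces, with smoothness in the Michal–Bastiani sense; a Banach manifold is one modeled on Banach spaces. A chart at a point sends that point to $0$. Regular operator: a continuous linear map $T\colon X\to Y$ between locally convex spaces is regular if it is relatively open (open as a map onto $\operatorname{Im}T$ with the relative topology) and $\operatorname{Ker}T\subseteq X$, $\operatorname{Im}T\subseteq Y$ are closed, topologically complemented subspaces. Abstract normal form: a tuple $(X,Y,\hat f,f_{\mathrm{sing}})$ where (i) $X,Y$ are locally convex spaces with topological direct sum decompositions $X=\mathrm{Ker}\oplus\mathrm{Coim}$, $Y=\mathrm{Coker}\oplus\mathrm{Im}$ (the names denote abstract closed subspaces); (ii) $\hat f\colon\mathrm{Coim}\to\mathrm{Im}$ is a linear topological isomorphism; (iii) $f_{\mathrm{sing}}\colon U\to\mathrm{Coker}$ is a smooth map on an open neighborhood $U$ of $0$ in $X$ with $f_{\mathrm{sing}}(0,x_2)=0$ for all $x_2\in U\cap\mathrm{Coim}$ and derivative $T_{(0,0)}f_{\mathrm{sing}}=0$. Put $f_{\mathrm{NF}}(x_1,x_2)=\hat f(x_2)+f_{\mathrm{sing}}(x_1,x_2)$ for $(x_1,x_2)\in U$, with $x_1\in\mathrm{Ker}$,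 $x_2\in\mathrm{Coim}$. A smooth map $f\colon M\to N$ can be brought into a normal form at $m\in M$ if there are an abstract normal form $(X,Y,\hat f,f_{\mathrm{sing}})$ and charts $\kappa\colon M\supseteq U'\to U\subseteq X$ at $m$ and $\rho\colon N\supseteq V'\to V\subseteq Y$ at $f(m)$ with $f(U')\subseteq V'$ and $\rho\circ f|_{U'}=f_{\mathrm{NF}}\circ\kappa$. *)

theory Defs
  imports "HOL-Analysis.Analysis" "HOL-Library.Function_Algebras"
begin

section \<open>Locally convex spaces\<close>

text \<open>Locally convex spaces are real and Hausdorff (class \<open>locally_convex_space\<close>); a general one is
  rendered as a linear subspace of a type of this class, with the subspace topology. This lets the
  model space vary from chart to chart. The class \<open>locally_convex_tvs\<close> without the Hausdorff axiom is
  separate only because the function type cannot be declared Hausdorff for arbitrary index types: that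
  arity clashes with the library's metric on functions with countable domain.\<close>

class locally_convex_tvs = real_vector + topological_ab_group_add +
  assumes tendsto_scaleR_nhds:
    "((\<lambda>p. scaleR (fst p) (snd p)) \<longlongrightarrow> scaleR c x) (nhds c \<times>\<^sub>F nhds x)"
  and locally_convex_raw:
    "open W \<Longrightarrow> 0 \<in> W \<Longrightarrow> \<exists>V. open V \<and> 0 \<in> V \<and> V \<subseteq> W \<and>
       (\<forall>x\<in>V. \<forall>y\<in>V. \<forall>a\<ge>0. \<forall>b\<ge>0. a + b = 1 \<longrightarrow> scaleR a x + scaleR b y \<in> V)"

class locally_convex_space = locally_convex_tvs + t2_space

lemma locally_convex:
  fixes W :: "'a::locally_convex_tvs set"
  shows "open W \<Longrightarrow> 0 \<in> W \<Longrightarrow> \<exists>V. open V \<and> 0 \<in> V \<and> V \<subseteq> W \<and> convex V"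
  using locally_convex_raw[of W] unfolding convex_def .

instance real_normed_vector \<subseteq> locally_convex_space
proof
  fix c :: real and x :: 'a
  have "((\<lambda>p. fst p *\<^sub>R snd p) \<longlongrightarrow> c *\<^sub>R x) (nhds (c, x))"
    using tendsto_scaleR[OF tendsto_fst[OF filterlim_ident] tendsto_snd[OF filterlim_ident],
        of "(c, x)"]
    by simp
  then show "((\<lambda>p. fst p *\<^sub>R snd p) \<longlongrightarrow> c *\<^sub>R x) (nhds c \<times>\<^sub>F nhds x)"
    by (simp add: nhds_prod)
next
  fix W :: "'a set"
  assume "open W" "0 \<in> W"
  then obtain e where "0 < e" "ball 0 e \<subseteq> W"
    using open_contains_ball by blast
  then show "\<exists>V. open V \<and> 0 \<in> V \<and> V \<subseteq> W \<and>
      (\<forall>x\<in>V. \<forall>y\<in>V. \<forall>a\<ge>0. \<forall>b\<ge>0. a + b = 1 \<longrightarrow> a *\<^sub>R x + b *\<^sub>R y \<in> V)"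
    using convex_ball[of 0 e] unfolding convex_def by (intro exI[of _ "ball 0 e"]) auto
qed

text \<open>Pointwise operations and the product topology make function types locally convex; tangent
  spaces are realised below as linear subspaces of such a product.\<close>

instantiation "fun" :: (type, real_vector) real_vector
begin

definition scaleR_fun_def: "scaleR c f = (\<lambda>i. c *\<^sub>R f i)"

instance
  by standard (auto simp: scaleR_fun_def fun_eq_iff scaleR_add_right scaleR_add_left)

end

lemma tendsto_fun_iff:
  fixes f :: "'x \<Rightarrow> 'i \<Rightarrow> 'a::topological_space"
  shows "(f \<longlongrightarrow> g) F \<longleftrightarrow> (\<forall>i. ((\<lambda>x. f x i) \<longlongrightarrow> g i) F)"
proof -
  have "(f \<longlongrightarrow> g) F \<longleftrightarrow> limitin (product_topology (\<lambda>_. euclidean) UNIV) f g F"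
    by (simp add: euclidean_product_topology)
  then show ?thesis
    by (simp add: limitin_componentwise)
qed

instance "fun" :: (type, locally_convex_tvs) locally_convex_tvs
proof
  fix f g :: "'a \<Rightarrow> 'b" and c :: real
  have co: "((\<lambda>h. h i) \<longlongrightarrow> k i) (nhds k)" for i and k :: "'a \<Rightarrow> 'b"
    using tendsto_fun_iff[of "\<lambda>h. h" k "nhds k"] filterlim_ident by blast
  show "((\<lambda>p. fst p + snd p) \<longlongrightarrow> f + g) (nhds f \<times>\<^sub>F nhds g)"
    unfolding tendsto_fun_iff plus_fun_def
    by (intro allI tendsto_add filterlim_compose[OF co]) (auto intro: filterlim_fst filterlim_snd)
  show "(uminus \<longlongrightarrow> - f) (nhds f)"
    unfolding tendsto_fun_iff fun_Compl_def by (intro allI tendsto_minus co)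
  show "((\<lambda>p. fst p *\<^sub>R snd p) \<longlongrightarrow> c *\<^sub>R f) (nhds c \<times>\<^sub>F nhds f)"
    unfolding tendsto_fun_iff scaleR_fun_def
  proof
    fix i
    have "filterlim (\<lambda>p. (fst p, snd p i)) (nhds c \<times>\<^sub>F nhds (f i)) (nhds c \<times>\<^sub>F nhds f)"
      by (intro filterlim_Pair filterlim_fst filterlim_compose[OF co filterlim_snd])
    from filterlim_compose[OF tendsto_scaleR_nhds this]
    show "((\<lambda>p. fst p *\<^sub>R snd p i) \<longlongrightarrow> c *\<^sub>R f i) (nhds c \<times>\<^sub>F nhds f)"
      by simp
  qed
next
  fix W :: "('a \<Rightarrow> 'b) set"
  assume "open W" "0 \<in> W"
  then obtain X where X: "0 \<in> PiE UNIV X" "\<And>i. open (X i)" "finite {i. X i \<noteq> UNIV}" "PiE UNIV X \<subseteq> W"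
    using product_topology_open_contains_basis[of "\<lambda>_. euclidean" UNIV W 0]
    by (auto simp: open_fun_def)
  have "\<exists>V. open V \<and> 0 \<in> V \<and> V \<subseteq> X i \<and> convex V \<and> (X i = UNIV \<longrightarrow> V = UNIV)" for i
  proof (cases "X i = UNIV")
    case False
    have "0 \<in> X i" using X(1) by (auto simp: PiE_def Pi_def zero_fun_def)
    with False show ?thesis using locally_convex[OF X(2)] by blast
  qed auto
  then obtain V where V: "\<And>i. open (V i)" "\<And>i. 0 \<in> V i" "\<And>i. V i \<subseteq> X i" "\<And>i. convex (V i)"
      "\<And>i. X i = UNIV \<Longrightarrow> V i = UNIV"
    by metis
  have "finite {i. V i \<noteq> UNIV}"
    by (rule finite_subset[OF _ X(3)]) (use V(5) in auto)
  then have "open (PiE UNIV V)"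
    using V(1) by (intro open_PiE) auto
  moreover have "convex (PiE UNIV V)"
    unfolding convex_def
    using V(4) by (auto simp: PiE_def Pi_def scaleR_fun_def convex_def)
  moreover have "PiE UNIV V \<subseteq> W"
    using X(4) V(3) by (auto simp: PiE_def Pi_def)
  ultimately show "\<exists>V. open V \<and> 0 \<in> V \<and> V \<subseteq> W \<and>
      (\<forall>x\<in>V. \<forall>y\<in>V. \<forall>a\<ge>0. \<forall>b\<ge>0. a + b = 1 \<longrightarrow> a *\<^sub>R x + b *\<^sub>R y \<in> V)"
    using V(2) unfolding convex_def by (intro exI[of _ "PiE UNIV V"]) (auto simp: zero_fun_def)
qed


section \<open>Michal--Bastiani smoothness\<close>

definition dir_deriv ::
  "('e::locally_convex_space \<Rightarrow> 'f::locally_convex_space) \<Rightarrow> 'e \<Rightarrow> 'e \<Rightarrow> 'f" where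
  "dir_deriv f x v = Lim (at 0) (\<lambda>t::real. (1 / t) *\<^sub>R (f (x + t *\<^sub>R v) - f x))"

text \<open>\<open>iter_deriv f k x v\<close> is the iterated directional derivative
  \<open>d\<^sup>k f(x)(v 0, \<dots>, v (k-1))\<close>. The directions are given as a sequence, of which only the first
  \<open>k\<close> entries matter, so that continuity in all arguments can be expressed with one type.\<close>

primrec iter_deriv ::
  "('e::locally_convex_space \<Rightarrow> 'f::locally_convex_space) \<Rightarrow> nat \<Rightarrow> 'e \<Rightarrow> (nat \<Rightarrow> 'e) \<Rightarrow> 'f" where
  "iter_deriv f 0 x v = f x"
| "iter_deriv f (Suc k) x v = dir_deriv (\<lambda>y. iter_deriv f k y v) x (v k)"

text \<open>Smoothness of \<open>f : U \<rightarrow> F\<close>, for \<open>U\<close> open in \<open>E\<close>: all iterated directional derivatives exist in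
  \<open>F\<close> and are jointly continuous on \<open>U \<times> E\<^sup>k\<close>. Since \<open>U\<close> is open in \<open>E\<close>, the values of the total
  function \<open>f\<close> outside \<open>U\<close> are irrelevant.\<close>

definition mb_smooth_on ::
  "'e::locally_convex_space set \<Rightarrow> 'f::locally_convex_space set \<Rightarrow> 'e set \<Rightarrow> ('e \<Rightarrow> 'f) \<Rightarrow> bool" where
  "mb_smooth_on E F U f \<longleftrightarrow>
     openin (top_of_set E) U \<and>
     (\<forall>k. (\<forall>x\<in>U. \<forall>v\<in>UNIV \<rightarrow> E.
             iter_deriv f k x v \<in> F \<and>
             (\<exists>l\<in>F. ((\<lambda>t::real. (1 / t) *\<^sub>R (iter_deriv f k (x + t *\<^sub>R v k) v - iter_deriv f k x v))
                       \<longlongrightarrow> l) (at 0))) \<and>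
          continuous_on (U \<times> (UNIV \<rightarrow> E)) (\<lambda>(x, v). iter_deriv f k x v))"


section \<open>Regular operators\<close>

definition linear_on :: "'a::real_vector set \<Rightarrow> 'b::real_vector set \<Rightarrow> ('a \<Rightarrow> 'b) \<Rightarrow> bool" where
  "linear_on X Y T \<longleftrightarrow>
     T \<in> X \<rightarrow> Y \<and> (\<forall>x\<in>X. \<forall>y\<in>X. T (x + y) = T x + T y) \<and> (\<forall>c. \<forall>x\<in>X. T (c *\<^sub>R x) = c *\<^sub>R T x)"

definition top_direct_sum ::
  "'a::locally_convex_tvs set \<Rightarrow> 'a set \<Rightarrow> 'a set \<Rightarrow> bool" where
  "top_direct_sum X A B \<longleftrightarrow>
     subspace X \<and> subspace A \<and> subspace B \<and>
     closedin (top_of_set X) A \<and> closedin (top_of_set X) B \<and>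
     (\<exists>g. homeomorphism (A \<times> B) X (\<lambda>(a, b). a + b) g)"

definition top_complemented :: "'a::locally_convex_tvs set \<Rightarrow> 'a set \<Rightarrow> bool" where
  "top_complemented X A \<longleftrightarrow> (\<exists>B. top_direct_sum X A B)"

definition regular_operator ::
  "'a::locally_convex_tvs set \<Rightarrow> 'b::locally_convex_tvs set \<Rightarrow> ('a \<Rightarrow> 'b) \<Rightarrow> bool" where
  "regular_operator X Y T \<longleftrightarrow>
     linear_on X Y T \<and> continuous_on X T \<and>
     (\<forall>U. openin (top_of_set X) U \<longrightarrow> openin (top_of_set (T ` X)) (T ` U)) \<and>
     closedin (top_of_set X) {x \<in> X. T x = 0} \<and> top_complemented X {x \<in> X. T x = 0} \<and>
     closedin (top_of_set Y) (T ` X) \<and> top_complemented Y (T ` X)"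


section \<open>Manifolds\<close>

record ('m, 'e) chart =
  chart_dom :: "'m set"
  chart_model :: "'e set"
  chart_map :: "'m \<Rightarrow> 'e"

definition chart_inv :: "('m, 'e) chart \<Rightarrow> 'e \<Rightarrow> 'm" where
  "chart_inv c = inv_into (chart_dom c) (chart_map c)"

definition is_chart :: "('m::topological_space, 'e::locally_convex_space) chart \<Rightarrow> bool" where
  "is_chart c \<longleftrightarrow>
     open (chart_dom c) \<and> subspace (chart_model c) \<and>
     openin (top_of_set (chart_model c)) (chart_map c ` chart_dom c) \<and>
     homeomorphism (chart_dom c) (chart_map c ` chart_dom c) (chart_map c) (chart_inv c)"

definition local_rep ::
  "('m, 'e) chart \<Rightarrow> ('n, 'f) chart \<Rightarrow> ('m \<Rightarrow> 'n) \<Rightarrow> 'e \<Rightarrow> 'f" where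
  "local_rep c d f = chart_map d \<circ> f \<circ> chart_inv c"

definition smooth_local_rep ::
  "('m, 'e::locally_convex_space) chart \<Rightarrow> ('n, 'f::locally_convex_space) chart \<Rightarrow> ('m \<Rightarrow> 'n) \<Rightarrow> bool" where
  "smooth_local_rep c d f \<longleftrightarrow>
     mb_smooth_on (chart_model c) (chart_model d)
       (chart_map c ` (chart_dom c \<inter> f -` chart_dom d)) (local_rep c d f)"

definition smooth_atlas :: "('m::t2_space, 'e::locally_convex_space) chart set \<Rightarrow> bool" where
  "smooth_atlas A \<longleftrightarrow>
     (\<forall>c\<in>A. is_chart c) \<and> (\<Union>c\<in>A. chart_dom c) = UNIV \<and>
     (\<forall>c\<in>A. \<forall>d\<in>A. smooth_local_rep c d id)"

text \<open>Charts of the manifold, i.e. members of the maximal atlas determined by \<open>A\<close>.\<close>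

definition compatible_chart ::
  "('m::t2_space, 'e::locally_convex_space) chart set \<Rightarrow> ('m, 'e) chart \<Rightarrow> bool" where
  "compatible_chart A c \<longleftrightarrow>
     is_chart c \<and> (\<forall>d\<in>A. smooth_local_rep c d id \<and> smooth_local_rep d c id)"

definition chart_at ::
  "('m::t2_space, 'e::locally_convex_space) chart set \<Rightarrow> 'm \<Rightarrow> ('m, 'e) chart \<Rightarrow> bool" where
  "chart_at A m c \<longleftrightarrow> compatible_chart A c \<and> m \<in> chart_dom c \<and> chart_map c m = 0"

definition smooth_map ::
  "('m::t2_space, 'e::locally_convex_space) chart set \<Rightarrow>
   ('n::t2_space, 'f::locally_convex_space) chart set \<Rightarrow> ('m \<Rightarrow> 'n) \<Rightarrow> bool" where
  "smooth_map A B f \<longleftrightarrow>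
     continuous_on UNIV f \<and> (\<forall>c\<in>A. \<forall>d\<in>B. smooth_local_rep c d f)"

text \<open>Any Banach space occurs as a complete linear subspace of a normed type, and any family of Banach
  spaces jointly so (in its \<open>l\<^sup>1\<close>-sum).\<close>

definition banach_manifold :: "('n::t2_space, 'f::real_normed_vector) chart set \<Rightarrow> bool" where
  "banach_manifold B \<longleftrightarrow> smooth_atlas B \<and> (\<forall>d\<in>B. complete (chart_model d))"

definition finite_dim_manifold :: "('n::t2_space, 'f::locally_convex_space) chart set \<Rightarrow> bool" where
  "finite_dim_manifold B \<longleftrightarrow>
     smooth_atlas B \<and> (\<forall>d\<in>B. \<exists>S. finite S \<and> chart_model d = span S)"


section \<open>Tangent spaces and differentials\<close>

text \<open>A tangent vector at \<open>m\<close> is a family of vectors, one in the model space of each chart of the atlas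
  around \<open>m\<close>, related by the derivatives of the chart changes (and \<open>0\<close> at all other indices). Every
  evaluation at a chart around \<open>m\<close> identifies the tangent space with the model space of that chart,
  linearly and, as the chart changes have continuous derivatives, topologically.\<close>

definition tangent_space ::
  "('m::t2_space, 'e::locally_convex_space) chart set \<Rightarrow> 'm \<Rightarrow> (('m, 'e) chart \<Rightarrow> 'e) set" where
  "tangent_space A m =
     {\<xi>. (\<forall>c. \<not> (c \<in> A \<and> m \<in> chart_dom c) \<longrightarrow> \<xi> c = 0) \<and>
         (\<forall>c\<in>A. m \<in> chart_dom c \<longrightarrow> \<xi> c \<in> chart_model c) \<and>
         (\<forall>c\<in>A. \<forall>d\<in>A. m \<in> chart_dom c \<and> m \<in> chart_dom d \<longrightarrow>
            \<xi> d = dir_deriv (local_rep c d id) (chart_map c m) (\<xi> c))}"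

text \<open>The chart on the source is arbitrary: by the chain rule the result does not depend on it.\<close>

definition differential ::
  "('m::t2_space, 'e::locally_convex_space) chart set \<Rightarrow>
   ('n::t2_space, 'f::locally_convex_space) chart set \<Rightarrow> ('m \<Rightarrow> 'n) \<Rightarrow> 'm \<Rightarrow>
   (('m, 'e) chart \<Rightarrow> 'e) \<Rightarrow> (('n, 'f) chart \<Rightarrow> 'f)" where
  "differential A B f m \<xi> =
     (let c = (SOME c. c \<in> A \<and> m \<in> chart_dom c)
      in (\<lambda>d. if d \<in> B \<and> f m \<in> chart_dom d
             then dir_deriv (local_rep c d f) (chart_map c m) (\<xi> c) else 0))"


section \<open>Normal forms\<close>

text \<open>The direct sums are internal: the pair \<open>(x\<^sub>1, x\<^sub>2)\<close> is the vector \<open>x\<^sub>1 + x\<^sub>2\<close> of \<open>X\<close>.\<close>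

definition abstract_normal_form ::
  "'e::locally_convex_space set \<Rightarrow> 'e set \<Rightarrow> 'e set \<Rightarrow>
   'f::locally_convex_space set \<Rightarrow> 'f set \<Rightarrow> 'f set \<Rightarrow>
   ('e \<Rightarrow> 'f) \<Rightarrow> 'e set \<Rightarrow> ('e \<Rightarrow> 'f) \<Rightarrow> bool" where
  "abstract_normal_form X Ker Coim Y Coker Img fhat U fsing \<longleftrightarrow>
     top_direct_sum X Ker Coim \<and> top_direct_sum Y Coker Img \<and>
     linear_on Coim Img fhat \<and> (\<exists>g. homeomorphism Coim Img fhat g) \<and>
     openin (top_of_set X) U \<and> 0 \<in> U \<and>
     mb_smooth_on X Coker U fsing \<and>
     (\<forall>x\<^sub>2\<in>U \<inter> Coim. fsing x\<^sub>2 = 0) \<and>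
     (\<forall>v\<in>X. dir_deriv fsing 0 v = 0)"

definition normal_form_map ::
  "'e::locally_convex_space set \<Rightarrow> 'e set \<Rightarrow>
   ('e \<Rightarrow> 'f::locally_convex_space) \<Rightarrow> ('e \<Rightarrow> 'f) \<Rightarrow> 'e \<Rightarrow> 'f" where
  "normal_form_map Ker Coim fhat fsing x =
     fhat (THE x\<^sub>2. x\<^sub>2 \<in> Coim \<and> (\<exists>x\<^sub>1\<in>Ker. x = x\<^sub>1 + x\<^sub>2)) + fsing x"

definition has_normal_form_at ::
  "('m::t2_space, 'e::locally_convex_space) chart set \<Rightarrow>
   ('n::t2_space, 'f::locally_convex_space) chart set \<Rightarrow> ('m \<Rightarrow> 'n) \<Rightarrow> 'm \<Rightarrow> bool" where
  "has_normal_form_at A B f m \<longleftrightarrow>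
     (\<exists>X Ker Coim Y Coker Img fhat U fsing \<kappa> \<rho>.
        abstract_normal_form X Ker Coim Y Coker Img fhat U fsing \<and>
        chart_at A m \<kappa> \<and> chart_model \<kappa> = X \<and> chart_map \<kappa> ` chart_dom \<kappa> = U \<and>
        chart_at B (f m) \<rho> \<and> chart_model \<rho> = Y \<and>
        f ` chart_dom \<kappa> \<subseteq> chart_dom \<rho> \<and>
        (\<forall>p\<in>chart_dom \<kappa>.
           chart_map \<rho> (f p) = normal_form_map Ker Coim fhat fsing (chart_map \<kappa> p)))"

end

theory Submission
  imports Defs
begin

text \<open>Write \<open>T\<close> for the differential in charts \<open>E \<rightarrow> F\<close> around \<open>m\<close> and \<open>f m\<close>, and \<open>g\<close> for the local
representative of \<open>f\<close>, both charts being translated to the origin. Regularity of \<open>T\<close> amounts to two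
continuous linear maps (a \<open>splitting\<close>): a projection \<open>\<pi>\<close> of \<open>F\<close> onto the image of \<open>T\<close>, and a right
inverse \<open>\<sigma>\<close> of \<open>T\<close> on that image. Then \<open>E = Ker T \<oplus> \<sigma> (T E)\<close> and \<open>F = Ker \<pi> \<oplus> T E\<close>.

On the source, \<open>\<theta> x = x - \<sigma> (T x - \<pi> (g x))\<close> has derivative \<open>id\<close> at \<open>0\<close> and satisfies \<open>T \<circ> \<theta> = \<pi> \<circ> g\<close>.
If \<open>\<theta>\<close> is a local diffeomorphism with inverse \<open>\<psi>\<close>, then \<open>g (\<psi> y) = T y + h y\<close> with \<open>h\<close> valued in \<open>Ker \<pi>\<close> and
\<open>h\<close> flat to first order: the image component of \<open>f\<close> has become linear (\<open>straighten_image_component\<close>).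
It remains to make \<open>h\<close> vanish on the coimage. The shear \<open>w \<mapsto> w - h (\<sigma> (\<pi> w))\<close> of the target, whose inverse is the
opposite shear, replaces \<open>h y\<close> by \<open>h y - h (\<sigma> (T y))\<close>, which is the singular part of the normal form
(\<open>normal_form_of_splitting\<close>).

\<open>E\<close> has no inverse function theorem of its own. But \<open>\<theta>\<close> differs from the identity by \<open>\<sigma> \<circ> Q\<close> with \<open>Q\<close> valued in
the Banach space \<open>T E\<close>, so solving \<open>\<theta> x = y\<close> means finding a fixed point \<open>b = Q (y + \<sigma> b)\<close> in \<open>T E\<close>; this
is a contraction depending on the parameter \<open>y\<close> (\<open>perturbation_local_diffeo\<close>). Smoothness of the
solution in the Michal--Bastiani sense is an induction on the order of differentiation: the derivative
of the solution \<open>b\<close> is the solution of a linear equation of the same type, and the derivatives of such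
linear solutions are again built from smooth maps and linear solutions (\<open>C_family_sol_corr\<close>).

The induction is carried out in a recursively defined class of \<open>n\<close> times differentiable families
\<open>G x v\<close>, where \<open>v\<close> is a sequence of directions (\<open>C_family\<close>). The class stays within one type, is closed
under sums, continuous linear maps and insertion into iterated derivatives (\<open>C_family_iter_deriv\<close>, the
chain rule of all orders), and characterises smoothness (\<open>C_family_iff_mb_smooth\<close>). The calculus rests on a
mean value theorem for open convex sets (\<open>mean_value_convex\<close>), which replaces integrals.

In the finite-dimensional case a splitting of any linear map exists by choice of bases, since linear maps
on finite-dimensional normed spaces are continuous.\<close>

section \<open>Velocities of curves and the mean value theorem\<close>

lemma tendsto_scaleR_lc:
  fixes g :: "'s \<Rightarrow> 'a::locally_convex_tvs"
  assumes "(f \<longlongrightarrow> c) F" "(g \<longlongrightarrow> x) F"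
  shows "((\<lambda>t. f t *\<^sub>R g t) \<longlongrightarrow> c *\<^sub>R x) F"
  using filterlim_compose[OF tendsto_scaleR_nhds filterlim_Pair[OF assms]] by simp

lemma open_translation_lc:
  fixes W :: "'a::locally_convex_tvs set"
  assumes "open W"
  shows "open {y. y + a \<in> W}"
proof -
  have "continuous_on UNIV (\<lambda>y. y + a)"
    by (intro continuous_on_add continuous_on_id continuous_on_const)
  from continuous_open_preimage[OF this open_UNIV assms]
  show ?thesis by (simp add: vimage_def)
qed

lemma convex_nbhd:
  fixes W :: "'a::locally_convex_tvs set"
  assumes "open W" "a \<in> W"
  obtains V where "open V" "a \<in> V" "V \<subseteq> W" "convex V"
proof -
  have "open {y. y + a \<in> W}" by (rule open_translation_lc[OF assms(1)])
  then obtain V where V: "open V" "0 \<in> V" "V \<subseteq> {y. y + a \<in> W}" "convex V"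
    using locally_convex[of "{y. y + a \<in> W}"] assms(2) by auto
  have eq: "{y. y + (- a) \<in> V} = (+) a ` V"
    by (auto simp: image_iff) (metis add.commute diff_add_cancel)
  have "open ((+) a ` V)" "convex ((+) a ` V)"
    using open_translation_lc[OF V(1), of "- a"] convex_translation[OF V(4), of a] eq by auto
  moreover have "a \<in> (+) a ` V" using V(2) by force
  moreover have "(+) a ` V \<subseteq> W" using V(3) by (auto simp: add.commute)
  ultimately show ?thesis using that by blast
qed

definition has_velocity :: "(real \<Rightarrow> 'a::locally_convex_tvs) \<Rightarrow> 'a \<Rightarrow> bool" where
  "has_velocity \<gamma> l \<longleftrightarrow> ((\<lambda>t. (1 / t) *\<^sub>R (\<gamma> t - \<gamma> 0)) \<longlongrightarrow> l) (at 0)"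

lemma has_velocity_unique:
  fixes \<gamma> :: "real \<Rightarrow> 'a::locally_convex_space"
  shows "has_velocity \<gamma> l \<Longrightarrow> has_velocity \<gamma> l' \<Longrightarrow> l = l'"
  unfolding has_velocity_def using tendsto_unique[of "at (0::real)"] by simp

lemma has_velocity_cong:
  assumes "\<forall>\<^sub>F t in at 0. \<gamma> t = \<delta> t" "\<gamma> 0 = \<delta> 0"
  shows "has_velocity \<gamma> l \<longleftrightarrow> has_velocity \<delta> l"
  unfolding has_velocity_def
  by (rule filterlim_cong) (use assms in \<open>auto elim: eventually_mono\<close>)

lemma has_velocity_add:
  "has_velocity \<gamma> l \<Longrightarrow> has_velocity \<delta> m \<Longrightarrow> has_velocity (\<lambda>t. \<gamma> t + \<delta> t) (l + m)"
  unfolding has_velocity_def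
  by (drule (1) tendsto_add) (simp add: algebra_simps)

lemma has_velocity_scale:
  "has_velocity \<gamma> l \<Longrightarrow> has_velocity (\<lambda>t. c *\<^sub>R \<gamma> t) (c *\<^sub>R l)"
  unfolding has_velocity_def
  by (drule tendsto_scaleR_lc[OF tendsto_const[of c]]) (simp add: algebra_simps)

lemma has_velocity_const [simp]: "has_velocity (\<lambda>t. a) 0"
  unfolding has_velocity_def by simp

lemma has_velocity_line: "has_velocity (\<lambda>t. a + t *\<^sub>R u) u"
  unfolding has_velocity_def
  by (rule tendsto_eventually) (simp add: eventually_at_filter)

lemma has_velocity_diff:
  assumes "has_velocity \<gamma> l" "has_velocity \<delta> k"
  shows "has_velocity (\<lambda>t. \<gamma> t - \<delta> t) (l - k)"
  using has_velocity_add[OF assms(1) has_velocity_scale[OF assms(2), of "-1"]] by simp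

lemma has_velocity_compose_scale:
  assumes "has_velocity \<gamma> l"
  shows "has_velocity (\<lambda>t. \<gamma> (r * t)) (r *\<^sub>R l)"
proof (cases "r = 0")
  case False
  have "filterlim (\<lambda>t. r * t) (at 0) (at 0)"
    unfolding filterlim_at using False
    by (auto intro!: tendsto_eq_intros simp: eventually_at_filter)
  from filterlim_compose[OF assms[unfolded has_velocity_def] this]
  have "((\<lambda>t. r *\<^sub>R ((1 / (r * t)) *\<^sub>R (\<gamma> (r * t) - \<gamma> 0))) \<longlongrightarrow> r *\<^sub>R l) (at 0)"
    by (rule tendsto_scaleR_lc[OF tendsto_const])
  then show ?thesis using False unfolding has_velocity_def by simp
qed simp

lemma has_velocity_tendsto:
  assumes "has_velocity \<gamma> l"
  shows "(\<gamma> \<longlongrightarrow> \<gamma> 0) (at 0)"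
proof -
  have "((\<lambda>t. \<gamma> 0 + t *\<^sub>R ((1 / t) *\<^sub>R (\<gamma> t - \<gamma> 0))) \<longlongrightarrow> \<gamma> 0 + 0 *\<^sub>R l) (at 0)"
    by (intro tendsto_add tendsto_const tendsto_scaleR_lc tendsto_ident_at
          assms[unfolded has_velocity_def])
  moreover have "\<forall>\<^sub>F t in at 0. \<gamma> 0 + t *\<^sub>R ((1 / t) *\<^sub>R (\<gamma> t - \<gamma> 0)) = \<gamma> t"
    by (auto simp: eventually_at_filter)
  ultimately show ?thesis by (simp add: tendsto_cong)
qed

lemma convex_mean_quotient:
  fixes p q :: "'a::real_vector"
  assumes "convex V" "a < x" "x < b"
    and "(1 / (x - a)) *\<^sub>R p \<in> V" "(1 / (b - x)) *\<^sub>R q \<in> V"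
  shows "(1 / (b - a)) *\<^sub>R (p + q) \<in> V"
proof -
  have "((x - a) / (b - a)) *\<^sub>R ((1 / (x - a)) *\<^sub>R p) + ((b - x) / (b - a)) *\<^sub>R ((1 / (b - x)) *\<^sub>R q) \<in> V"
    using assms by (intro convexD) (auto simp flip: add_divide_distrib)
  also have "((x - a) / (b - a)) *\<^sub>R ((1 / (x - a)) *\<^sub>R p) + ((b - x) / (b - a)) *\<^sub>R ((1 / (b - x)) *\<^sub>R q)
      = (1 / (b - a)) *\<^sub>R (p + q)"
    using assms by (simp add: algebra_simps)
  finally show ?thesis .
qed

text \<open>The difference quotients of \<open>\<gamma>\<close> over small intervals lie in \<open>V\<close> because \<open>V\<close> is open, and the quotient
over a union of adjacent intervals is a convex combination of theirs. Since \<open>V\<close> need not contain \<open>0\<close>, this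
locates difference quotients near a given vector without seminorms or functionals.\<close>

lemma mean_value_convex:
  fixes \<gamma> :: "real \<Rightarrow> 'a::locally_convex_tvs"
  assumes "open V" "convex V"
    and der: "\<And>s. 0 \<le> s \<Longrightarrow> s \<le> 1 \<Longrightarrow> has_velocity (\<lambda>t. \<gamma> (s + t)) (\<gamma>' s)"
    and mem: "\<And>s. 0 \<le> s \<Longrightarrow> s \<le> 1 \<Longrightarrow> \<gamma>' s \<in> V"
  shows "\<gamma> 1 - \<gamma> 0 \<in> V"
proof -
  let ?P = "\<lambda>a b. a < b \<longrightarrow> (1 / (b - a)) *\<^sub>R (\<gamma> b - \<gamma> a) \<in> V"
  have trans: "?P a c" if "?P a b" "?P b c" "a \<le> b" "b \<le> c" for a b c
    using convex_mean_quotient[OF assms(2), of a b c "\<gamma> b - \<gamma> a" "\<gamma> c - \<gamma> b"] that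
    by (cases "a = b"; cases "b = c") auto
  have "?P 0 1"
  proof (rule Bolzano[of 0 1 ?P])
    fix x :: real assume x: "0 \<le> x" "x \<le> 1"
    have "\<forall>\<^sub>F t in at 0. (1 / t) *\<^sub>R (\<gamma> (x + t) - \<gamma> (x + 0)) \<in> V"
      using topological_tendstoD[OF der[OF x, unfolded has_velocity_def] assms(1) mem[OF x]] .
    then obtain d where d: "d > 0"
      "\<And>t. t \<noteq> 0 \<Longrightarrow> \<bar>t\<bar> < d \<Longrightarrow> (1 / t) *\<^sub>R (\<gamma> (x + t) - \<gamma> x) \<in> V"
      unfolding eventually_at by (auto simp: dist_real_def)
    have "?P a b" if "a \<le> x" "x \<le> b" "b - a < d" for a b
    proof (rule trans[of a x b])
      show "?P a x"
      proof
        assume "a < x"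
        have "(1 / (a - x)) *\<^sub>R (\<gamma> a - \<gamma> x) \<in> V"
          using d(2)[of "a - x"] \<open>a < x\<close> that by auto
        moreover have "(1 / (a - x)) *\<^sub>R (\<gamma> a - \<gamma> x) = (1 / (x - a)) *\<^sub>R (\<gamma> x - \<gamma> a)"
        proof -
          have "1 / (a - x) = - (1 / (x - a))" using \<open>a < x\<close> by (simp add: field_simps)
          then show ?thesis by (simp only: scaleR_minus_left) (simp add: algebra_simps)
        qed
        ultimately show "(1 / (x - a)) *\<^sub>R (\<gamma> x - \<gamma> a) \<in> V" by simp
      qed
      show "?P x b"
        using d(2)[of "b - x"] that by auto
    qed (use that in auto)
    then show "\<exists>d>0. \<forall>a b. a \<le> x \<and> x \<le> b \<and> b - a < d \<longrightarrow> ?P a b"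
      using d(1) by blast
  qed (use trans in \<open>auto\<close>)
  then show ?thesis by simp
qed

section \<open>Iterated directional derivatives\<close>

lemma iter_deriv_cong:
  "(\<And>i. i < k \<Longrightarrow> v i = w i) \<Longrightarrow> iter_deriv f k x v = iter_deriv f k x w"
proof (induction k arbitrary: x)
  case (Suc k)
  then have "iter_deriv f k y v = iter_deriv f k y w" for y by simp
  with Suc.prems show ?case by simp
qed simp

lemma iter_deriv_upd [simp]: "k \<le> i \<Longrightarrow> iter_deriv f k x (v(i := u)) = iter_deriv f k x v"
  by (rule iter_deriv_cong) auto

lemma mb_smooth_mem:
  "mb_smooth_on E F U f \<Longrightarrow> x \<in> U \<Longrightarrow> v \<in> UNIV \<rightarrow> E \<Longrightarrow> iter_deriv f k x v \<in> F"
  unfolding mb_smooth_on_def by blast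

lemma mb_smooth_openin: "mb_smooth_on E F U f \<Longrightarrow> openin (top_of_set E) U"
  unfolding mb_smooth_on_def by blast

lemma mb_smooth_maps:
  "mb_smooth_on E F U f \<Longrightarrow> subspace E \<Longrightarrow> x \<in> U \<Longrightarrow> f x \<in> F"
  using mb_smooth_mem[of E F U f x "\<lambda>_. 0" 0] by (auto simp: subspace_0)

lemma mb_smooth_velocity:
  assumes "mb_smooth_on E F U f" "x \<in> U" "v \<in> UNIV \<rightarrow> E"
  shows "has_velocity (\<lambda>t. iter_deriv f k (x + t *\<^sub>R v k) v) (iter_deriv f (Suc k) x v)"
proof -
  from assms obtain l where
    l: "((\<lambda>t. (1 / t) *\<^sub>R (iter_deriv f k (x + t *\<^sub>R v k) v - iter_deriv f k x v)) \<longlongrightarrow> l) (at 0)"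
    unfolding mb_smooth_on_def by blast
  then have "iter_deriv f (Suc k) x v = l"
    unfolding iter_deriv.simps dir_deriv_def by (intro tendsto_Lim) auto
  with l show ?thesis unfolding has_velocity_def by simp
qed

lemma mb_smooth_velocity_upd:
  assumes "mb_smooth_on E F U f" "x \<in> U" "v \<in> UNIV \<rightarrow> E" "u \<in> E"
  shows "has_velocity (\<lambda>t. iter_deriv f k (x + t *\<^sub>R u) v) (iter_deriv f (Suc k) x (v(k := u)))"
  using mb_smooth_velocity[OF assms(1,2), of "v(k := u)" k] assms(3,4)
  by (auto simp del: iter_deriv.simps simp: Pi_iff)

lemma mb_smooth_continuous:
  assumes "mb_smooth_on E F U f"
  shows "continuous_on (U \<times> (UNIV \<rightarrow> E)) (\<lambda>(x, v). iter_deriv f k x v)"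
  using assms unfolding mb_smooth_on_def by blast

lemma mb_smooth_tendsto:
  assumes "mb_smooth_on E F U f"
    and "(b \<longlongrightarrow> x) \<F>" "\<And>i. ((\<lambda>t. w t i) \<longlongrightarrow> v i) \<F>"
    and "x \<in> U" "v \<in> UNIV \<rightarrow> E" "\<forall>\<^sub>F t in \<F>. b t \<in> U" "\<forall>\<^sub>F t in \<F>. w t \<in> UNIV \<rightarrow> E"
  shows "((\<lambda>t. iter_deriv f k (b t) (w t)) \<longlongrightarrow> iter_deriv f k x v) \<F>"
proof -
  have "(w \<longlongrightarrow> v) \<F>" using assms(3) unfolding tendsto_fun_iff by blast
  then have "((\<lambda>t. (b t, w t)) \<longlongrightarrow> (x, v)) \<F>" using assms(2) by (intro tendsto_Pair)
  moreover have "\<forall>\<^sub>F t in \<F>. (b t, w t) \<in> U \<times> (UNIV \<rightarrow> E)"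
    using assms(6,7) by eventually_elim auto
  ultimately show ?thesis
    using continuous_on_tendsto_compose[OF mb_smooth_continuous[OF assms(1), of k],
        of "\<lambda>t. (b t, w t)" "(x, v)" \<F>] assms(4,5) by auto
qed

text \<open>The base point, the direction and the parameters may all move with \<open>t\<close>: by the mean value theorem the
quotient lies in any convex neighbourhood that contains the derivative along the segment, and joint
continuity controls the derivative near \<open>x\<close>. This is what upgrades mere directional differentiability to a
chain rule.\<close>

lemma iter_deriv_quotient:
  fixes g :: "'e::locally_convex_space \<Rightarrow> 'f::locally_convex_space"
  assumes sm: "mb_smooth_on E F U g" and E: "subspace E"
    and b: "(b \<longlongrightarrow> x) \<F>" and u: "(u \<longlongrightarrow> \<xi>) \<F>" and w: "\<And>i. ((\<lambda>t. w t i) \<longlongrightarrow> v i) \<F>"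
    and r: "(r \<longlongrightarrow> (0::real)) \<F>" "\<forall>\<^sub>F t in \<F>. r t \<noteq> 0"
    and mem: "x \<in> U" "\<xi> \<in> E" "v \<in> UNIV \<rightarrow> E"
    and ev: "\<forall>\<^sub>F t in \<F>. b t \<in> U" "\<forall>\<^sub>F t in \<F>. u t \<in> E" "\<forall>\<^sub>F t in \<F>. w t \<in> UNIV \<rightarrow> E"
  shows "((\<lambda>t. (1 / r t) *\<^sub>R (iter_deriv g k (b t + r t *\<^sub>R u t) (w t) - iter_deriv g k (b t) (w t)))
           \<longlongrightarrow> iter_deriv g (Suc k) x (v(k := \<xi>))) \<F>" (is "(?q \<longlongrightarrow> ?l) _")
proof (rule topological_tendstoI)
  fix W assume "open W" "?l \<in> W"
  then obtain V where V: "open V" "?l \<in> V" "V \<subseteq> W" "convex V" by (rule convex_nbhd)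
  obtain U' where U': "open U'" "U = E \<inter> U'"
    using mb_smooth_openin[OF sm] unfolding openin_open by blast
  let ?H = "\<lambda>(x, v). iter_deriv g (Suc k) x v"
  obtain O' where O': "open O'" "O' \<inter> (U \<times> (UNIV \<rightarrow> E)) = ?H -` V \<inter> (U \<times> (UNIV \<rightarrow> E))"
    using mb_smooth_continuous[OF sm, of "Suc k", unfolded continuous_on_open_invariant,
        rule_format, OF V(1)]
    by - (erule exE, erule conjE, rule that)
  have "(x, v(k := \<xi>)) \<in> ?H -` V \<inter> (U \<times> (UNIV \<rightarrow> E))" using V(2) mem by (auto simp: Pi_iff)
  then have "(x, v(k := \<xi>)) \<in> O'" using O'(2) by blast
  from open_prod_elim[OF O'(1) this] obtain A B
    where AB: "open A" "open B" "x \<in> A" "v(k := \<xi>) \<in> B" "A \<times> B \<subseteq> O'"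
    by (metis mem_Sigma_iff)
  have "open (A \<inter> U')" "x \<in> A \<inter> U'" using AB U' mem(1) by auto
  then obtain C where C: "open C" "x \<in> C" "C \<subseteq> A \<inter> U'" "convex C" by (rule convex_nbhd)
  have "((\<lambda>t. b t + r t *\<^sub>R u t) \<longlongrightarrow> x + 0 *\<^sub>R \<xi>) \<F>"
    by (intro tendsto_add b tendsto_scaleR_lc r u)
  then have "\<forall>\<^sub>F t in \<F>. b t + r t *\<^sub>R u t \<in> C"
    using topological_tendstoD[OF _ C(1)] C(2) by simp
  moreover have "\<forall>\<^sub>F t in \<F>. b t \<in> C" using topological_tendstoD[OF b C(1,2)] .
  moreover have "((\<lambda>t. (w t)(k := u t)) \<longlongrightarrow> v(k := \<xi>)) \<F>"
    unfolding tendsto_fun_iff using w u by (auto simp: fun_upd_def)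
  from topological_tendstoD[OF this AB(2,4)]
  have "\<forall>\<^sub>F t in \<F>. (w t)(k := u t) \<in> B" .
  ultimately have "\<forall>\<^sub>F t in \<F>. ?q t \<in> V" using r(2) ev
  proof eventually_elim
    case (elim t)
    define y where "y s = b t + (s * r t) *\<^sub>R u t" for s
    have y: "y s \<in> U" "y s \<in> A" if "0 \<le> s" "s \<le> 1" for s
    proof -
      have "y s = (1 - s) *\<^sub>R b t + s *\<^sub>R (b t + r t *\<^sub>R u t)" by (simp add: y_def algebra_simps)
      also have "\<dots> \<in> C" using elim C(4) that by (intro convexD) auto
      finally have "y s \<in> C" .
      moreover have "y s \<in> E"
        unfolding y_def using elim U'(2) E by (auto intro!: subspace_add subspace_scale)
      ultimately show "y s \<in> U" "y s \<in> A" using C(3) U'(2) by auto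
    qed
    define \<gamma> where "\<gamma> s = (1 / r t) *\<^sub>R iter_deriv g k (y s) (w t)" for s
    define \<gamma>' where "\<gamma>' s = iter_deriv g (Suc k) (y s) ((w t)(k := u t))" for s
    have "\<gamma> 1 - \<gamma> 0 \<in> V"
    proof (rule mean_value_convex[OF V(1,4)])
      fix s :: real assume s: "0 \<le> s" "s \<le> 1"
      have "has_velocity (\<lambda>\<tau>. iter_deriv g k (y s + \<tau> *\<^sub>R u t) (w t)) (\<gamma>' s)"
        unfolding \<gamma>'_def using mb_smooth_velocity_upd[OF sm y(1)[OF s]] elim by blast
      from has_velocity_scale[OF has_velocity_compose_scale[OF this, of "r t"], of "1 / r t"]
      have "has_velocity (\<lambda>\<tau>. (1 / r t) *\<^sub>R iter_deriv g k (y s + (r t * \<tau>) *\<^sub>R u t) (w t)) (\<gamma>' s)"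
        using elim by simp
      then show "has_velocity (\<lambda>\<tau>. \<gamma> (s + \<tau>)) (\<gamma>' s)"
        unfolding \<gamma>_def y_def by (simp add: algebra_simps)
      have "(y s, (w t)(k := u t)) \<in> ?H -` V \<inter> (U \<times> (UNIV \<rightarrow> E))"
        unfolding O'(2)[symmetric] using AB(5) elim y[OF s] by (auto simp: Pi_iff)
      then show "\<gamma>' s \<in> V" unfolding \<gamma>'_def by (simp del: iter_deriv.simps)
    qed
    then show "?q t \<in> V" by (simp add: \<gamma>_def y_def algebra_simps)
  qed
  then show "\<forall>\<^sub>F t in \<F>. ?q t \<in> W" by eventually_elim (use V(3) in blast)
qed


lemma openin_eventually:
  assumes "openin (top_of_set E) U" "(b \<longlongrightarrow> x) \<F>" "x \<in> U" "\<forall>\<^sub>F t in \<F>. b t \<in> E"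
  shows "\<forall>\<^sub>F t in \<F>. b t \<in> U"
proof -
  from assms(1) obtain U' where U': "open U'" "U = E \<inter> U'" unfolding openin_open by blast
  have "\<forall>\<^sub>F t in \<F>. b t \<in> U'" using topological_tendstoD[OF assms(2) U'(1)] assms(3) U'(2) by blast
  with assms(4) show ?thesis by eventually_elim (use U' in blast)
qed

lemma line_eventually:
  fixes E :: "'e::locally_convex_tvs set"
  assumes "openin (top_of_set E) U" "subspace E" "x \<in> U" "u \<in> E"
  shows "\<forall>\<^sub>F t in at 0. x + t *\<^sub>R u \<in> U"
proof (rule openin_eventually[OF assms(1) _ assms(3)])
  have "((\<lambda>t. x + t *\<^sub>R u) \<longlongrightarrow> x + 0 *\<^sub>R u) (at 0)"
    by (intro tendsto_add tendsto_const tendsto_scaleR_lc tendsto_ident_at)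
  then show "((\<lambda>t. x + t *\<^sub>R u) \<longlongrightarrow> x) (at 0)" by simp
  have "x \<in> E" using openin_imp_subset[OF assms(1)] assms(3) by blast
  then show "\<forall>\<^sub>F t in at 0. x + t *\<^sub>R u \<in> E"
    using assms by (intro always_eventually allI subspace_add subspace_scale)
qed

lemma iter_deriv_last_scale:
  assumes sm: "mb_smooth_on E F U g" and "subspace E" "x \<in> U" "v \<in> UNIV \<rightarrow> E" "u \<in> E"
  shows "iter_deriv g (Suc k) x (v(k := c *\<^sub>R u)) = c *\<^sub>R iter_deriv g (Suc k) x (v(k := u))"
proof (rule has_velocity_unique)
  show "has_velocity (\<lambda>t. iter_deriv g k (x + t *\<^sub>R c *\<^sub>R u) v) (iter_deriv g (Suc k) x (v(k := c *\<^sub>R u)))"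
    using assms by (intro mb_smooth_velocity_upd[OF sm] subspace_scale)
  show "has_velocity (\<lambda>t. iter_deriv g k (x + t *\<^sub>R c *\<^sub>R u) v) (c *\<^sub>R iter_deriv g (Suc k) x (v(k := u)))"
    using has_velocity_compose_scale[OF mb_smooth_velocity_upd[OF sm assms(3-5)], where r = c]
    by (simp add: mult.commute del: iter_deriv.simps)
qed

text \<open>Moving by \<open>t (u + u')\<close> is moving by \<open>t u\<close> and then by \<open>t u'\<close>; the quotient of the second step is taken at
a moving base point, whence \<open>iter_deriv_quotient\<close>.\<close>

lemma iter_deriv_last_add:
  assumes sm: "mb_smooth_on E F U g" and E: "subspace E" and x: "x \<in> U" and v: "v \<in> UNIV \<rightarrow> E"
    and u: "u \<in> E" "u' \<in> E"
  shows "iter_deriv g (Suc k) x (v(k := u + u'))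
       = iter_deriv g (Suc k) x (v(k := u)) + iter_deriv g (Suc k) x (v(k := u'))"
proof (rule has_velocity_unique)
  have op: "openin (top_of_set E) U" by (rule mb_smooth_openin[OF sm])
  show "has_velocity (\<lambda>t. iter_deriv g k (x + t *\<^sub>R (u + u')) v) (iter_deriv g (Suc k) x (v(k := u + u')))"
    by (intro mb_smooth_velocity_upd[OF sm] subspace_add u v x E)
  let ?D = "\<lambda>y. iter_deriv g k y v"
  have "((\<lambda>t. x + t *\<^sub>R u) \<longlongrightarrow> x + 0 *\<^sub>R u) (at 0)"
    by (intro tendsto_add tendsto_const tendsto_scaleR_lc tendsto_ident_at)
  then have "((\<lambda>t. (1 / t) *\<^sub>R (?D (x + t *\<^sub>R u + t *\<^sub>R u') - ?D (x + t *\<^sub>R u)))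
      \<longlongrightarrow> iter_deriv g (Suc k) x (v(k := u'))) (at 0)"
    by (intro iter_deriv_quotient[OF sm E])
       (use u v x line_eventually[OF op E x u(1)] in
         \<open>auto simp: eventually_at_filter\<close>)
  moreover have "((\<lambda>t. (1 / t) *\<^sub>R (?D (x + t *\<^sub>R u) - ?D x))
      \<longlongrightarrow> iter_deriv g (Suc k) x (v(k := u))) (at 0)"
    using mb_smooth_velocity_upd[OF sm x v u(1)] unfolding has_velocity_def by simp
  ultimately show "has_velocity (\<lambda>t. ?D (x + t *\<^sub>R (u + u')))
      (iter_deriv g (Suc k) x (v(k := u)) + iter_deriv g (Suc k) x (v(k := u')))"
    unfolding has_velocity_def using tendsto_add
    by (fastforce simp: algebra_simps simp del: iter_deriv.simps)
qed

text \<open>Linearity in an earlier direction survives each further differentiation, because a limit of maps linear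
in a parameter is linear in it.\<close>

lemma iter_deriv_slot_linear:
  assumes sm: "mb_smooth_on E F U g" and E: "subspace E"
    and "x \<in> U" "v \<in> UNIV \<rightarrow> E" "a \<in> E" "b \<in> E" "i < k"
  shows "iter_deriv g k x (v(i := a + c *\<^sub>R b))
       = iter_deriv g k x (v(i := a)) + c *\<^sub>R iter_deriv g k x (v(i := b))"
  using assms(3-)
proof (induction k arbitrary: x)
  case (Suc k)
  show ?case
  proof (cases "i = k")
    case True
    have "c *\<^sub>R b \<in> E" using Suc E by (intro subspace_scale)
    then show ?thesis unfolding True
      using iter_deriv_last_add[OF sm E Suc.prems(1,2,3)] iter_deriv_last_scale[OF sm E Suc.prems(1,2,4)]
      by metis
  next
    case False
    then have ik: "i < k" using Suc.prems by simp
    let ?D = "\<lambda>z t. iter_deriv g k (x + t *\<^sub>R v k) (v(i := z))"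
    have vel: "has_velocity (?D z) (iter_deriv g (Suc k) x (v(i := z)))" if "z \<in> E" for z
      using mb_smooth_velocity[OF sm Suc.prems(1), of "v(i := z)" k] that Suc.prems(2) ik
      by (auto simp: Pi_iff simp del: iter_deriv.simps)
    have vk: "v k \<in> E" using Suc.prems(2) by auto
    have mem: "a + c *\<^sub>R b \<in> E" using Suc E by (intro subspace_scale subspace_add)
    have "\<forall>\<^sub>F t in at 0. x + t *\<^sub>R v k \<in> U"
      by (rule line_eventually[OF mb_smooth_openin[OF sm] E Suc.prems(1) vk])
    then have ev: "\<forall>\<^sub>F t in at 0. ?D (a + c *\<^sub>R b) t = ?D a t + c *\<^sub>R ?D b t"
      by eventually_elim (use Suc ik in blast)
    have eq: "?D (a + c *\<^sub>R b) 0 = ?D a 0 + c *\<^sub>R ?D b 0"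
      using Suc.IH[OF Suc.prems(1-4) ik] by (simp only: scaleR_zero_left add_0_right)
    have "has_velocity (?D (a + c *\<^sub>R b))
        (iter_deriv g (Suc k) x (v(i := a)) + c *\<^sub>R iter_deriv g (Suc k) x (v(i := b)))"
      by (rule has_velocity_cong[THEN iffD2, OF ev eq])
        (rule has_velocity_add[OF vel[OF Suc.prems(3)] has_velocity_scale[OF vel[OF Suc.prems(4)]]])
    with vel[OF mem] show ?thesis by (rule has_velocity_unique)
  qed
qed simp

lemma iter_deriv_slot_diff:
  assumes sm: "mb_smooth_on E F U g" and E: "subspace E"
    and "x \<in> U" "v \<in> UNIV \<rightarrow> E" "a \<in> E" "b \<in> E" "i < k"
  shows "c *\<^sub>R (iter_deriv g k x (v(i := a)) - iter_deriv g k x (v(i := b)))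
       = iter_deriv g k x (v(i := c *\<^sub>R (a - b)))"
proof -
  have ab: "a - b \<in> E" "c *\<^sub>R (a - b) \<in> E"
    using assms by (auto intro: subspace_diff subspace_scale)
  have "iter_deriv g k x (v(i := a)) = iter_deriv g k x (v(i := b)) + iter_deriv g k x (v(i := a - b))"
    using iter_deriv_slot_linear[OF assms(1-4,6) ab(1) assms(7), of 1] by simp
  moreover have "iter_deriv g k x (v(i := c *\<^sub>R (a - b))) = c *\<^sub>R iter_deriv g k x (v(i := a - b))"
    using iter_deriv_slot_linear[OF assms(1-4) subspace_0[OF E] ab(1) assms(7), of c]
      iter_deriv_slot_linear[OF assms(1-4) subspace_0[OF E] subspace_0[OF E] assms(7), of 1] by simp
  ultimately show ?thesis by simp
qed

text \<open>The increment splits into the change of the point with the new directions held, a difference quotient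
at a fixed base point, and the change of the directions one at a time, where multilinearity turns
each step into a single iterated derivative.\<close>

lemma iter_deriv_chain:
  fixes g :: "'e::locally_convex_space \<Rightarrow> 'f::locally_convex_space"
  assumes sm: "mb_smooth_on E F U g" and E: "subspace E"
    and p: "has_velocity p p'" "p' \<in> E" "p 0 \<in> U" "\<forall>\<^sub>F t in at 0. p t \<in> U"
    and w: "\<And>i. has_velocity (\<lambda>t. w t i) (w' i)" "w' \<in> UNIV \<rightarrow> E" "w 0 \<in> UNIV \<rightarrow> E"
      "\<forall>\<^sub>F t in at 0. w t \<in> UNIV \<rightarrow> E"
  shows "has_velocity (\<lambda>t. iter_deriv g k (p t) (w t))
    (iter_deriv g (Suc k) (p 0) ((w 0)(k := p')) + (\<Sum>i<k. iter_deriv g k (p 0) ((w 0)(i := w' i))))"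
proof -
  have UE: "U \<subseteq> E" using mb_smooth_openin[OF sm] openin_imp_subset by blast
  \<comment> \<open>the directions after the first \<open>i\<close> of them have been moved\<close>
  define z where "z t i l = (if l < i then w t l else w 0 l)" for t and i l :: nat
  have wlim: "((\<lambda>t. w t l) \<longlongrightarrow> w 0 l) (at 0)" for l
    using has_velocity_tendsto[OF w(1)] .
  have part1: "((\<lambda>t. (1 / t) *\<^sub>R (iter_deriv g k (p 0 + t *\<^sub>R ((1 / t) *\<^sub>R (p t - p 0))) (w t)
        - iter_deriv g k (p 0) (w t))) \<longlongrightarrow> iter_deriv g (Suc k) (p 0) ((w 0)(k := p'))) (at 0)"
  proof (intro iter_deriv_quotient[OF sm E])
    show "((\<lambda>t. (1 / t) *\<^sub>R (p t - p 0)) \<longlongrightarrow> p') (at 0)" using p(1) unfolding has_velocity_def .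
    show "\<forall>\<^sub>F t in at 0. (1 / t) *\<^sub>R (p t - p 0) \<in> E" using p(4)
      by eventually_elim (use p(3) UE E in \<open>auto intro!: subspace_scale subspace_diff\<close>)
  qed (use p w wlim in \<open>auto simp: eventually_at_filter\<close>)
  have part2: "((\<lambda>t. (1 / t) *\<^sub>R (iter_deriv g k (p 0) (z t (Suc i)) - iter_deriv g k (p 0) (z t i)))
      \<longlongrightarrow> iter_deriv g k (p 0) ((w 0)(i := w' i))) (at 0)" if "i < k" for i
  proof -
    have "((\<lambda>t. iter_deriv g k (p 0) ((z t i)(i := (1 / t) *\<^sub>R (w t i - w 0 i))))
        \<longlongrightarrow> iter_deriv g k (p 0) ((w 0)(i := w' i))) (at 0)"
    proof (intro mb_smooth_tendsto[OF sm])
      fix l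
      show "((\<lambda>t. ((z t i)(i := (1 / t) *\<^sub>R (w t i - w 0 i))) l) \<longlongrightarrow> ((w 0)(i := w' i)) l) (at 0)"
        using w(1)[of i, unfolded has_velocity_def] wlim[of l]
        by (cases "l = i"; cases "l < i") (simp_all add: z_def)
      show "\<forall>\<^sub>F t in at 0. (z t i)(i := (1 / t) *\<^sub>R (w t i - w 0 i)) \<in> UNIV \<rightarrow> E" using w(4)
        by eventually_elim (use w(3) E in \<open>auto simp: z_def Pi_iff intro!: subspace_scale subspace_diff\<close>)
    qed (use p w in \<open>auto simp: Pi_iff\<close>)
    moreover have "\<forall>\<^sub>F t in at 0. iter_deriv g k (p 0) ((z t i)(i := (1 / t) *\<^sub>R (w t i - w 0 i)))
       = (1 / t) *\<^sub>R (iter_deriv g k (p 0) (z t (Suc i)) - iter_deriv g k (p 0) (z t i))"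
      using w(4)
    proof eventually_elim
      case (elim t)
      have "z t (Suc i) = (z t i)(i := w t i)" "z t i = (z t i)(i := w 0 i)"
        by (auto simp: z_def fun_eq_iff less_Suc_eq)
      moreover have "z t i \<in> UNIV \<rightarrow> E" using elim w(3) by (auto simp: z_def Pi_iff)
      moreover have "w t i \<in> E" "w 0 i \<in> E" using elim w(3) by auto
      ultimately show ?case
        using iter_deriv_slot_diff[OF sm E p(3) _ _ _ that, of "z t i" "w t i" "w 0 i" "1 / t"] by metis
    qed
    ultimately show ?thesis using tendsto_cong by fast
  qed
  have part2': "((\<lambda>t. \<Sum>i<k. (1 / t) *\<^sub>R (iter_deriv g k (p 0) (z t (Suc i)) - iter_deriv g k (p 0) (z t i)))
      \<longlongrightarrow> (\<Sum>i<k. iter_deriv g k (p 0) ((w 0)(i := w' i)))) (at 0)"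
    by (intro tendsto_sum part2) auto
  have tel: "(\<Sum>i<k. (1 / t) *\<^sub>R (iter_deriv g k (p 0) (z t (Suc i)) - iter_deriv g k (p 0) (z t i)))
     = (1 / t) *\<^sub>R (iter_deriv g k (p 0) (w t) - iter_deriv g k (p 0) (w 0))" for t
  proof -
    have "iter_deriv g k (p 0) (z t k) = iter_deriv g k (p 0) (w t)"
      by (rule iter_deriv_cong) (simp add: z_def)
    moreover have "z t 0 = w 0" by (simp add: z_def fun_eq_iff)
    ultimately show ?thesis
      unfolding scaleR_sum_right[symmetric] using sum_lessThan_telescope[of "\<lambda>i. iter_deriv g k (p 0) (z t i)" k]
      by simp
  qed
  show ?thesis
    unfolding has_velocity_def
    apply (rule tendsto_cong[THEN iffD1, OF _ tendsto_add[OF part1 part2']])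
    unfolding tel by (auto simp: eventually_at_filter algebra_simps)
qed

section \<open>Families of class n\<close>

text \<open>Families that are \<open>n\<close> times differentiable in \<open>x\<close>, each differentiation being in the direction of some
entry of the parameter sequence \<open>v\<close>. The usual recursion, \<open>f\<close> is of class \<open>n + 1\<close> if its differential on
\<open>U \<times> E\<close> is of class \<open>n\<close>, changes the type at each step; here the directions are stored in advance in a
sequence, so that the derivative of a family is again a family of the same type.\<close>

fun C_family ::
  "'e::locally_convex_space set \<Rightarrow> 'f::locally_convex_space set \<Rightarrow> 'e set \<Rightarrow> nat \<Rightarrow>
   ('e \<Rightarrow> (nat \<Rightarrow> 'e) \<Rightarrow> 'f) \<Rightarrow> bool" where
  "C_family E F U 0 G \<longleftrightarrow>
     (\<forall>x\<in>U. \<forall>v\<in>UNIV \<rightarrow> E. G x v \<in> F) \<and> continuous_on (U \<times> (UNIV \<rightarrow> E)) (\<lambda>(x, v). G x v)"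
| "C_family E F U (Suc n) G \<longleftrightarrow>
     C_family E F U 0 G \<and>
     (\<forall>l. \<exists>G'. C_family E F U n G' \<and>
        (\<forall>x\<in>U. \<forall>v\<in>UNIV \<rightarrow> E. has_velocity (\<lambda>t. G (x + t *\<^sub>R v l) v) (G' x v)))"

lemma C_family_0: "C_family E F U n G \<Longrightarrow> C_family E F U 0 G"
  by (cases n) auto

lemma C_family_mem: "C_family E F U n G \<Longrightarrow> x \<in> U \<Longrightarrow> v \<in> UNIV \<rightarrow> E \<Longrightarrow> G x v \<in> F"
  by (drule C_family_0) auto

lemma C_family_tendsto:
  assumes "C_family E F U n G" "x \<in> U" "v \<in> UNIV \<rightarrow> E"
  shows "((\<lambda>p. G (fst p) (snd p)) \<longlongrightarrow> G x v) (at (x, v) within U \<times> (UNIV \<rightarrow> E))"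
proof -
  have "continuous_on (U \<times> (UNIV \<rightarrow> E)) (\<lambda>(x, v). G x v)"
    using C_family_0[OF assms(1)] by simp
  then show ?thesis using assms(2,3) unfolding continuous_on_def by (auto simp: case_prod_unfold)
qed

lemma C_family_0I:
  assumes "\<And>x v. x \<in> U \<Longrightarrow> v \<in> UNIV \<rightarrow> E \<Longrightarrow> G x v \<in> F"
    and "\<And>x v. x \<in> U \<Longrightarrow> v \<in> UNIV \<rightarrow> E \<Longrightarrow>
      ((\<lambda>p. G (fst p) (snd p)) \<longlongrightarrow> G x v) (at (x, v) within U \<times> (UNIV \<rightarrow> E))"
  shows "C_family E F U 0 G"
  using assms unfolding C_family.simps(1) continuous_on_def by (auto simp: case_prod_unfold)

lemma C_family_derivative:
  assumes "C_family E F U (Suc n) G"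
  obtains G' where "C_family E F U n G'"
    "\<And>x v. x \<in> U \<Longrightarrow> v \<in> UNIV \<rightarrow> E \<Longrightarrow> has_velocity (\<lambda>t. G (x + t *\<^sub>R v l) v) (G' x v)"
proof -
  from assms[unfolded C_family.simps(2)] have "\<exists>G'. C_family E F U n G' \<and>
      (\<forall>x\<in>U. \<forall>v\<in>UNIV \<rightarrow> E. has_velocity (\<lambda>t. G (x + t *\<^sub>R v l) v) (G' x v))"
    by (elim conjE) (erule allE)
  then show ?thesis using that by (elim exE conjE) simp
qed

lemma C_family_SucI:
  assumes "C_family E F U 0 G"
    and "\<And>l. \<exists>G'. C_family E F U n G' \<and>
      (\<forall>x\<in>U. \<forall>v\<in>UNIV \<rightarrow> E. has_velocity (\<lambda>t. G (x + t *\<^sub>R v l) v) (G' x v))"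
  shows "C_family E F U (Suc n) G"
  unfolding C_family.simps(2) using assms by (intro conjI allI)

lemma C_family_Suc: "C_family E F U (Suc n) G \<Longrightarrow> C_family E F U n G"
proof (induction n arbitrary: G)
  case (Suc n)
  have "\<exists>G'. C_family E F U n G' \<and>
      (\<forall>x\<in>U. \<forall>v\<in>UNIV \<rightarrow> E. has_velocity (\<lambda>t. G (x + t *\<^sub>R v l) v) (G' x v))" for l
  proof -
    obtain G' where G': "C_family E F U (Suc n) G'"
      "\<And>x v. x \<in> U \<Longrightarrow> v \<in> UNIV \<rightarrow> E \<Longrightarrow> has_velocity (\<lambda>t. G (x + t *\<^sub>R v l) v) (G' x v)"
      using C_family_derivative[OF Suc.prems, of l] by blast
    then show ?thesis using Suc.IH[OF G'(1)] by (intro exI[of _ G'] conjI ballI)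
  qed
  then show ?case by (rule C_family_SucI[OF C_family_0[OF Suc.prems]])
qed simp

lemma C_family_cong:
  assumes "C_family E F U n G" and U: "openin (top_of_set E) U" "subspace E"
    and eq: "\<And>x v. x \<in> U \<Longrightarrow> v \<in> UNIV \<rightarrow> E \<Longrightarrow> G x v = H x v"
  shows "C_family E F U n H"
proof -
  have 0: "C_family E F U 0 H"
  proof -
    have "continuous_on (U \<times> (UNIV \<rightarrow> E)) (\<lambda>(x, v). H x v) \<longleftrightarrow>
          continuous_on (U \<times> (UNIV \<rightarrow> E)) (\<lambda>(x, v). G x v)"
      by (rule continuous_on_cong) (auto simp: eq)
    then show ?thesis using C_family_0[OF assms(1)] by (auto simp: eq)
  qed
  show ?thesis
  proof (cases n)
    case (Suc m)
    have "\<exists>G'. C_family E F U m G' \<and>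
        (\<forall>x\<in>U. \<forall>v\<in>UNIV \<rightarrow> E. has_velocity (\<lambda>t. H (x + t *\<^sub>R v l) v) (G' x v))" for l
    proof -
      obtain G' where G': "C_family E F U m G'"
        "\<And>x v. x \<in> U \<Longrightarrow> v \<in> UNIV \<rightarrow> E \<Longrightarrow> has_velocity (\<lambda>t. G (x + t *\<^sub>R v l) v) (G' x v)"
        using C_family_derivative[OF assms(1)[unfolded Suc], of l] by blast
      have "has_velocity (\<lambda>t. H (x + t *\<^sub>R v l) v) (G' x v)" if "x \<in> U" "v \<in> UNIV \<rightarrow> E" for x v
      proof (rule has_velocity_cong[THEN iffD1, OF _ _ G'(2)[OF that]])
        have "v l \<in> E" using that by auto
        from line_eventually[OF U that(1) this]
        show "\<forall>\<^sub>F t in at 0. G (x + t *\<^sub>R v l) v = H (x + t *\<^sub>R v l) v"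
          by eventually_elim (use eq that in auto)
      qed (use eq that in simp)
      with G'(1) show ?thesis by blast
    qed
    then show ?thesis unfolding Suc by (rule C_family_SucI[OF 0])
  qed (use 0 in simp)
qed

lemma C_family_fixed:
  assumes "continuous_on (UNIV \<rightarrow> E) h" "\<And>v. v \<in> UNIV \<rightarrow> E \<Longrightarrow> h v \<in> F" "subspace F"
  shows "C_family E F U n (\<lambda>x v. h v)"
proof -
  have "continuous_on (U \<times> (UNIV \<rightarrow> E)) (\<lambda>p. h (snd p))"
    by (rule continuous_on_compose2[OF assms(1)]) (auto intro: continuous_intros)
  then have 0: "C_family E F U 0 (\<lambda>x v. h v)" using assms(2) by (auto simp: case_prod_unfold)
  have z: "C_family E F U m (\<lambda>x v. 0)" for m
    by (induction m) (use subspace_0[OF assms(3)] in \<open>auto intro!: exI[of _ "\<lambda>x v. 0"]\<close>)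
  show ?thesis
    by (cases n) (use 0 z in \<open>auto intro!: exI[of _ "\<lambda>x v. 0"]\<close>)
qed

lemma C_family_const: "c \<in> F \<Longrightarrow> subspace F \<Longrightarrow> C_family E F U n (\<lambda>x v. c)"
  by (intro C_family_fixed) auto

lemma C_family_dir: "subspace E \<Longrightarrow> C_family E E U n (\<lambda>x v. v l)"
proof (rule C_family_fixed)
  show "continuous_on (UNIV \<rightarrow> E) (\<lambda>v. v l)"
    by (rule continuous_on_subset[OF continuous_on_product_coordinates]) simp
qed auto

lemma C_family_id:
  assumes "subspace E" "U \<subseteq> E"
  shows "C_family E E U n (\<lambda>x v. x)"
proof -
  have 0: "C_family E E U 0 (\<lambda>x v. x)"
    using assms by (auto simp: case_prod_unfold intro: continuous_intros)
  show ?thesis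
  proof (cases n)
    case (Suc m)
    have "\<exists>G'. C_family E E U m G' \<and>
        (\<forall>x\<in>U. \<forall>v\<in>UNIV \<rightarrow> E. has_velocity (\<lambda>t. x + t *\<^sub>R v l) (G' x v))" for l
      using C_family_dir[OF assms(1)] has_velocity_line by fast
    then show ?thesis unfolding Suc by (rule C_family_SucI[OF 0])
  qed (use 0 in simp)
qed

lemma C_family_add:
  assumes F: "subspace F"
  shows "C_family E F U n G \<Longrightarrow> C_family E F U n H \<Longrightarrow> C_family E F U n (\<lambda>x v. G x v + H x v)"
proof (induction n arbitrary: G H)
  have base: "C_family E F U 0 (\<lambda>x v. G x v + H x v)" if GH: "C_family E F U 0 G" "C_family E F U 0 H" for G H
    by (rule C_family_0I)
      (use F C_family_mem[OF GH(1)] C_family_mem[OF GH(2)] C_family_tendsto[OF GH(1)] C_family_tendsto[OF GH(2)]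
        in \<open>auto intro!: tendsto_add subspace_add\<close>)
  {
  case 0
  then show ?case by (rule base)
next
  case (Suc n)
  have "\<exists>K. C_family E F U n K \<and>
     (\<forall>x\<in>U. \<forall>v\<in>UNIV \<rightarrow> E. has_velocity (\<lambda>t. G (x + t *\<^sub>R v l) v + H (x + t *\<^sub>R v l) v) (K x v))" for l
  proof -
    obtain G' where G': "C_family E F U n G'"
      "\<And>x v. x \<in> U \<Longrightarrow> v \<in> UNIV \<rightarrow> E \<Longrightarrow> has_velocity (\<lambda>t. G (x + t *\<^sub>R v l) v) (G' x v)"
      using C_family_derivative[OF Suc.prems(1), of l] by blast
    obtain H' where H': "C_family E F U n H'"
      "\<And>x v. x \<in> U \<Longrightarrow> v \<in> UNIV \<rightarrow> E \<Longrightarrow> has_velocity (\<lambda>t. H (x + t *\<^sub>R v l) v) (H' x v)"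
      using C_family_derivative[OF Suc.prems(2), of l] by blast
    show ?thesis
      using Suc.IH[OF G'(1) H'(1)] has_velocity_add[OF G'(2) H'(2)]
      by (intro exI[of _ "\<lambda>x v. G' x v + H' x v"] conjI ballI)
  qed
  then show ?case by (rule C_family_SucI[OF base[OF Suc.prems[THEN C_family_0]]])
  }
qed

lemma C_family_sum:
  assumes "subspace F" "finite I" "\<And>i. i \<in> I \<Longrightarrow> C_family E F U n (G i)"
  shows "C_family E F U n (\<lambda>x v. \<Sum>i\<in>I. G i x v)"
  using assms(2,3)
proof (induction I rule: finite_induct)
  case empty
  then show ?case using C_family_const[OF subspace_0[OF assms(1)] assms(1)] by simp
next
  case (insert i I)
  then show ?case
    using C_family_add[OF assms(1), of E U n "G i" "\<lambda>x v. \<Sum>i\<in>I. G i x v"] by simp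
qed

lemma linear_onD:
  assumes "linear_on X Y L" "subspace X"
  shows "x \<in> X \<Longrightarrow> L x \<in> Y" "x \<in> X \<Longrightarrow> y \<in> X \<Longrightarrow> L (x + y) = L x + L y"
    "x \<in> X \<Longrightarrow> L (c *\<^sub>R x) = c *\<^sub>R L x" "L 0 = 0"
    "x \<in> X \<Longrightarrow> y \<in> X \<Longrightarrow> L (x - y) = L x - L y"
proof -
  show *: "x \<in> X \<Longrightarrow> L x \<in> Y" "x \<in> X \<Longrightarrow> y \<in> X \<Longrightarrow> L (x + y) = L x + L y"
    "x \<in> X \<Longrightarrow> L (c *\<^sub>R x) = c *\<^sub>R L x" for x y c
    using assms(1) unfolding linear_on_def by auto
  show "L 0 = 0" using *(3)[OF subspace_0[OF assms(2)], of 0] by simp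
  show "x \<in> X \<Longrightarrow> y \<in> X \<Longrightarrow> L (x - y) = L x - L y"
    using *(2)[of x "(-1) *\<^sub>R y"] *(3)[of y "-1"] subspace_scale[OF assms(2), of y "-1"] by simp
qed

lemma has_velocity_linear:
  assumes L: "linear_on F H L" "continuous_on F L" and F: "subspace F"
    and \<gamma>: "has_velocity \<gamma> l" "l \<in> F" "\<gamma> 0 \<in> F" "\<forall>\<^sub>F t in at 0. \<gamma> t \<in> F"
  shows "has_velocity (\<lambda>t. L (\<gamma> t)) (L l)"
proof -
  have "\<forall>\<^sub>F t in at 0. (1 / t) *\<^sub>R (\<gamma> t - \<gamma> 0) \<in> F" using \<gamma>(4)
    by eventually_elim (use F \<gamma>(3) in \<open>auto intro!: subspace_scale subspace_diff\<close>)
  from continuous_on_tendsto_compose[OF L(2) \<gamma>(1)[unfolded has_velocity_def] \<gamma>(2) this]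
  have lim: "((\<lambda>t. L ((1 / t) *\<^sub>R (\<gamma> t - \<gamma> 0))) \<longlongrightarrow> L l) (at 0)" .
  have "\<forall>\<^sub>F t in at 0. L ((1 / t) *\<^sub>R (\<gamma> t - \<gamma> 0)) = (1 / t) *\<^sub>R (L (\<gamma> t) - L (\<gamma> 0))"
    using \<gamma>(4)
    by eventually_elim (use F \<gamma>(3) in \<open>simp add: linear_onD[OF L(1) F] subspace_diff\<close>)
  with lim show ?thesis unfolding has_velocity_def using tendsto_cong by fast
qed

lemma C_family_linear:
  assumes L: "linear_on F H L" "continuous_on F L" and F: "subspace F"
    and U: "openin (top_of_set E) U" "subspace E"
  shows "C_family E F U n G \<Longrightarrow> C_family E H U n (\<lambda>x v. L (G x v))"
proof (induction n arbitrary: G)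
  have base: "C_family E H U 0 (\<lambda>x v. L (G x v))" if G: "C_family E F U 0 G" for G
  proof (rule C_family_0I)
    fix x v assume xv: "x \<in> U" "v \<in> (UNIV :: nat set) \<rightarrow> E"
    show "L (G x v) \<in> H" using C_family_mem[OF G xv] linear_onD[OF L(1) F] by blast
    show "((\<lambda>p. L (G (fst p) (snd p))) \<longlongrightarrow> L (G x v)) (at (x, v) within U \<times> (UNIV \<rightarrow> E))"
      by (intro continuous_on_tendsto_compose[OF L(2)] C_family_tendsto[OF G] C_family_mem[OF G] xv)
        (use C_family_mem[OF G] in \<open>auto simp: eventually_at_filter intro!: always_eventually\<close>)
  qed
  {
  case 0
  then show ?case by (rule base)
next
  case (Suc n)
  have "\<exists>K. C_family E H U n K \<and>
     (\<forall>x\<in>U. \<forall>v\<in>UNIV \<rightarrow> E. has_velocity (\<lambda>t. L (G (x + t *\<^sub>R v l) v)) (K x v))" for l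
  proof -
    obtain G' where G': "C_family E F U n G'"
      "\<And>x v. x \<in> U \<Longrightarrow> v \<in> UNIV \<rightarrow> E \<Longrightarrow> has_velocity (\<lambda>t. G (x + t *\<^sub>R v l) v) (G' x v)"
      using C_family_derivative[OF Suc.prems, of l] by blast
    have "has_velocity (\<lambda>t. L (G (x + t *\<^sub>R v l) v)) (L (G' x v))" if xv: "x \<in> U" "v \<in> UNIV \<rightarrow> E" for x v
    proof (rule has_velocity_linear[OF L F])
      have "v l \<in> E" using xv by auto
      from line_eventually[OF U xv(1) this]
      show "\<forall>\<^sub>F t in at 0. G (x + t *\<^sub>R v l) v \<in> F"
        by eventually_elim (use C_family_mem[OF Suc.prems] xv in auto)
    qed (use G' xv C_family_mem[OF Suc.prems xv] C_family_mem[OF G'(1) xv] in auto)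
    then show ?thesis
      using Suc.IH[OF G'(1)] by (intro exI[of _ "\<lambda>x v. L (G' x v)"] conjI ballI)
  qed
  then show ?case by (rule C_family_SucI[OF base[OF C_family_0[OF Suc.prems]]])
  }
qed

text \<open>The chain rule to all orders. One differentiation produces the next iterated derivative of \<open>g\<close> with one
more direction inserted and the same iterated derivative with one direction differentiated
(\<open>iter_deriv_chain\<close>); all of these are of the form covered by the induction hypothesis, so that no
combinatorial formula is needed.\<close>

lemma C_family_iter_deriv:
  fixes g :: "'f::locally_convex_space \<Rightarrow> 'h::locally_convex_space"
  assumes sm: "mb_smooth_on F H V g" and F: "subspace F" and H: "subspace H"
    and U: "openin (top_of_set E) U" "subspace E"
  shows "C_family E F U n \<phi> \<Longrightarrow> (\<And>i. C_family E F U n (w i)) \<Longrightarrow>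
     (\<And>x v. x \<in> U \<Longrightarrow> v \<in> UNIV \<rightarrow> E \<Longrightarrow> \<phi> x v \<in> V) \<Longrightarrow>
     C_family E H U n (\<lambda>x v. iter_deriv g k (\<phi> x v) (\<lambda>i. w i x v))"
proof (induction n arbitrary: \<phi> w k)
  have base: "C_family E H U 0 (\<lambda>x v. iter_deriv g k (\<phi> x v) (\<lambda>i. w i x v))"
    if \<phi>: "C_family E F U 0 \<phi>" and w: "\<And>i. C_family E F U 0 (w i)"
      and V: "\<And>x v. x \<in> U \<Longrightarrow> v \<in> UNIV \<rightarrow> E \<Longrightarrow> \<phi> x v \<in> V" for \<phi> w k
  proof (rule C_family_0I)
    fix x v assume xv: "x \<in> U" "v \<in> (UNIV :: nat set) \<rightarrow> E"
    show "iter_deriv g k (\<phi> x v) (\<lambda>i. w i x v) \<in> H"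
      using C_family_mem[OF w] V xv by (intro mb_smooth_mem[OF sm]) auto
    show "((\<lambda>p. iter_deriv g k (\<phi> (fst p) (snd p)) (\<lambda>i. w i (fst p) (snd p))) \<longlongrightarrow>
        iter_deriv g k (\<phi> x v) (\<lambda>i. w i x v)) (at (x, v) within U \<times> (UNIV \<rightarrow> E))"
      by (intro mb_smooth_tendsto[OF sm] C_family_tendsto[OF \<phi>] C_family_tendsto[OF w] xv)
        (use C_family_mem[OF w] V xv in \<open>auto simp: eventually_at_filter Pi_iff intro!: always_eventually\<close>)
  qed
  {
  case (0 \<phi> w k)
  then show ?case by (rule base)
next
  case (Suc n \<phi> w k)
  note w0 = C_family_0[OF Suc.prems(2)]
  have "\<exists>K. C_family E H U n K \<and> (\<forall>x\<in>U. \<forall>v\<in>UNIV \<rightarrow> E.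
     has_velocity (\<lambda>t. iter_deriv g k (\<phi> (x + t *\<^sub>R v l) v) (\<lambda>i. w i (x + t *\<^sub>R v l) v)) (K x v))" for l
  proof -
    obtain \<phi>' where \<phi>': "C_family E F U n \<phi>'"
      "\<And>x v. x \<in> U \<Longrightarrow> v \<in> UNIV \<rightarrow> E \<Longrightarrow> has_velocity (\<lambda>t. \<phi> (x + t *\<^sub>R v l) v) (\<phi>' x v)"
      using C_family_derivative[OF Suc.prems(1), of l] by blast
    have "\<exists>G'. C_family E F U n G' \<and>
      (\<forall>x\<in>U. \<forall>v\<in>UNIV \<rightarrow> E. has_velocity (\<lambda>t. w i (x + t *\<^sub>R v l) v) (G' x v))" for i
      using C_family_derivative[OF Suc.prems(2)[of i], of l] by metis
    then obtain w' where w': "\<And>i. C_family E F U n (w' i)"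
      "\<And>i x v. x \<in> U \<Longrightarrow> v \<in> UNIV \<rightarrow> E \<Longrightarrow> has_velocity (\<lambda>t. w i (x + t *\<^sub>R v l) v) (w' i x v)"
      by metis
    note \<phi>n = C_family_Suc[OF Suc.prems(1)] and wn = C_family_Suc[OF Suc.prems(2)]
    define K where "K x v = iter_deriv g (Suc k) (\<phi> x v) ((\<lambda>i. w i x v)(k := \<phi>' x v)) +
       (\<Sum>i<k. iter_deriv g k (\<phi> x v) ((\<lambda>i. w i x v)(i := w' i x v)))" for x v
    have upd: "(\<lambda>i. w i x v)(j := z x v) = (\<lambda>i. (if i = j then z else w i) x v)" for j z x v
      by auto
    have "C_family E H U n K"
      unfolding K_def upd
      by (intro C_family_add C_family_sum H Suc.IH \<phi>n Suc.prems(3))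
        (use wn w' \<phi>' in \<open>auto\<close>)
    moreover have "has_velocity (\<lambda>t. iter_deriv g k (\<phi> (x + t *\<^sub>R v l) v) (\<lambda>i. w i (x + t *\<^sub>R v l) v)) (K x v)"
      if xv: "x \<in> U" "v \<in> UNIV \<rightarrow> E" for x v
    proof -
      have vl: "v l \<in> E" using xv by auto
      note ev = line_eventually[OF U xv(1) vl]
      have "\<forall>\<^sub>F t in at 0. \<phi> (x + t *\<^sub>R v l) v \<in> V"
        using ev by eventually_elim (use Suc.prems(3) xv in auto)
      moreover have "\<forall>\<^sub>F t in at 0. (\<lambda>i. w i (x + t *\<^sub>R v l) v) \<in> UNIV \<rightarrow> F"
        using ev by eventually_elim (use C_family_mem[OF w0] xv in auto)
      ultimately show ?thesis
        using iter_deriv_chain[OF sm F, of "\<lambda>t. \<phi> (x + t *\<^sub>R v l) v" "\<phi>' x v"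
            "\<lambda>t i. w i (x + t *\<^sub>R v l) v" "\<lambda>i. w' i x v" k]
          \<phi>'(2)[OF xv] w'(2)[OF xv] C_family_mem[OF \<phi>'(1) xv] C_family_mem[OF w'(1) xv]
          C_family_mem[OF w0 xv] Suc.prems(3)[OF xv]
        by (simp add: K_def Pi_iff del: iter_deriv.simps)
    qed
    ultimately show ?thesis by blast
  qed
  moreover have "C_family E H U 0 (\<lambda>x v. iter_deriv g k (\<phi> x v) (\<lambda>i. w i x v))"
    by (intro base C_family_0[OF Suc.prems(1)] w0 Suc.prems(3))
  ultimately show ?case by (intro C_family_SucI)
  }
qed

text \<open>A smooth map is its own iterated derivative of order \<open>0\<close>, so one direction is an instance of the chain rule.
Conversely the derivative of \<open>iter_deriv f k\<close> in direction \<open>v k\<close> is \<open>iter_deriv f (Suc k)\<close>.\<close>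

lemma C_family_iff_mb_smooth:
  assumes E: "subspace E" and F: "subspace F" and U: "openin (top_of_set E) U"
  shows "mb_smooth_on E F U f \<longleftrightarrow> (\<forall>n. C_family E F U n (\<lambda>x v. f x))"
proof
  assume sm: "mb_smooth_on E F U f"
  have "C_family E F U n (\<lambda>x v. iter_deriv f 0 x (\<lambda>i. v i))" for n
    using C_family_iter_deriv[OF sm E F U E, of n "\<lambda>x v. x" "\<lambda>i x v. v i" 0]
      C_family_id[OF E openin_imp_subset[OF U]] C_family_dir[OF E] by blast
  then show "\<forall>n. C_family E F U n (\<lambda>x v. f x)" by simp
next
  assume C: "\<forall>n. C_family E F U n (\<lambda>x v. f x)"
  have it: "C_family E F U n (iter_deriv f k)" for n k
  proof (induction k arbitrary: n)
    case 0
    then show ?case using C by (simp add: iter_deriv.simps(1)[abs_def])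
  next
    case (Suc k)
    from Suc[of "Suc n"] obtain G' where G': "C_family E F U n G'"
      "\<And>x v. x \<in> U \<Longrightarrow> v \<in> UNIV \<rightarrow> E \<Longrightarrow> has_velocity (\<lambda>t. iter_deriv f k (x + t *\<^sub>R v k) v) (G' x v)"
      using C_family_derivative[of E F U n _ k] by blast
    show ?case
    proof (rule C_family_cong[OF G'(1) U E])
      fix x v assume "x \<in> U" "v \<in> (UNIV :: nat set) \<rightarrow> E"
      from G'(2)[OF this] show "G' x v = iter_deriv f (Suc k) x v"
        unfolding has_velocity_def iter_deriv.simps dir_deriv_def by (intro tendsto_Lim[symmetric]) auto
    qed
  qed
  show "mb_smooth_on E F U f"
    unfolding mb_smooth_on_def
  proof (intro conjI allI ballI)
    fix k
    show "continuous_on (U \<times> (UNIV \<rightarrow> E)) (\<lambda>(x, v). iter_deriv f k x v)"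
      using it[of 0 k] by simp
    fix x v assume xv: "x \<in> U" "v \<in> (UNIV :: nat set) \<rightarrow> E"
    show "iter_deriv f k x v \<in> F" by (rule C_family_mem[OF it xv])
    obtain G' where "C_family E F U 0 G'"
      "has_velocity (\<lambda>t. iter_deriv f k (x + t *\<^sub>R v k) v) (G' x v)"
      using C_family_derivative[OF it[of "Suc 0" k], of k] xv by metis
    then show "\<exists>l\<in>F. ((\<lambda>t. (1 / t) *\<^sub>R (iter_deriv f k (x + t *\<^sub>R v k) v - iter_deriv f k x v)) \<longlongrightarrow> l) (at 0)"
      using C_family_mem[of E F U 0 G'] xv unfolding has_velocity_def by auto
  qed (rule U)
qed


section \<open>Smooth maps\<close>

lemma C_family_0_subset:
  assumes "U' \<subseteq> U" "C_family E F U 0 G"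
  shows "C_family E F U' 0 G"
proof -
  have "U' \<times> (UNIV \<rightarrow> E) \<subseteq> U \<times> (UNIV \<rightarrow> E)" using assms by auto
  with assms show ?thesis
    unfolding C_family.simps(1) using continuous_on_subset by blast
qed

lemma C_family_subset:
  assumes "U' \<subseteq> U"
  shows "C_family E F U n G \<Longrightarrow> C_family E F U' n G"
proof (induction n arbitrary: G)
  case 0
  then show ?case by (rule C_family_0_subset[OF assms])
next
  case (Suc n)
  have 0: "C_family E F U' 0 G"
    by (rule C_family_0_subset[OF assms C_family_0[OF Suc.prems]])
  have "\<exists>G'. C_family E F U' n G' \<and>
      (\<forall>x\<in>U'. \<forall>v\<in>UNIV \<rightarrow> E. has_velocity (\<lambda>t. G (x + t *\<^sub>R v l) v) (G' x v))" for l
  proof -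
    obtain G' where G': "C_family E F U n G'"
      "\<And>x v. x \<in> U \<Longrightarrow> v \<in> UNIV \<rightarrow> E \<Longrightarrow> has_velocity (\<lambda>t. G (x + t *\<^sub>R v l) v) (G' x v)"
      using C_family_derivative[OF Suc.prems, of l] by blast
    show ?thesis
      using Suc.IH[OF G'(1)] G'(2) assms by (intro exI[of _ G'] conjI ballI) auto
  qed
  then show ?case by (rule C_family_SucI[OF 0])
qed

lemma mb_smooth_subset:
  assumes "mb_smooth_on E F U f" "openin (top_of_set E) U'" "U' \<subseteq> U" "subspace E" "subspace F"
  shows "mb_smooth_on E F U' f"
  using assms C_family_subset[OF assms(3)] mb_smooth_openin[OF assms(1)]
  by (metis C_family_iff_mb_smooth)

lemma mb_smooth_cong:
  assumes "mb_smooth_on E F U f" "subspace E" "subspace F" "\<And>x. x \<in> U \<Longrightarrow> f x = g x"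
  shows "mb_smooth_on E F U g"
proof -
  note U = mb_smooth_openin[OF assms(1)]
  show ?thesis
    using assms(1) unfolding C_family_iff_mb_smooth[OF assms(2,3) U]
    using C_family_cong[OF _ U assms(2), of F _ "\<lambda>x v. f x" "\<lambda>x v. g x"] assms(4) by blast
qed

lemma mb_smooth_compose:
  assumes g: "mb_smooth_on F H V g" and f: "mb_smooth_on E F U f" and "f \<in> U \<rightarrow> V"
    and E: "subspace E" and F: "subspace F" and H: "subspace H"
  shows "mb_smooth_on E H U (\<lambda>x. g (f x))"
proof -
  note U = mb_smooth_openin[OF f]
  have "C_family E F U n (\<lambda>x v. f x)" for n using f C_family_iff_mb_smooth[OF E F U] by blast
  then have "C_family E H U n (\<lambda>x v. iter_deriv g 0 (f x) (\<lambda>i. 0))" for n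
    using assms(3) by (intro C_family_iter_deriv[OF g F H U E] C_family_const subspace_0 F) auto
  then show ?thesis using C_family_iff_mb_smooth[OF E H U] by simp
qed

lemma mb_smooth_linear:
  assumes "linear_on E F L" "continuous_on E L" "subspace E" "subspace F"
    and U: "openin (top_of_set E) U"
  shows "mb_smooth_on E F U L"
  unfolding C_family_iff_mb_smooth[OF assms(3,4) U]
  by (intro allI C_family_linear[OF assms(1,2,3) U assms(3)] C_family_id
      openin_imp_subset[OF U] assms(3))

lemma mb_smooth_add:
  assumes "mb_smooth_on E F U f" "mb_smooth_on E F U g" "subspace E" "subspace F"
  shows "mb_smooth_on E F U (\<lambda>x. f x + g x)"
proof -
  note U = mb_smooth_openin[OF assms(1)]
  show ?thesis
    using assms unfolding C_family_iff_mb_smooth[OF assms(3,4) U] by (auto intro: C_family_add)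
qed

lemma mb_smooth_id:
  assumes "subspace E" "openin (top_of_set E) U"
  shows "mb_smooth_on E E U (\<lambda>x. x)"
  using assms by (intro mb_smooth_linear) (auto simp: linear_on_def)

lemma mb_smooth_const:
  assumes "subspace E" "subspace F" "openin (top_of_set E) U" "c \<in> F"
  shows "mb_smooth_on E F U (\<lambda>x. c)"
  unfolding C_family_iff_mb_smooth[OF assms(1-3)] by (intro allI C_family_const assms(4,2))

lemma mb_smooth_scale:
  assumes "mb_smooth_on E F U f" "subspace E" "subspace F"
  shows "mb_smooth_on E F U (\<lambda>x. c *\<^sub>R f x)"
proof (rule mb_smooth_compose[OF _ assms(1)])
  show "mb_smooth_on F F F (\<lambda>y. c *\<^sub>R y)"
  proof (rule mb_smooth_linear)
    show "linear_on F F ((*\<^sub>R) c)"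
      using assms(3) by (auto simp: linear_on_def subspace_scale algebra_simps)
    show "continuous_on F ((*\<^sub>R) c)"
      unfolding continuous_on_def by (auto intro!: tendsto_scaleR_lc tendsto_const tendsto_ident_at)
  qed (use assms in auto)
  show "f \<in> U \<rightarrow> F" using mb_smooth_maps[OF assms(1,2)] by auto
qed (use assms in auto)

lemma mb_smooth_diff:
  assumes "mb_smooth_on E F U f" "mb_smooth_on E F U g" "subspace E" "subspace F"
  shows "mb_smooth_on E F U (\<lambda>x. f x - g x)"
  using mb_smooth_add[OF assms(1) mb_smooth_scale[OF assms(2-4), of "-1"] assms(3,4)] by simp

lemma mb_smooth_continuous_on:
  assumes "mb_smooth_on E F U f" "subspace E"
  shows "continuous_on U f"
  unfolding continuous_on_def
proof
  fix x assume "x \<in> U"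
  have "((\<lambda>y. iter_deriv f 0 y (\<lambda>_. 0)) \<longlongrightarrow> iter_deriv f 0 x (\<lambda>_. 0)) (at x within U)"
    using \<open>x \<in> U\<close> by (intro mb_smooth_tendsto[OF assms(1)])
      (auto simp: eventually_at_filter subspace_0[OF assms(2)])
  then show "(f \<longlongrightarrow> f x) (at x within U)" by simp
qed

lemma dir_deriv_eq_iter: "dir_deriv f x v = iter_deriv f 1 x (\<lambda>_. v)"
  by simp

lemma dir_deriv_mem:
  "mb_smooth_on E F U f \<Longrightarrow> x \<in> U \<Longrightarrow> v \<in> E \<Longrightarrow> dir_deriv f x v \<in> F"
  unfolding dir_deriv_eq_iter by (intro mb_smooth_mem) auto

lemma dir_deriv_velocity:
  assumes "mb_smooth_on E F U f" "x \<in> U" "v \<in> E"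
  shows "has_velocity (\<lambda>t. f (x + t *\<^sub>R v)) (dir_deriv f x v)"
  using mb_smooth_velocity[OF assms(1,2), of "\<lambda>_. v" 0] assms(3) by simp

lemma dir_deriv_tendsto:
  assumes "mb_smooth_on E F U f" "(b \<longlongrightarrow> x) \<F>" "(w \<longlongrightarrow> v) \<F>"
    and "x \<in> U" "v \<in> E" "\<forall>\<^sub>F t in \<F>. b t \<in> U" "\<forall>\<^sub>F t in \<F>. w t \<in> E"
  shows "((\<lambda>t. dir_deriv f (b t) (w t)) \<longlongrightarrow> dir_deriv f x v) \<F>"
  unfolding dir_deriv_eq_iter using assms
  by (intro mb_smooth_tendsto[OF assms(1)]) (auto elim: eventually_mono)

lemma dir_deriv_linear:
  assumes "mb_smooth_on E F U f" "subspace E" "x \<in> U"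
  shows "linear_on E F (dir_deriv f x)"
proof -
  have "dir_deriv f x (a + c *\<^sub>R b) = dir_deriv f x a + c *\<^sub>R dir_deriv f x b"
    if "a \<in> E" "b \<in> E" for a b c
  proof -
    have "iter_deriv f 1 x ((\<lambda>_. 0)(0 := z)) = dir_deriv f x z" for z by simp
    then show ?thesis
      using iter_deriv_slot_linear[OF assms, of "\<lambda>_. 0" a b 0 1 c] that subspace_0[OF assms(2)]
      by (simp del: iter_deriv.simps One_nat_def)
  qed
  note lin = this
  have z: "dir_deriv f x 0 = 0" using lin[OF subspace_0[OF assms(2)] subspace_0[OF assms(2)], of 1] by simp
  have "dir_deriv f x (c *\<^sub>R b) = c *\<^sub>R dir_deriv f x b" if "b \<in> E" for b c
    using lin[OF subspace_0[OF assms(2)] that, of c] z by simp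
  moreover have "dir_deriv f x (a + b) = dir_deriv f x a + dir_deriv f x b" if "a \<in> E" "b \<in> E" for a b
    using lin[OF that, of 1] by simp
  ultimately show ?thesis using dir_deriv_mem[OF assms(1,3)] unfolding linear_on_def by auto
qed

lemma dir_deriv_continuous:
  assumes "mb_smooth_on E F U f" "x \<in> U"
  shows "continuous_on E (dir_deriv f x)"
  unfolding continuous_on_def
  using assms by (auto intro!: dir_deriv_tendsto[OF assms(1)] simp: eventually_at_filter)

lemma dir_deriv_chain_curve:
  assumes g: "mb_smooth_on E F U g" and E: "subspace E"
    and p: "has_velocity p p'" "p' \<in> E" "p 0 \<in> U" "\<forall>\<^sub>F t in at 0. p t \<in> U"
  shows "has_velocity (\<lambda>t. g (p t)) (dir_deriv g (p 0) p')"
  using iter_deriv_chain[OF g E p, of "\<lambda>_ _. 0" "\<lambda>_. 0" 0] subspace_0[OF E] by simp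

lemma has_velocity_dir_deriv:
  "has_velocity (\<lambda>t. f (x + t *\<^sub>R v)) l \<Longrightarrow> dir_deriv f x v = l"
  unfolding has_velocity_def dir_deriv_def by (intro tendsto_Lim) auto

lemma dir_deriv_compose:
  assumes g: "mb_smooth_on F H V g" and f: "mb_smooth_on E F U f" and fx: "f x \<in> V"
    and E: "subspace E" and F: "subspace F" and x: "x \<in> U" "v \<in> E"
  shows "dir_deriv (\<lambda>x. g (f x)) x v = dir_deriv g (f x) (dir_deriv f x v)"
proof -
  have ev: "\<forall>\<^sub>F t in at 0. x + t *\<^sub>R v \<in> U"
    by (rule line_eventually[OF mb_smooth_openin[OF f] E x])
  have "\<forall>\<^sub>F t in at 0. f (x + t *\<^sub>R v) \<in> V"
  proof (rule openin_eventually[OF mb_smooth_openin[OF g] _ fx])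
    show "((\<lambda>t. f (x + t *\<^sub>R v)) \<longlongrightarrow> f x) (at 0)"
      using has_velocity_tendsto[OF dir_deriv_velocity[OF f x]] by simp
    show "\<forall>\<^sub>F t in at 0. f (x + t *\<^sub>R v) \<in> F"
      using ev by eventually_elim (use mb_smooth_maps[OF f E] in blast)
  qed
  then have "has_velocity (\<lambda>t. g (f (x + t *\<^sub>R v))) (dir_deriv g (f (x + 0 *\<^sub>R v)) (dir_deriv f x v))"
    by (intro dir_deriv_chain_curve[OF g F] dir_deriv_velocity[OF f x] dir_deriv_mem[OF f x])
      (use fx in simp_all)
  then show ?thesis by (intro has_velocity_dir_deriv) simp
qed

lemma dir_deriv_cong:
  assumes "mb_smooth_on E F U f" "subspace E" "x \<in> U" "v \<in> E" "\<And>y. y \<in> U \<Longrightarrow> f y = g y"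
  shows "dir_deriv g x v = dir_deriv f x v"
proof (rule has_velocity_dir_deriv)
  have "\<forall>\<^sub>F t in at 0. f (x + t *\<^sub>R v) = g (x + t *\<^sub>R v)"
    using line_eventually[OF mb_smooth_openin[OF assms(1)] assms(2-4)]
    by eventually_elim (use assms(5) in blast)
  from has_velocity_cong[THEN iffD1, OF this _ dir_deriv_velocity[OF assms(1,3,4)]]
  show "has_velocity (\<lambda>t. g (x + t *\<^sub>R v)) (dir_deriv f x v)" using assms by simp
qed

section \<open>Inverting perturbations of the identity with Banach range\<close>

lemma convex_scaled:
  assumes "convex C"
  shows "convex {x. k *\<^sub>R x \<in> C}"
proof (rule convexI)
  fix x y u v
  assume *: "x \<in> {x. k *\<^sub>R x \<in> C}" "y \<in> {x. k *\<^sub>R x \<in> C}" "0 \<le> u" "0 \<le> v" "u + v = (1::real)"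
  have "k *\<^sub>R (u *\<^sub>R x + v *\<^sub>R y) = u *\<^sub>R (k *\<^sub>R x) + v *\<^sub>R (k *\<^sub>R y)"
    by (simp add: scaleR_add_right mult.commute)
  also have "\<dots> \<in> C" using * assms by (intro convexD) auto
  finally show "u *\<^sub>R x + v *\<^sub>R y \<in> {x. k *\<^sub>R x \<in> C}" by simp
qed

lemma open_scaled_lc:
  fixes C :: "'a::locally_convex_tvs set"
  assumes "open C"
  shows "open {x. k *\<^sub>R x \<in> C}"
proof -
  have "continuous_on UNIV (\<lambda>x::'a. k *\<^sub>R x)"
    unfolding continuous_on_def by (auto intro!: tendsto_scaleR_lc tendsto_const tendsto_ident_at)
  then show ?thesis using assms by (simp add: continuous_on_open_vimage vimage_def)
qed

lemma fixpoint_estimate: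
  fixes b :: "'f::real_normed_vector"
  assumes "K \<beta> = \<beta>" "norm (K \<beta> - K b) \<le> 1/2 * norm (\<beta> - b)"
  shows "norm (\<beta> - b) \<le> 2 * norm (K b - b)"
proof -
  have "norm (\<beta> - b) \<le> norm (K \<beta> - K b) + norm (K b - b)"
    using norm_triangle_ineq[of "K \<beta> - K b" "K b - b"] assms(1) by simp
  with assms(2) show ?thesis by linarith
qed

text \<open>Continuous dependence of fixed points of half-contractions requires continuity of \<open>K\<close> only at the one argument \<open>b\<close>.\<close>

lemma fixpoint_tendsto:
  fixes \<beta> :: "'p \<Rightarrow> 'f::real_normed_vector"
  assumes "((\<lambda>p. K p b) \<longlongrightarrow> b) \<F>"
    and "\<forall>\<^sub>F p in \<F>. K p (\<beta> p) = \<beta> p \<and> norm (K p (\<beta> p) - K p b) \<le> 1/2 * norm (\<beta> p - b)"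
  shows "(\<beta> \<longlongrightarrow> b) \<F>"
proof -
  have "((\<lambda>p. \<beta> p - b) \<longlongrightarrow> 0) \<F>"
  proof (rule Lim_null_comparison)
    show "\<forall>\<^sub>F p in \<F>. norm (\<beta> p - b) \<le> 2 * norm (K p b - b)"
      using assms(2) by eventually_elim (auto intro: fixpoint_estimate)
    have "((\<lambda>p. 2 * norm (K p b - b)) \<longlongrightarrow> 2 * norm (b - b)) \<F>"
      by (intro tendsto_intros assms(1))
    then show "((\<lambda>p. 2 * norm (K p b - b)) \<longlongrightarrow> 0) \<F>" by simp
  qed
  then show ?thesis using LIM_zero_iff by blast
qed

text \<open>Implicit differentiation: if the candidate line \<open>\<beta> 0 + t \<gamma>\<close> solves the fixed point equation to first order, then
it is the tangent of the solution, as the distance to a fixed point of a half-contraction is at most twice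
the defect.\<close>

lemma fixpoint_velocity:
  fixes \<beta> :: "real \<Rightarrow> 'f::real_normed_vector"
  assumes "has_velocity (\<lambda>t. K t (\<beta> 0 + t *\<^sub>R \<gamma>)) \<gamma>" "K 0 (\<beta> 0) = \<beta> 0"
    and "\<forall>\<^sub>F t in at 0. K t (\<beta> t) = \<beta> t \<and>
       norm (K t (\<beta> t) - K t (\<beta> 0 + t *\<^sub>R \<gamma>)) \<le> 1/2 * norm (\<beta> t - (\<beta> 0 + t *\<^sub>R \<gamma>))"
  shows "has_velocity \<beta> \<gamma>"
proof -
  let ?q = "\<lambda>t. (1 / t) *\<^sub>R (K t (\<beta> 0 + t *\<^sub>R \<gamma>) - \<beta> 0)"
  have q: "(?q \<longlongrightarrow> \<gamma>) (at 0)" using assms(1,2) unfolding has_velocity_def by simp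
  have "((\<lambda>t. (1 / t) *\<^sub>R (\<beta> t - \<beta> 0) - \<gamma>) \<longlongrightarrow> 0) (at 0)"
  proof (rule Lim_null_comparison)
    have "\<forall>\<^sub>F t in at 0. (t::real) \<noteq> 0" by (simp add: eventually_at_filter)
    with assms(3) show "\<forall>\<^sub>F t in at 0. norm ((1 / t) *\<^sub>R (\<beta> t - \<beta> 0) - \<gamma>) \<le> 2 * norm (?q t - \<gamma>)"
    proof eventually_elim
      case (elim t)
      let ?b = "\<beta> 0 + t *\<^sub>R \<gamma>"
      have "(1 / t) *\<^sub>R (\<beta> t - \<beta> 0) - \<gamma> = (1 / t) *\<^sub>R (\<beta> t - ?b)"
        "?q t - \<gamma> = (1 / t) *\<^sub>R (K t ?b - ?b)" using elim by (simp_all add: algebra_simps)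
      moreover have "norm (\<beta> t - ?b) \<le> 2 * norm (K t ?b - ?b)"
        using elim by (intro fixpoint_estimate) auto
      ultimately show ?case by (simp add: divide_right_mono)
    qed
    have "((\<lambda>t. 2 * norm (?q t - \<gamma>)) \<longlongrightarrow> 2 * norm (\<gamma> - \<gamma>)) (at 0)"
      by (intro tendsto_intros q)
    then show "((\<lambda>t. 2 * norm (?q t - \<gamma>)) \<longlongrightarrow> 0) (at 0)" by simp
  qed
  then show ?thesis unfolding has_velocity_def using LIM_zero_iff by blast
qed

text \<open>The map to be inverted is \<open>x \<mapsto> x - S (Q x)\<close>. The displacement is factored through the complete space \<open>I\<close> because
\<open>E\<close> itself carries no norm.\<close>

locale perturbation =
  fixes E :: "'e::locally_convex_space set" and I :: "'f::real_normed_vector set"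
    and U :: "'e set" and Q :: "'e \<Rightarrow> 'f" and S :: "'f \<Rightarrow> 'e"
  assumes E: "subspace E" and I: "subspace I" and complete: "complete I"
    and Q: "mb_smooth_on E I U Q" and zero: "0 \<in> U" "Q 0 = 0"
    and flat: "\<And>v. v \<in> E \<Longrightarrow> dir_deriv Q 0 v = 0"
    and S: "linear_on I E S" "continuous_on I S"
begin

lemmas S_simps = linear_onD[OF S(1) I]

text \<open>A bound on second derivatives is what replaces continuity of the first derivative in operator norm,
which does not make sense on \<open>E\<close>.\<close>

lemma second_deriv_bounded:
  obtains C where "open C" "convex C" "0 \<in> C" "C \<inter> E \<subseteq> U"
    "\<forall>y\<in>C \<inter> E. \<forall>a\<in>C \<inter> E. \<forall>b\<in>C \<inter> E. norm (iter_deriv Q 2 y ((\<lambda>_. a)(1 := b))) < 1"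
proof -
  let ?H = "\<lambda>(x, v). iter_deriv Q 2 x v"
  have z: "?H (0, \<lambda>_. 0) = 0"
    using iter_deriv_slot_linear[OF Q E zero(1), of "\<lambda>_. 0" 0 0 0 2 1] subspace_0[OF E]
    by (auto simp: fun_upd_idem simp del: iter_deriv.simps)
  obtain O' where O': "open O'" "O' \<inter> (U \<times> (UNIV \<rightarrow> E)) = ?H -` ball 0 1 \<inter> (U \<times> (UNIV \<rightarrow> E))"
    using mb_smooth_continuous[OF Q, of 2, unfolded continuous_on_open_invariant,
        rule_format, OF open_ball[of 0 1]]
    by - (erule exE, erule conjE, rule that)
  have "(0, \<lambda>_. 0) \<in> ?H -` ball 0 1 \<inter> (U \<times> (UNIV \<rightarrow> E))"
    using z zero(1) subspace_0[OF E] by (auto simp del: iter_deriv.simps)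
  then have 0: "(0, \<lambda>_. 0) \<in> O'" using O'(2) by blast
  define h where "h p = (fst p, (\<lambda>_::nat. fst (snd p))(1 := snd (snd p)))" for p :: "'e \<times> 'e \<times> 'e"
  have "continuous_on UNIV h"
    unfolding h_def fun_upd_def
    by (intro continuous_on_Pair continuous_on_coordinatewise_then_product)
       (intro continuous_intros, case_tac "i = 1", auto intro!: continuous_intros)
  then have "open (h -` O')" using O'(1) by (simp add: continuous_on_open_vimage)
  moreover have "(0, 0, 0) \<in> h -` O'" using 0 by (simp add: h_def fun_upd_idem)
  ultimately obtain A B where AB: "open A" "open B" "0 \<in> A" "(0, 0) \<in> B" "A \<times> B \<subseteq> h -` O'"
    by (rule open_prod_elim) auto
  obtain A1 A2 where A12: "open A1" "open A2" "0 \<in> A1" "0 \<in> A2" "A1 \<times> A2 \<subseteq> B"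
    using open_prod_elim[OF AB(2,4)] by (metis mem_Sigma_iff)
  obtain U' where U': "open U'" "U = E \<inter> U'"
    using mb_smooth_openin[OF Q] unfolding openin_open by blast
  have "open (A \<inter> A1 \<inter> A2 \<inter> U')" "0 \<in> A \<inter> A1 \<inter> A2 \<inter> U'" using AB A12 U' zero by auto
  then obtain C where C: "open C" "0 \<in> C" "C \<subseteq> A \<inter> A1 \<inter> A2 \<inter> U'" "convex C"
    by (rule convex_nbhd)
  show ?thesis
  proof (rule that[OF C(1,4,2)])
    show "C \<inter> E \<subseteq> U" using C(3) U'(2) by blast
    show "\<forall>y\<in>C \<inter> E. \<forall>a\<in>C \<inter> E. \<forall>b\<in>C \<inter> E. norm (iter_deriv Q 2 y ((\<lambda>_. a)(1 := b))) < 1"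
    proof (intro ballI)
      fix y a b assume yab: "y \<in> C \<inter> E" "a \<in> C \<inter> E" "b \<in> C \<inter> E"
      then have "(y, a, b) \<in> A \<times> B" using C(3) A12(5) by blast
      then have "h (y, a, b) \<in> O'" using AB(5) by blast
      moreover have "h (y, a, b) \<in> U \<times> (UNIV \<rightarrow> E)"
        using yab C(3) U'(2) by (auto simp: h_def)
      ultimately have "h (y, a, b) \<in> ?H -` ball 0 1 \<inter> (U \<times> (UNIV \<rightarrow> E))"
        unfolding O'(2)[symmetric] by (rule IntI)
      then show "norm (iter_deriv Q 2 y ((\<lambda>_. a)(1 := b))) < 1"
        unfolding Int_iff vimage_eq by (simp add: h_def del: iter_deriv.simps fun_upd_apply)
    qed
  qed
qed

text \<open>On \<open>C\<close> the first derivative varies at most linearly with the point, by the bound on the second one. Hence on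
the scaled set \<open>\<epsilon> C\<close> it is smaller than \<open>\<epsilon>\<close> in all directions from \<open>C\<close>, in particular in the directions
\<open>S c\<close> with \<open>norm c < \<delta>\<close>.\<close>

lemma deriv_contracting:
  obtains D where "openin (top_of_set E) D" "convex D" "0 \<in> D" "D \<subseteq> U"
    "\<And>x c. x \<in> D \<Longrightarrow> c \<in> I \<Longrightarrow> norm (dir_deriv Q x (S c)) \<le> 1/2 * norm c"
proof -
  obtain C where C: "open C" "convex C" "0 \<in> C" "C \<inter> E \<subseteq> U"
    "\<forall>y\<in>C \<inter> E. \<forall>a\<in>C \<inter> E. \<forall>b\<in>C \<inter> E. norm (iter_deriv Q 2 y ((\<lambda>_. a)(1 := b))) < 1"
    by (rule second_deriv_bounded) (rule that)
  have "\<forall>\<^sub>F c in at 0 within I. S c \<in> C"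
    using S(2) subspace_0[OF I] topological_tendstoD[OF _ C(1)] S_simps(4) C(3)
    unfolding continuous_on_def by metis
  then obtain \<delta>0 where \<delta>0: "\<delta>0 > 0" "\<And>c. c \<in> I \<Longrightarrow> c \<noteq> 0 \<Longrightarrow> norm c < \<delta>0 \<Longrightarrow> S c \<in> C"
    unfolding eventually_at by (auto simp: dist_norm)
  define \<delta> where "\<delta> = min \<delta>0 1"
  have \<delta>: "\<delta> > 0" "\<delta> \<le> 1" "\<And>c. c \<in> I \<Longrightarrow> norm c < \<delta> \<Longrightarrow> S c \<in> C"
    using \<delta>0 S_simps(4) C(3) by (auto simp: \<delta>_def) (metis)
  \<comment> \<open>below, \<open>c\<close> is rescaled to norm \<open>\<delta> / 2\<close>, which leaves the factor \<open>2 \<epsilon> / \<delta> = 1/2\<close>\<close>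
  define \<epsilon> where "\<epsilon> = \<delta> / 4"
  have \<epsilon>: "\<epsilon> > 0" "\<epsilon> \<le> 1" using \<delta> by (auto simp: \<epsilon>_def)
  define D where "D = E \<inter> {x. (1 / \<epsilon>) *\<^sub>R x \<in> C}"
  have "open {x. (1 / \<epsilon>) *\<^sub>R x \<in> C}" by (rule open_scaled_lc[OF C(1)])
  then have op: "openin (top_of_set E) D" unfolding D_def by (rule openin_open_Int)
  have cv: "convex D"
  proof -
    have "convex {x. (1 / \<epsilon>) *\<^sub>R x \<in> C}" by (rule convex_scaled[OF C(2)])
    then show ?thesis unfolding D_def using subspace_imp_convex[OF E] by (intro convex_Int)
  qed
  have scaled: "s *\<^sub>R x \<in> C \<inter> E" if "x \<in> D" "0 \<le> s" "s \<le> 1" for x s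
  proof -
    have "(s * \<epsilon>) *\<^sub>R ((1 / \<epsilon>) *\<^sub>R x) + (1 - s * \<epsilon>) *\<^sub>R 0 \<in> C"
      using that \<epsilon> C(2,3) by (intro convexD) (auto simp: D_def mult_le_one)
    moreover have "s *\<^sub>R x \<in> E" using that E by (auto simp: D_def intro: subspace_scale)
    ultimately show ?thesis using \<epsilon> by simp
  qed
  have DU: "D \<subseteq> U" using scaled[of _ 1] C(4) by auto
  have small: "norm (dir_deriv Q x a) < \<epsilon>" if x: "x \<in> D" and a: "a \<in> C \<inter> E" for x a
  proof -
    have "dir_deriv Q (1 *\<^sub>R x) a - dir_deriv Q (0 *\<^sub>R x) a \<in> ball 0 \<epsilon>"
    proof (rule mean_value_convex)
      fix s :: real assume s: "0 \<le> s" "s \<le> 1"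
      have sx: "s *\<^sub>R x \<in> C \<inter> E" by (rule scaled[OF x s])
      then have sU: "s *\<^sub>R x \<in> U" using C(4) by blast
      have xE: "x \<in> E" using x by (simp add: D_def)
      have "has_velocity (\<lambda>t. iter_deriv Q 1 (s *\<^sub>R x + t *\<^sub>R x) (\<lambda>_. a))
          (iter_deriv Q (Suc 1) (s *\<^sub>R x) ((\<lambda>_. a)(1 := x)))"
        using mb_smooth_velocity_upd[OF Q sU _ xE, of "\<lambda>_. a" 1] a by blast
      then show "has_velocity (\<lambda>t. dir_deriv Q ((s + t) *\<^sub>R x) a)
          (iter_deriv Q 2 (s *\<^sub>R x) ((\<lambda>_. a)(1 := x)))"
        unfolding dir_deriv_eq_iter by (simp add: scaleR_add_left numeral_2_eq_2 del: iter_deriv.simps)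
      have x': "(1 / \<epsilon>) *\<^sub>R x \<in> C \<inter> E" using x E by (auto simp: D_def intro: subspace_scale)
      have "iter_deriv Q (Suc 1) (s *\<^sub>R x) ((\<lambda>_. a)(1 := \<epsilon> *\<^sub>R ((1 / \<epsilon>) *\<^sub>R x)))
          = \<epsilon> *\<^sub>R iter_deriv Q (Suc 1) (s *\<^sub>R x) ((\<lambda>_. a)(1 := (1 / \<epsilon>) *\<^sub>R x))"
        using a x' by (intro iter_deriv_last_scale[OF Q E sU]) auto
      then have "iter_deriv Q 2 (s *\<^sub>R x) ((\<lambda>_. a)(1 := x))
          = \<epsilon> *\<^sub>R iter_deriv Q 2 (s *\<^sub>R x) ((\<lambda>_. a)(1 := (1 / \<epsilon>) *\<^sub>R x))"
        using \<epsilon> by (simp add: numeral_2_eq_2 del: iter_deriv.simps)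
      then show "iter_deriv Q 2 (s *\<^sub>R x) ((\<lambda>_. a)(1 := x)) \<in> ball 0 \<epsilon>"
        using C(5)[rule_format, OF sx a x'] \<epsilon> by (simp del: iter_deriv.simps)
    qed auto
    then show ?thesis using flat[of a] a by simp
  qed
  show ?thesis
  proof (rule that[OF op cv _ DU])
    show "0 \<in> D" using C(3) subspace_0[OF E] by (simp add: D_def)
    fix x c assume x: "x \<in> D" and c: "c \<in> I"
    show "norm (dir_deriv Q x (S c)) \<le> 1/2 * norm c"
    proof (cases "c = 0")
      case True
      then show ?thesis using linear_onD(4)[OF dir_deriv_linear[OF Q E] E] x DU S_simps(4) by auto
    next
      case False
      define k where "k = 2 * norm c / \<delta>"
      have k: "k > 0" using False \<delta> by (simp add: k_def)
      have c': "(1 / k) *\<^sub>R c \<in> I" using c I by (intro subspace_scale)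
      have "norm ((1 / k) *\<^sub>R c) < \<delta>" using False \<delta> k by (simp add: k_def field_simps)
      then have a: "S ((1 / k) *\<^sub>R c) \<in> C \<inter> E" using \<delta>(3)[OF c'] S_simps(1)[OF c'] by blast
      have "S c = k *\<^sub>R S ((1 / k) *\<^sub>R c)" using S_simps(3)[OF c', of k] k by simp
      then have "dir_deriv Q x (S c) = k *\<^sub>R dir_deriv Q x (S ((1 / k) *\<^sub>R c))"
        using linear_onD(3)[OF dir_deriv_linear[OF Q E] E] x DU a by auto
      then have "norm (dir_deriv Q x (S c)) \<le> k * \<epsilon>"
        using small[OF x a] k by simp
      also have "k * \<epsilon> = 1/2 * norm c" using \<delta> by (simp add: k_def \<epsilon>_def)
      finally show ?thesis .
    qed
  qed
qed

end

locale contracting_perturbation = perturbation E I U Q S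
  for E :: "'e::locally_convex_space set" and I :: "'f::real_normed_vector set" and U Q S +
  fixes D :: "'e set"
  assumes D: "openin (top_of_set E) D" "convex D" "0 \<in> D" "D \<subseteq> U"
    and contr: "\<And>x c. x \<in> D \<Longrightarrow> c \<in> I \<Longrightarrow> norm (dir_deriv Q x (S c)) \<le> 1/2 * norm c"
begin

lemma DE: "x \<in> D \<Longrightarrow> x \<in> E"
  using openin_imp_subset[OF D(1)] by blast

lemma DU: "x \<in> D \<Longrightarrow> x \<in> U"
  using D(4) by blast

lemmas dQ = linear_onD[OF dir_deriv_linear[OF Q E DU] E]

lemma Q_contracting:
  assumes "x \<in> D" "c \<in> I" "x + S c \<in> D"
  shows "norm (Q (x + S c) - Q x) \<le> 1/2 * norm c"
proof (rule dense_ge)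
  fix r assume r: "1/2 * norm c < r"
  have "Q (x + 1 *\<^sub>R S c) - Q (x + 0 *\<^sub>R S c) \<in> ball 0 r"
  proof (rule mean_value_convex)
    fix s :: real assume s: "0 \<le> s" "s \<le> 1"
    have "x + s *\<^sub>R S c = (1 - s) *\<^sub>R x + s *\<^sub>R (x + S c)" by (simp add: algebra_simps)
    also have "\<dots> \<in> D" using s assms D(2) by (intro convexD) auto
    finally have xs: "x + s *\<^sub>R S c \<in> D" .
    show "has_velocity (\<lambda>t. Q (x + (s + t) *\<^sub>R S c)) (dir_deriv Q (x + s *\<^sub>R S c) (S c))"
      using dir_deriv_velocity[OF Q DU[OF xs] S_simps(1)[OF assms(2)]] by (simp add: algebra_simps)
    show "dir_deriv Q (x + s *\<^sub>R S c) (S c) \<in> ball 0 r"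
      using contr[OF xs assms(2)] r by simp
  qed auto
  then show "norm (Q (x + S c) - Q x) \<le> r" by simp
qed

lemma Q_contracting2:
  assumes "b \<in> I" "b' \<in> I" "y + S b \<in> D" "y + S b' \<in> D"
  shows "norm (Q (y + S b) - Q (y + S b')) \<le> 1/2 * norm (b - b')"
  using Q_contracting[OF assms(4), of "b - b'"] assms I S_simps(5) by (simp add: subspace_diff)

lemma dQ_contracting2:
  assumes "x \<in> D" "\<eta> \<in> E" "b \<in> I" "b' \<in> I"
  shows "norm (dir_deriv Q x (\<eta> + S b) - dir_deriv Q x (\<eta> + S b')) \<le> 1/2 * norm (b - b')"
proof -
  have "dir_deriv Q x (\<eta> + S b) - dir_deriv Q x (\<eta> + S b') = dir_deriv Q x ((\<eta> + S b) - (\<eta> + S b'))"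
    using dQ(5)[OF assms(1), of "\<eta> + S b" "\<eta> + S b'"] assms E S_simps(1) by (simp only: subspace_add)
  also have "(\<eta> + S b) - (\<eta> + S b') = S (b - b')" using S_simps(5) assms by simp
  finally show ?thesis using contr[OF assms(1), of "b - b'"] assms I by (simp add: subspace_diff)
qed

text \<open>For the derivative of the inverse map: \<open>\<xi> = \<eta> + S (corr x \<eta>)\<close> is the solution of the linearised equation
\<open>\<xi> - S (dir_deriv Q x \<xi>) = \<eta>\<close>.\<close>

definition corr :: "'e \<Rightarrow> 'e \<Rightarrow> 'f" where
  "corr x \<eta> = (THE c. c \<in> I \<and> dir_deriv Q x (\<eta> + S c) = c)"

lemma corr:
  assumes "x \<in> D" "\<eta> \<in> E"
  shows "corr x \<eta> \<in> I" "dir_deriv Q x (\<eta> + S (corr x \<eta>)) = corr x \<eta>"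
proof -
  have "\<exists>!c. c \<in> I \<and> dir_deriv Q x (\<eta> + S c) = c"
  proof (rule Banach_fix[OF complete, of "1/2"])
    show "I \<noteq> {}" using subspace_0[OF I] by blast
    show "(\<lambda>c. dir_deriv Q x (\<eta> + S c)) ` I \<subseteq> I"
      using dQ(1)[OF assms(1)] assms E S_simps(1) by (auto intro!: subspace_add)
  qed (use dQ_contracting2[OF assms] in \<open>auto simp: dist_norm\<close>)
  from theI'[OF this] show "corr x \<eta> \<in> I" "dir_deriv Q x (\<eta> + S (corr x \<eta>)) = corr x \<eta>"
    unfolding corr_def by auto
qed

end


context contracting_perturbation
begin

lemma corr_tendsto:
  assumes "(b \<longlongrightarrow> x) \<F>" "(w \<longlongrightarrow> \<eta>) \<F>" "x \<in> D" "\<eta> \<in> E"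
    and "\<forall>\<^sub>F t in \<F>. b t \<in> D" "\<forall>\<^sub>F t in \<F>. w t \<in> E"
  shows "((\<lambda>t. corr (b t) (w t)) \<longlongrightarrow> corr x \<eta>) \<F>"
proof (rule fixpoint_tendsto)
  note c = corr[OF assms(3,4)]
  have "((\<lambda>t. dir_deriv Q (b t) (w t + S (corr x \<eta>))) \<longlongrightarrow> dir_deriv Q x (\<eta> + S (corr x \<eta>))) \<F>"
  proof (rule dir_deriv_tendsto[OF Q assms(1)])
    show "\<forall>\<^sub>F t in \<F>. b t \<in> U" using assms(5) by eventually_elim (rule DU)
    show "\<forall>\<^sub>F t in \<F>. w t + S (corr x \<eta>) \<in> E"
      using assms(6) by eventually_elim (intro subspace_add E S_simps(1) c)
  qed (use c assms DU E S_simps(1) in \<open>auto intro!: tendsto_intros subspace_add\<close>)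
  then show "((\<lambda>t. dir_deriv Q (b t) (w t + S (corr x \<eta>))) \<longlongrightarrow> corr x \<eta>) \<F>"
    using c(2) by simp
  show "\<forall>\<^sub>F t in \<F>. dir_deriv Q (b t) (w t + S (corr (b t) (w t))) = corr (b t) (w t) \<and>
      norm (dir_deriv Q (b t) (w t + S (corr (b t) (w t))) - dir_deriv Q (b t) (w t + S (corr x \<eta>)))
      \<le> 1/2 * norm (corr (b t) (w t) - corr x \<eta>)"
    using assms(5,6) 
  proof eventually_elim
    case (elim t)
    note ct = corr[OF elim]
    show ?case using ct(2) dQ_contracting2[OF elim ct(1) c(1)] by blast
  qed
qed

text \<open>The ball of radius \<open>r\<close> is mapped into itself: half of \<open>r\<close> is used up by the contraction, the other half is
available for \<open>Q y\<close>.\<close>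

lemma solution_box:
  obtains D1 r where "openin (top_of_set E) D1" "0 \<in> D1" "r > 0"
    "\<And>y b. y \<in> D1 \<Longrightarrow> b \<in> I \<Longrightarrow> norm b \<le> r \<Longrightarrow> y + S b \<in> D"
    "\<And>y. y \<in> D1 \<Longrightarrow> norm (Q y) < r / 2"
proof -
  obtain D' where D': "open D'" "D = E \<inter> D'"
    using D(1) unfolding openin_open by blast
  obtain C where C: "open C" "0 \<in> C" "C \<subseteq> D'" "convex C"
    using convex_nbhd[OF D'(1), of 0] D(3) D'(2) by blast
  define H where "H = {x. (2::real) *\<^sub>R x \<in> C}"
  have H: "open H" "0 \<in> H" using open_scaled_lc[OF C(1)] C(2) by (auto simp: H_def)
  have sum: "x + y \<in> C" if "x \<in> H" "y \<in> H" for x y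
    using convexD[OF C(4), of "2 *\<^sub>R x" "2 *\<^sub>R y" "1/2" "1/2"] that by (simp add: H_def)
  have "\<forall>\<^sub>F c in at 0 within I. S c \<in> H"
    using S(2) subspace_0[OF I] topological_tendstoD[OF _ H(1)] S_simps(4) H(2)
    unfolding continuous_on_def by metis
  then obtain r0 where r0: "r0 > 0" "\<And>c. c \<in> I \<Longrightarrow> c \<noteq> 0 \<Longrightarrow> norm c < r0 \<Longrightarrow> S c \<in> H"
    unfolding eventually_at by (auto simp: dist_norm)
  define r where "r = r0 / 2"
  have r: "r > 0" using r0 by (simp add: r_def)
  have Sr: "S c \<in> H" if "c \<in> I" "norm c \<le> r" for c
    using r0(1) r0(2)[OF that(1)] that(2) S_simps(4) H(2) by (cases "c = 0") (auto simp: r_def)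
  define D1 where "D1 = E \<inter> H \<inter> (D \<inter> Q -` ball 0 (r / 2))"
  have "openin (top_of_set D) (D \<inter> Q -` ball 0 (r / 2))"
    using continuous_on_subset[OF mb_smooth_continuous_on[OF Q E] D(4)]
    by (rule continuous_openin_preimage_gen) simp
  then have "openin (top_of_set E) (D \<inter> Q -` ball 0 (r / 2))"
    using D(1) openin_trans by blast
  then have "openin (top_of_set E) D1"
    unfolding D1_def using openin_open_Int[OF H(1), of E] by (rule openin_Int[rotated])
  then show ?thesis
  proof (rule that[OF _ _ r])
    show "0 \<in> D1" using H D(3) DE zero(2) r by (auto simp: D1_def)
    fix y assume y: "y \<in> D1"
    then show "norm (Q y) < r / 2" by (simp add: D1_def)
    fix b assume b: "b \<in> I" "norm b \<le> r"
    have "y + S b \<in> C" using y Sr[OF b] by (intro sum) (auto simp: D1_def)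
    moreover have "y + S b \<in> E" using y b E S_simps(1) by (auto simp: D1_def intro: subspace_add)
    ultimately show "y + S b \<in> D" using C(3) D'(2) by blast
  qed
qed

end

locale solvable_perturbation = contracting_perturbation E I U Q S D
  for E :: "'e::locally_convex_space set" and I :: "'f::real_normed_vector set" and U Q S D +
  fixes D1 :: "'e set" and r :: real
  assumes D1: "openin (top_of_set E) D1" "0 \<in> D1" and r: "r > 0"
    and box: "\<And>y b. y \<in> D1 \<Longrightarrow> b \<in> I \<Longrightarrow> norm b \<le> r \<Longrightarrow> y + S b \<in> D"
    and Q_small: "\<And>y. y \<in> D1 \<Longrightarrow> norm (Q y) < r / 2"
begin

text \<open>The inverse of \<open>x \<mapsto> x - S (Q x)\<close> sends \<open>y\<close> to \<open>y + S b\<close>, where \<open>b\<close> is the common value of \<open>Q\<close> there.\<close>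

definition sol :: "'e \<Rightarrow> 'f" where
  "sol y = (THE b. b \<in> I \<inter> cball 0 r \<and> Q (y + S b) = b)"

lemma Q_box:
  assumes "y \<in> D1" "b \<in> I" "norm b \<le> r"
  shows "norm (Q (y + S b)) < r"
proof -
  have "y \<in> D" using box[OF assms(1) subspace_0[OF I]] r S_simps(4) by simp
  then have "norm (Q (y + S b) - Q y) \<le> 1/2 * norm b"
    by (intro Q_contracting assms box)
  moreover have "norm (Q (y + S b)) \<le> norm (Q (y + S b) - Q y) + norm (Q y)"
    using norm_triangle_ineq[of "Q (y + S b) - Q y" "Q y"] by simp
  ultimately show ?thesis using Q_small[OF assms(1)] assms(3) by linarith
qed

lemma Q_mem: "x \<in> D \<Longrightarrow> Q x \<in> I"
  using mb_smooth_maps[OF Q E] DU by blast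

lemma sol_ex1:
  assumes y: "y \<in> D1"
  shows "\<exists>!b. b \<in> I \<inter> cball 0 r \<and> Q (y + S b) = b"
proof (rule Banach_fix[where c = "1/2"])
  show "complete (I \<inter> cball 0 r)" by (rule complete_Int_closed[OF complete closed_cball])
  show "I \<inter> cball 0 r \<noteq> {}" using subspace_0[OF I] r by auto
  show "(\<lambda>b. Q (y + S b)) ` (I \<inter> cball 0 r) \<subseteq> I \<inter> cball 0 r"
    using Q_box[OF y] Q_mem box[OF y] by (auto simp: less_imp_le)
  fix b b' assume "b \<in> I \<inter> cball 0 r" "b' \<in> I \<inter> cball 0 r"
  then show "dist (Q (y + S b)) (Q (y + S b')) \<le> 1/2 * dist b b'"
    unfolding dist_norm by (intro Q_contracting2 box[OF y]) auto
qed auto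

lemma sol:
  assumes y: "y \<in> D1"
  shows "sol y \<in> I" "norm (sol y) < r" "Q (y + S (sol y)) = sol y"
proof -
  note * = theI'[OF sol_ex1[OF y], folded sol_def]
  then show "sol y \<in> I" "Q (y + S (sol y)) = sol y" by auto
  then show "norm (sol y) < r" using Q_box[OF y, of "sol y"] * by simp
qed

lemma sol_unique:
  assumes "y \<in> D1" "b \<in> I" "norm b \<le> r" "Q (y + S b) = b"
  shows "sol y = b"
  unfolding sol_def using assms by (intro the1_equality[OF sol_ex1]) auto

definition psi :: "'e \<Rightarrow> 'e" where
  "psi y = y + S (sol y)"

lemma psi_mem: "y \<in> D1 \<Longrightarrow> psi y \<in> D"
  unfolding psi_def using sol[of y] by (intro box) auto

lemma sol_continuous: "continuous_on D1 sol"
  unfolding continuous_on_def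
proof
  fix y assume y: "y \<in> D1"
  note s = sol[OF y]
  have ev: "\<forall>\<^sub>F p in at y within D1. p \<in> D1"
    by (auto simp: eventually_at_filter)
  show "(sol \<longlongrightarrow> sol y) (at y within D1)"
  proof (rule fixpoint_tendsto)
    have "((\<lambda>p. Q (p + S (sol y))) \<longlongrightarrow> Q (y + S (sol y))) (at y within D1)"
    proof (rule continuous_on_tendsto_compose[OF mb_smooth_continuous_on[OF Q E]])
      show "\<forall>\<^sub>F p in at y within D1. p + S (sol y) \<in> U"
        using ev by eventually_elim (use s in \<open>auto intro!: DU box\<close>)
      show "y + S (sol y) \<in> U" using psi_mem[OF y] DU by (simp add: psi_def)
    qed (auto intro!: tendsto_add)
    then show "((\<lambda>p. Q (p + S (sol y))) \<longlongrightarrow> sol y) (at y within D1)"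
      using s(3) by simp
    show "\<forall>\<^sub>F p in at y within D1. Q (p + S (sol p)) = sol p \<and>
        norm (Q (p + S (sol p)) - Q (p + S (sol y))) \<le> 1/2 * norm (sol p - sol y)"
      using ev
    proof eventually_elim
      case (elim p)
      have "p + S (sol y) \<in> D" using s by (intro box[OF elim]) auto
      then show ?case
        using sol[OF elim] s psi_mem[OF elim] Q_contracting2[of "sol p" "sol y" p]
        by (simp only: psi_def)
    qed
  qed
qed

lemma psi_continuous: "continuous_on D1 psi"
  unfolding psi_def
proof (intro continuous_on_add continuous_on_id)
  show "continuous_on D1 (\<lambda>y. S (sol y))"
    by (rule continuous_on_compose2[OF S(2) sol_continuous]) (use sol in auto)
qed

text \<open>The line \<open>sol y + t \<gamma>\<close> corresponds to a straight line through \<open>psi y\<close>, along which \<open>Q\<close> is differentiable by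
hypothesis; the curvature of the actual solution is absorbed by \<open>fixpoint_velocity\<close>.\<close>

lemma sol_velocity:
  assumes y: "y \<in> D1" and \<eta>: "\<eta> \<in> E"
  shows "has_velocity (\<lambda>t. sol (y + t *\<^sub>R \<eta>)) (corr (psi y) \<eta>)"
proof -
  define \<gamma> where "\<gamma> = corr (psi y) \<eta>"
  have \<gamma>: "\<gamma> \<in> I" "dir_deriv Q (psi y) (\<eta> + S \<gamma>) = \<gamma>"
    unfolding \<gamma>_def using corr[OF psi_mem[OF y] \<eta>] by auto
  define \<zeta> where "\<zeta> = \<eta> + S \<gamma>"
  have \<zeta>: "\<zeta> \<in> E" unfolding \<zeta>_def using \<eta> \<gamma> E S_simps(1) by (intro subspace_add) auto
  note s = sol[OF y]
  have line: "y + t *\<^sub>R \<eta> + S (sol y + t *\<^sub>R \<gamma>) = psi y + t *\<^sub>R \<zeta>" for t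
    using s \<gamma> I S_simps by (simp add: psi_def \<zeta>_def subspace_scale algebra_simps)
  have "has_velocity (\<lambda>t. sol (y + t *\<^sub>R \<eta>)) \<gamma>"
  proof (rule fixpoint_velocity[where K = "\<lambda>t b. Q (y + t *\<^sub>R \<eta> + S b)"])
    show "has_velocity (\<lambda>t. Q (y + t *\<^sub>R \<eta> + S (sol (y + 0 *\<^sub>R \<eta>) + t *\<^sub>R \<gamma>))) \<gamma>"
      using dir_deriv_velocity[OF Q DU[OF psi_mem[OF y]] \<zeta>] \<gamma>(2) line by (simp add: \<zeta>_def)
    show "Q (y + 0 *\<^sub>R \<eta> + S (sol (y + 0 *\<^sub>R \<eta>))) = sol (y + 0 *\<^sub>R \<eta>)" using s by simp
    show "\<forall>\<^sub>F t in at 0. Q (y + t *\<^sub>R \<eta> + S (sol (y + t *\<^sub>R \<eta>))) = sol (y + t *\<^sub>R \<eta>) \<and>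
        norm (Q (y + t *\<^sub>R \<eta> + S (sol (y + t *\<^sub>R \<eta>))) - Q (y + t *\<^sub>R \<eta> + S (sol (y + 0 *\<^sub>R \<eta>) + t *\<^sub>R \<gamma>)))
        \<le> 1/2 * norm (sol (y + t *\<^sub>R \<eta>) - (sol (y + 0 *\<^sub>R \<eta>) + t *\<^sub>R \<gamma>))"
      using line_eventually[OF D1(1) E y \<eta>] line_eventually[OF D(1) E psi_mem[OF y] \<zeta>]
    proof eventually_elim
      case (elim t)
      have "sol y + t *\<^sub>R \<gamma> \<in> I" using s \<gamma> I by (intro subspace_add subspace_scale)
      then have "norm (Q (y + t *\<^sub>R \<eta> + S (sol (y + t *\<^sub>R \<eta>))) - Q (y + t *\<^sub>R \<eta> + S (sol y + t *\<^sub>R \<gamma>)))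
        \<le> 1/2 * norm (sol (y + t *\<^sub>R \<eta>) - (sol y + t *\<^sub>R \<gamma>))"
        using sol(1)[OF elim(1)] psi_mem[OF elim(1)] elim(2)
        by (intro Q_contracting2) (simp_all only: line psi_def)
      then show ?case using sol(3)[OF elim(1)] by simp
    qed
  qed
  then show ?thesis by (simp add: \<gamma>_def)
qed

lemma psi_velocity:
  assumes y: "y \<in> D1" and \<eta>: "\<eta> \<in> E"
  shows "has_velocity (\<lambda>t. psi (y + t *\<^sub>R \<eta>)) (\<eta> + S (corr (psi y) \<eta>))"
  unfolding psi_def[of "_ + _"]
proof (rule has_velocity_add[OF has_velocity_line has_velocity_linear[OF S I]])
  show "has_velocity (\<lambda>t. sol (y + t *\<^sub>R \<eta>)) (corr (psi y) \<eta>)"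
    by (rule sol_velocity[OF assms])
  show "\<forall>\<^sub>F t in at 0. sol (y + t *\<^sub>R \<eta>) \<in> I"
    using line_eventually[OF D1(1) E y \<eta>] by eventually_elim (rule sol)
qed (use corr(1)[OF psi_mem[OF y] \<eta>] sol(1)[OF y] in auto)

lemma C_family_S: "C_family E I D1 n G \<Longrightarrow> C_family E E D1 n (\<lambda>y v. S (G y v))"
  by (rule C_family_linear[OF S I D1(1) E])

text \<open>Differentiating \<open>c = dir_deriv Q x (w + S c)\<close> gives \<open>c' = e + dir_deriv Q x (w' + S c')\<close> with a second-order
term \<open>e\<close>. Substituting \<open>c' = e + g\<close> yields \<open>g = dir_deriv Q x ((w' + S e) + S g)\<close>, the linearised equation
again, so \<open>g = corr x (w' + S e)\<close>.\<close>

lemma corr_velocity: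
  assumes y: "y \<in> D1" and \<eta>: "\<eta> \<in> E"
    and w: "has_velocity w w'" "w 0 \<in> E" "w' \<in> E" "\<forall>\<^sub>F t in at 0. w t \<in> E"
  defines "\<xi> \<equiv> \<eta> + S (corr (psi y) \<eta>)"
  defines "e \<equiv> iter_deriv Q 2 (psi y) ((\<lambda>_. w 0 + S (corr (psi y) (w 0)))(1 := \<xi>))"
  shows "has_velocity (\<lambda>t. corr (psi (y + t *\<^sub>R \<eta>)) (w t)) (e + corr (psi y) (w' + S e))"
proof -
  note pD = psi_mem[OF y]
  define c where "c = corr (psi y) (w 0)"
  have c: "c \<in> I" "dir_deriv Q (psi y) (w 0 + S c) = c"
    unfolding c_def using corr[OF pD w(2)] by auto
  have \<xi>: "\<xi> \<in> E" unfolding \<xi>_def using corr(1)[OF pD \<eta>] \<eta> E S_simps(1) by (intro subspace_add)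
  have wc: "w 0 + S c \<in> E" using w(2) c E S_simps(1) by (intro subspace_add)
  have e: "e \<in> I" unfolding e_def c_def[symmetric]
    using wc \<xi> by (intro mb_smooth_mem[OF Q DU[OF pD]]) auto
  define g where "g = corr (psi y) (w' + S e)"
  have we: "w' + S e \<in> E" using w(3) e E S_simps(1) by (intro subspace_add)
  have g: "g \<in> I" "dir_deriv Q (psi y) (w' + S e + S g) = g"
    unfolding g_def using corr[OF pD we] by auto
  define \<gamma> where "\<gamma> = e + g"
  have \<gamma>: "\<gamma> \<in> I" unfolding \<gamma>_def using e g I by (intro subspace_add)
  have S\<gamma>: "S \<gamma> \<in> E" "S \<gamma> = S e + S g" using S_simps(1)[OF \<gamma>] S_simps(2)[OF e g(1)] unfolding \<gamma>_def by auto
  have ev: "\<forall>\<^sub>F t in at 0. y + t *\<^sub>R \<eta> \<in> D1" by (rule line_eventually[OF D1(1) E y \<eta>])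
  have ct: "c + t *\<^sub>R \<gamma> \<in> I" for t using c \<gamma> I by (intro subspace_add subspace_scale)
  have Sct: "S (c + t *\<^sub>R \<gamma>) = S c + t *\<^sub>R S \<gamma>" for t
    using c \<gamma> I S_simps by (simp add: subspace_scale)
  have "has_velocity (\<lambda>t. corr (psi (y + t *\<^sub>R \<eta>)) (w t)) \<gamma>"
  proof (rule fixpoint_velocity[where K = "\<lambda>t b. dir_deriv Q (psi (y + t *\<^sub>R \<eta>)) (w t + S b)"])
    have vel: "has_velocity (\<lambda>t. w t + S (c + t *\<^sub>R \<gamma>)) (w' + S \<gamma>)"
      unfolding Sct by (rule has_velocity_add[OF w(1) has_velocity_line])
    have "has_velocity (\<lambda>t. iter_deriv Q 1 (psi (y + t *\<^sub>R \<eta>)) (\<lambda>i. w t + S (c + t *\<^sub>R \<gamma>)))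
      (iter_deriv Q (Suc 1) (psi (y + 0 *\<^sub>R \<eta>)) ((\<lambda>i. w 0 + S (c + 0 *\<^sub>R \<gamma>))(1 := \<xi>)) +
       (\<Sum>i<1. iter_deriv Q 1 (psi (y + 0 *\<^sub>R \<eta>)) ((\<lambda>i. w 0 + S (c + 0 *\<^sub>R \<gamma>))(i := w' + S \<gamma>))))"
    proof (rule iter_deriv_chain[OF Q E])
      show "has_velocity (\<lambda>t. psi (y + t *\<^sub>R \<eta>)) \<xi>" unfolding \<xi>_def by (rule psi_velocity[OF y \<eta>])
      show "\<forall>\<^sub>F t in at 0. psi (y + t *\<^sub>R \<eta>) \<in> U"
        using ev by eventually_elim (intro DU psi_mem)
      show "\<forall>\<^sub>F t in at 0. (\<lambda>i::nat. w t + S (c + t *\<^sub>R \<gamma>)) \<in> UNIV \<rightarrow> E"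
        using w(4) by eventually_elim (use ct E S_simps(1) in \<open>auto intro: subspace_add\<close>)
    qed (use \<xi> DU[OF pD] vel wc w(3) S\<gamma>(1) E in \<open>auto intro: subspace_add\<close>)
    moreover have "iter_deriv Q (Suc 1) (psi (y + 0 *\<^sub>R \<eta>)) ((\<lambda>i. w 0 + S (c + 0 *\<^sub>R \<gamma>))(1 := \<xi>)) = e"
      by (simp add: e_def c_def numeral_2_eq_2 del: iter_deriv.simps)
    moreover have "(\<Sum>i<1. iter_deriv Q 1 (psi (y + 0 *\<^sub>R \<eta>)) ((\<lambda>i. w 0 + S (c + 0 *\<^sub>R \<gamma>))(i := w' + S \<gamma>))) = g"
      using g(2) by (simp add: S\<gamma>(2) add.assoc)
    ultimately show "has_velocity (\<lambda>t. dir_deriv Q (psi (y + t *\<^sub>R \<eta>))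
        (w t + S (corr (psi (y + 0 *\<^sub>R \<eta>)) (w 0) + t *\<^sub>R \<gamma>))) \<gamma>"
      unfolding dir_deriv_eq_iter \<gamma>_def[symmetric]
      by (simp only: \<gamma>_def[symmetric] c_def[symmetric] scaleR_zero_left add_0_right)
    show "dir_deriv Q (psi (y + 0 *\<^sub>R \<eta>)) (w 0 + S (corr (psi (y + 0 *\<^sub>R \<eta>)) (w 0)))
        = corr (psi (y + 0 *\<^sub>R \<eta>)) (w 0)"
      using corr(2)[OF pD w(2)] by simp
    show "\<forall>\<^sub>F t in at 0. dir_deriv Q (psi (y + t *\<^sub>R \<eta>)) (w t + S (corr (psi (y + t *\<^sub>R \<eta>)) (w t)))
        = corr (psi (y + t *\<^sub>R \<eta>)) (w t) \<and>
       norm (dir_deriv Q (psi (y + t *\<^sub>R \<eta>)) (w t + S (corr (psi (y + t *\<^sub>R \<eta>)) (w t))) -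
          dir_deriv Q (psi (y + t *\<^sub>R \<eta>)) (w t + S (corr (psi (y + 0 *\<^sub>R \<eta>)) (w 0) + t *\<^sub>R \<gamma>)))
       \<le> 1/2 * norm (corr (psi (y + t *\<^sub>R \<eta>)) (w t) - (corr (psi (y + 0 *\<^sub>R \<eta>)) (w 0) + t *\<^sub>R \<gamma>))"
      using ev w(4)
    proof eventually_elim
      case (elim t)
      note pt = psi_mem[OF elim(1)]
      show ?case
        using corr[OF pt elim(2)] dQ_contracting2[OF pt elim(2) corr(1)[OF pt elim(2)] ct[of t]]
        by (simp only: c_def scaleR_zero_left add_0_right)
    qed
  qed
  then show ?thesis by (simp add: \<gamma>_def g_def)
qed

text \<open>Both statements are needed at once: the derivative of \<open>sol\<close> is \<open>corr\<close> along \<open>psi\<close>, and the derivative of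
\<open>corr\<close> involves \<open>corr\<close>, the derivatives of \<open>Q\<close>, and \<open>psi\<close>, all one order lower.\<close>

lemma C_family_sol_corr:
  "C_family E I D1 n (\<lambda>y v. sol y) \<and>
   (\<forall>w. C_family E E D1 n w \<longrightarrow> C_family E I D1 n (\<lambda>y v. corr (psi y) (w y v)))"
proof (induction n)
  have sol0: "C_family E I D1 0 (\<lambda>y v. sol y)"
  proof (rule C_family_0I)
    fix y and v :: "nat \<Rightarrow> 'e" assume y: "y \<in> D1" "v \<in> UNIV \<rightarrow> E"
    then show "sol y \<in> I" by (intro sol)
    show "((\<lambda>p. sol (fst p)) \<longlongrightarrow> sol y) (at (y, v) within D1 \<times> (UNIV \<rightarrow> E))"
      by (rule continuous_on_tendsto_compose[OF sol_continuous _ y(1)])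
        (auto intro!: tendsto_eq_intros always_eventually simp: eventually_at_filter)
  qed
  have corr0: "C_family E I D1 0 (\<lambda>y v. corr (psi y) (w y v))" if w: "C_family E E D1 0 w" for w
  proof (rule C_family_0I)
    fix y and v :: "nat \<Rightarrow> 'e" assume y: "y \<in> D1" "v \<in> UNIV \<rightarrow> E"
    show "corr (psi y) (w y v) \<in> I" by (intro corr psi_mem C_family_mem[OF w] y)
    have "((\<lambda>p. psi (fst p)) \<longlongrightarrow> psi y) (at (y, v) within D1 \<times> (UNIV \<rightarrow> E))"
      by (rule continuous_on_tendsto_compose[OF psi_continuous _ y(1)])
        (auto intro!: tendsto_eq_intros always_eventually simp: eventually_at_filter)
    then show "((\<lambda>p. corr (psi (fst p)) (w (fst p) (snd p))) \<longlongrightarrow> corr (psi y) (w y v))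
        (at (y, v) within D1 \<times> (UNIV \<rightarrow> E))"
      by (rule corr_tendsto[OF _ C_family_tendsto[OF w y] psi_mem[OF y(1)] C_family_mem[OF w y]])
        (use C_family_mem[OF w] psi_mem in \<open>auto intro!: always_eventually simp: eventually_at_filter\<close>)
  qed
  {
    case 0
    then show ?case using sol0 corr0 by blast
  next
    case (Suc n)
    then have IH: "C_family E I D1 n (\<lambda>y v. sol y)"
      "\<And>w. C_family E E D1 n w \<Longrightarrow> C_family E I D1 n (\<lambda>y v. corr (psi y) (w y v))" by blast+
    have dir: "C_family E E D1 n (\<lambda>y v. v l)" for l by (rule C_family_dir[OF E])
    have psi: "C_family E E D1 n (\<lambda>y v. psi y)"
      unfolding psi_def
      by (intro C_family_add E C_family_id C_family_S IH(1) openin_imp_subset[OF D1(1)])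
    have "C_family E I D1 (Suc n) (\<lambda>y v. sol y)"
    proof (rule C_family_SucI[OF sol0])
      fix l
      show "\<exists>G'. C_family E I D1 n G' \<and>
          (\<forall>y\<in>D1. \<forall>v\<in>UNIV \<rightarrow> E. has_velocity (\<lambda>t. sol (y + t *\<^sub>R v l)) (G' y v))"
        using IH(2)[OF dir[of l]] by (intro exI[of _ "\<lambda>y v. corr (psi y) (v l)"] conjI ballI sol_velocity) auto
    qed
    moreover have "C_family E I D1 (Suc n) (\<lambda>y v. corr (psi y) (w y v))" if w: "C_family E E D1 (Suc n) w" for w
    proof (rule C_family_SucI[OF corr0[OF C_family_0[OF w]]])
      fix l
      obtain w' where w': "C_family E E D1 n w'"
        "\<And>x v. x \<in> D1 \<Longrightarrow> v \<in> UNIV \<rightarrow> E \<Longrightarrow> has_velocity (\<lambda>t. w (x + t *\<^sub>R v l) v) (w' x v)"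
        using C_family_derivative[OF w, of l] by blast
      note wn = C_family_Suc[OF w]
      define z where "z i y v = (if i = Suc 0 then v l + S (corr (psi y) (v l))
          else w y v + S (corr (psi y) (w y v)))" for i :: nat and y v
      define e where "e y v = iter_deriv Q 2 (psi y) (\<lambda>i. z i y v)" for y v
      have z: "C_family E E D1 n (z i)" for i
        unfolding z_def
        by (cases "i = Suc 0") (auto intro!: C_family_add E dir wn C_family_S IH(2))
      have e: "C_family E I D1 n e"
        unfolding e_def by (rule C_family_iter_deriv[OF Q E I D1(1) E psi z]) (intro DU psi_mem)
      have "C_family E I D1 n (\<lambda>y v. e y v + corr (psi y) (w' y v + S (e y v)))"
        by (intro C_family_add I e IH(2) E w'(1) C_family_S)
      moreover have "has_velocity (\<lambda>t. corr (psi (y + t *\<^sub>R v l)) (w (y + t *\<^sub>R v l) v))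
          (e y v + corr (psi y) (w' y v + S (e y v)))"
        if yv: "y \<in> D1" "v \<in> UNIV \<rightarrow> E" for y v
      proof -
        have vl: "v l \<in> E" using yv by auto
        have ev: "\<forall>\<^sub>F t in at 0. w (y + t *\<^sub>R v l) v \<in> E"
          using line_eventually[OF D1(1) E yv(1) vl] by eventually_elim (intro C_family_mem[OF wn] yv(2))
        have "(\<lambda>i. z i y v) = ((\<lambda>_. w y v + S (corr (psi y) (w y v)))(1 := v l + S (corr (psi y) (v l))))"
          by (auto simp: z_def fun_eq_iff)
        then show ?thesis
          using corr_velocity[OF yv(1) vl w'(2)[OF yv] _ C_family_mem[OF w'(1) yv] ev] C_family_mem[OF wn yv]
          unfolding e_def by simp
      qed
      ultimately show "\<exists>G'. C_family E I D1 n G' \<and> (\<forall>y\<in>D1. \<forall>v\<in>UNIV \<rightarrow> E.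
          has_velocity (\<lambda>t. corr (psi (y + t *\<^sub>R v l)) (w (y + t *\<^sub>R v l) v)) (G' y v))" by blast
    qed
    ultimately show ?case by blast
  }
qed

lemma psi_smooth: "mb_smooth_on E E D1 psi"
  unfolding C_family_iff_mb_smooth[OF E E D1(1)] psi_def
  using C_family_sol_corr
  by (intro allI C_family_add E C_family_id C_family_S openin_imp_subset[OF D1(1)]) blast

text \<open>The norm condition selects the small fixed points, which are the unique ones.\<close>

definition N :: "'e set" where
  "N = {x \<in> D. norm (Q x) < r \<and> x - S (Q x) \<in> D1}"

lemma N_open: "openin (top_of_set E) N"
proof -
  have Qc: "continuous_on D Q"
    by (rule continuous_on_subset[OF mb_smooth_continuous_on[OF Q E] D(4)])
  have SQ: "continuous_on D (\<lambda>x. S (Q x))"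
    by (rule continuous_on_compose2[OF S(2) Qc]) (use Q_mem in auto)
  have c: "continuous_on D (\<lambda>x. x - S (Q x))"
    using continuous_on_add[OF continuous_on_id continuous_on_minus[OF SQ]] by simp
  have "openin (top_of_set D) (D \<inter> (\<lambda>x. x - S (Q x)) -` D1)"
    using c D1(1) DE Q_mem S_simps(1) E
    by (intro continuous_openin_preimage[of D _ E]) (auto intro!: subspace_diff)
  moreover have "openin (top_of_set D) (D \<inter> Q -` ball 0 r)"
    using Qc by (rule continuous_openin_preimage_gen) simp
  ultimately have "openin (top_of_set D) ((D \<inter> Q -` ball 0 r) \<inter> (D \<inter> (\<lambda>x. x - S (Q x)) -` D1))"
    by (rule openin_Int[rotated])
  moreover have "(D \<inter> Q -` ball 0 r) \<inter> (D \<inter> (\<lambda>x. x - S (Q x)) -` D1) = N"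
    by (auto simp: N_def)
  ultimately show ?thesis using openin_trans[OF _ D(1)] by simp
qed

lemma psi_N: "y \<in> D1 \<Longrightarrow> psi y \<in> N" "y \<in> D1 \<Longrightarrow> psi y - S (Q (psi y)) = y"
  using psi_mem[of y] sol[of y] unfolding N_def by (auto simp: psi_def)

lemma N_psi:
  assumes "x \<in> N"
  shows "psi (x - S (Q x)) = x"
proof -
  have "sol (x - S (Q x)) = Q x"
    using assms Q_mem by (intro sol_unique) (auto simp: N_def)
  then show ?thesis by (simp add: psi_def)
qed

end

text \<open>Inverse function theorem for perturbations of the identity of a locally convex space that factor through
a Banach space.\<close>

lemma perturbation_local_diffeo:
  assumes "perturbation E I U Q S"
  obtains N D \<psi> where
    "openin (top_of_set E) N" "0 \<in> N" "N \<subseteq> U" "openin (top_of_set E) D" "0 \<in> D"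
    "\<And>x. x \<in> N \<Longrightarrow> x - S (Q x) \<in> D \<and> \<psi> (x - S (Q x)) = x"
    "\<And>y. y \<in> D \<Longrightarrow> \<psi> y \<in> N \<and> \<psi> y - S (Q (\<psi> y)) = y"
    "mb_smooth_on E E D \<psi>"
proof -
  interpret perturbation E I U Q S by fact
  obtain D where D: "openin (top_of_set E) D" "convex D" "0 \<in> D" "D \<subseteq> U"
    "\<And>x c. x \<in> D \<Longrightarrow> c \<in> I \<Longrightarrow> norm (dir_deriv Q x (S c)) \<le> 1/2 * norm c"
    by (rule deriv_contracting) blast
  interpret contracting_perturbation E I U Q S D
    by unfold_locales (use D in auto)
  obtain D1 r where D1: "openin (top_of_set E) D1" "0 \<in> D1" "r > 0"
    "\<And>y b. y \<in> D1 \<Longrightarrow> b \<in> I \<Longrightarrow> norm b \<le> r \<Longrightarrow> y + S b \<in> D"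
    "\<And>y. y \<in> D1 \<Longrightarrow> norm (Q y) < r / 2"
    by (rule solution_box) blast
  interpret solvable_perturbation E I U Q S D D1 r
    by unfold_locales (use D1 in auto)
  show ?thesis
  proof (rule that[of N D1 psi])
    show "0 \<in> N" using D(3) D1(2) r zero(2) S_simps(4) by (simp add: N_def)
    show "N \<subseteq> U" using DU by (auto simp: N_def)
  qed (use N_open D1 psi_smooth psi_N N_psi in \<open>auto simp: N_def\<close>)
qed


section \<open>Splittings of operators\<close>

lemma direct_sum_projections:
  fixes X :: "'a::locally_convex_tvs set"
  assumes "top_direct_sum X A B"
  obtains p q where "continuous_on X p" "continuous_on X q"
    "\<And>x. x \<in> X \<Longrightarrow> p x \<in> A" "\<And>x. x \<in> X \<Longrightarrow> q x \<in> B" "\<And>x. x \<in> X \<Longrightarrow> p x + q x = x"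
    "\<And>a b. a \<in> A \<Longrightarrow> b \<in> B \<Longrightarrow> p (a + b) = a" "\<And>a b. a \<in> A \<Longrightarrow> b \<in> B \<Longrightarrow> q (a + b) = b"
proof -
  obtain g where g: "homeomorphism (A \<times> B) X (\<lambda>(a, b). a + b) g"
    using assms unfolding top_direct_sum_def by blast
  have 1: "g x \<in> A \<times> B" if "x \<in> X" for x
    using g that homeomorphism_image2[OF g] by blast
  have 2: "fst (g x) + snd (g x) = x" if "x \<in> X" for x
    using homeomorphism_apply2[OF g that] by (simp add: case_prod_unfold)
  have 3: "g (a + b) = (a, b)" if "a \<in> A" "b \<in> B" for a b
    using homeomorphism_apply1[OF g, of "(a, b)"] that by simp
  show ?thesis
    by (rule that[of "fst \<circ> g" "snd \<circ> g"])
      (use 1 2 3 homeomorphism_cont2[OF g] in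
        \<open>auto simp: o_def mem_Times_iff intro: continuous_on_fst continuous_on_snd\<close>)
qed

lemma direct_sum_projections_linear:
  assumes X: "subspace X" and A: "subspace A" and B: "subspace B"
    and p: "\<And>x. x \<in> X \<Longrightarrow> p x \<in> A" and q: "\<And>x. x \<in> X \<Longrightarrow> q x \<in> B" and pq: "\<And>x. x \<in> X \<Longrightarrow> p x + q x = x"
    and "\<And>a b. a \<in> A \<Longrightarrow> b \<in> B \<Longrightarrow> p (a + b) = a" "\<And>a b. a \<in> A \<Longrightarrow> b \<in> B \<Longrightarrow> q (a + b) = b"
  shows "linear_on X A p" "linear_on X B q"
proof -
  have add: "p (x + y) = p x + p y \<and> q (x + y) = q x + q y" if "x \<in> X" "y \<in> X" for x y
  proof -
    have "x + y = (p x + p y) + (q x + q y)"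
      using pq[OF that(1)] pq[OF that(2)] by (metis add.assoc add.left_commute)
    then show ?thesis using assms(7,8)[of "p x + p y" "q x + q y"] p q that A B
      by (simp add: subspace_add)
  qed
  have scale: "p (c *\<^sub>R x) = c *\<^sub>R p x \<and> q (c *\<^sub>R x) = c *\<^sub>R q x" if "x \<in> X" for c x
  proof -
    have "c *\<^sub>R x = c *\<^sub>R p x + c *\<^sub>R q x" using pq[OF that] by (metis scaleR_add_right)
    then show ?thesis using assms(7,8)[of "c *\<^sub>R p x" "c *\<^sub>R q x"] p q that A B
      by (simp add: subspace_scale)
  qed
  show "linear_on X A p" "linear_on X B q"
    using add scale p q unfolding linear_on_def by auto
qed

text \<open>The two maps through which regularity is used: \<open>\<pi>\<close> encodes a complement of the image, \<open>\<sigma>\<close> encodes a complement of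
the kernel together with the continuity of the induced inverse.\<close>

definition splitting ::
  "'a::locally_convex_tvs set \<Rightarrow> 'b::locally_convex_tvs set \<Rightarrow> ('a \<Rightarrow> 'b) \<Rightarrow> ('b \<Rightarrow> 'b) \<Rightarrow> ('b \<Rightarrow> 'a) \<Rightarrow> bool" where
  "splitting X Y T \<pi> \<sigma> \<longleftrightarrow>
     linear_on Y (T ` X) \<pi> \<and> continuous_on Y \<pi> \<and> (\<forall>y\<in>T ` X. \<pi> y = y) \<and>
     linear_on (T ` X) X \<sigma> \<and> continuous_on (T ` X) \<sigma> \<and> (\<forall>y\<in>T ` X. T (\<sigma> y) = y)"

lemma linear_on_image_subspace:
  assumes "linear_on X Y T" "subspace X"
  shows "subspace (T ` X)"
proof (rule subspaceI)
  note T = linear_onD[OF assms]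
  show "0 \<in> T ` X" using T(4) subspace_0[OF assms(2)] by force
  fix x y assume "x \<in> T ` X" "y \<in> T ` X"
  then show "x + y \<in> T ` X"
    using T(2) subspace_add[OF assms(2)] by (auto simp flip: T(2) intro!: imageI)
next
  note T = linear_onD[OF assms]
  fix x c assume "x \<in> T ` X"
  then show "c *\<^sub>R x \<in> T ` X"
    using subspace_scale[OF assms(2)] by (auto simp flip: T(3) intro!: imageI)
qed

text \<open>On \<open>T x\<close> the right inverse is the component \<open>q x\<close> of \<open>x\<close> in the complement of the kernel. Its continuity is
that of \<open>q\<close>, as \<open>T\<close> is a quotient map onto its image.\<close>

lemma regular_operator_splitting:
  fixes X :: "'a::locally_convex_tvs set" and Y :: "'b::locally_convex_tvs set"
  assumes "regular_operator X Y T"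
  obtains \<pi> \<sigma> where "splitting X Y T \<pi> \<sigma>"
proof -
  let ?K = "{x \<in> X. T x = 0}"
  have lin: "linear_on X Y T" and op: "\<And>U. openin (top_of_set X) U \<Longrightarrow> openin (top_of_set (T ` X)) (T ` U)"
    using assms unfolding regular_operator_def by auto
  obtain B C where B: "top_direct_sum X ?K B" and C: "top_direct_sum Y (T ` X) C"
    using assms unfolding regular_operator_def top_complemented_def by blast
  have X: "subspace X" "subspace ?K" "subspace B" "subspace Y" "subspace (T ` X)" "subspace C"
    using B C unfolding top_direct_sum_def by auto
  note T = linear_onD[OF lin X(1)]
  obtain \<pi> \<pi>' where \<pi>: "continuous_on Y \<pi>" "continuous_on Y \<pi>'"
    "\<And>x. x \<in> Y \<Longrightarrow> \<pi> x \<in> T ` X" "\<And>x. x \<in> Y \<Longrightarrow> \<pi>' x \<in> C" "\<And>x. x \<in> Y \<Longrightarrow> \<pi> x + \<pi>' x = x"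
    "\<And>a b. a \<in> T ` X \<Longrightarrow> b \<in> C \<Longrightarrow> \<pi> (a + b) = a" "\<And>a b. a \<in> T ` X \<Longrightarrow> b \<in> C \<Longrightarrow> \<pi>' (a + b) = b"
    by (rule direct_sum_projections[OF C]) (rule that)
  obtain p q where pq: "continuous_on X p" "continuous_on X q"
    "\<And>x. x \<in> X \<Longrightarrow> p x \<in> ?K" "\<And>x. x \<in> X \<Longrightarrow> q x \<in> B" "\<And>x. x \<in> X \<Longrightarrow> p x + q x = x"
    "\<And>a b. a \<in> ?K \<Longrightarrow> b \<in> B \<Longrightarrow> p (a + b) = a" "\<And>a b. a \<in> ?K \<Longrightarrow> b \<in> B \<Longrightarrow> q (a + b) = b"
    by (rule direct_sum_projections[OF B]) (rule that)
  have qlin: "linear_on X B q" by (rule direct_sum_projections_linear[OF X(1-3) pq(3-7)])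
  note q = linear_onD[OF qlin X(1)]
  have BX: "b \<in> X" if "b \<in> B" for b
    using B that closedin_imp_subset unfolding top_direct_sum_def by blast
  define \<sigma> where "\<sigma> y = q (SOME x. x \<in> X \<and> T x = y)" for y
  have \<sigma>: "\<sigma> (T x) = q x" if x: "x \<in> X" for x
  proof -
    define x' where "x' = (SOME x'. x' \<in> X \<and> T x' = T x)"
    have x': "x' \<in> X" "T x' = T x"
      using someI[of "\<lambda>x'. x' \<in> X \<and> T x' = T x", OF conjI[OF x refl]] by (auto simp: x'_def)
    then have "x' - x \<in> ?K" using x T(5) X(1) by (auto intro: subspace_diff)
    then have "q (x' - x) = 0" using pq(7)[of "x' - x" 0] subspace_0[OF X(3)] by simp
    then show ?thesis using q(5)[OF x'(1) x] by (simp add: \<sigma>_def x'_def)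
  qed
  have Tq: "T (q x) = T x" if "x \<in> X" for x
    using T(2)[of "p x" "q x"] pq(3)[OF that] pq(5)[OF that] BX[OF pq(4)[OF that]] by simp
  have "splitting X Y T \<pi> \<sigma>"
    unfolding splitting_def
  proof (intro conjI ballI)
    show "linear_on Y (T ` X) \<pi>"
      by (rule direct_sum_projections_linear[OF X(4-6) \<pi>(3-7)])
    show "\<pi> y = y" if "y \<in> T ` X" for y
      using \<pi>(6)[OF that, of 0] subspace_0[OF X(6)] by simp
    show "linear_on (T ` X) X \<sigma>"
      unfolding linear_on_def
    proof (intro conjI ballI allI)
      show "\<sigma> \<in> T ` X \<rightarrow> X" using \<sigma> BX pq(4) by auto
      show "\<sigma> (x + y) = \<sigma> x + \<sigma> y" if "x \<in> T ` X" "y \<in> T ` X" for x y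
        using that \<sigma> q(2) X(1) by (auto simp: subspace_add simp flip: T(2))
      show "\<sigma> (c *\<^sub>R x) = c *\<^sub>R \<sigma> x" if "x \<in> T ` X" for c x
        using that \<sigma> q(3) X(1) by (auto simp: subspace_scale simp flip: T(3))
    qed
    show "continuous_on (T ` X) \<sigma>"
      unfolding continuous_openin_preimage_eq
    proof (intro allI impI)
      fix O' :: "'a set" assume "open O'"
      then have "openin (top_of_set X) (X \<inter> q -` O')"
        using pq(2) unfolding continuous_openin_preimage_eq by blast
      from op[OF this] show "openin (top_of_set (T ` X)) (T ` X \<inter> \<sigma> -` O')"
        by (rule back_subst[of "openin _"]) (use \<sigma> in auto)
    qed
    show "T (\<sigma> y) = y" if "y \<in> T ` X" for y using that \<sigma> Tq by auto
  qed (fact \<pi>)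
  then show ?thesis by (rule that)
qed

section \<open>Finite-dimensional targets\<close>

text \<open>A complete subspace is closed, so \<open>a\<close> has positive distance \<open>\<delta>\<close> from it. Thus the coefficient of \<open>a\<close>
is a bounded functional, which drives the inductions on finite spanning sets.\<close>

lemma complete_span_insert_bound:
  fixes a :: "'f::real_normed_vector"
  assumes "complete (span S)" "a \<notin> span S"
  obtains \<delta> where "\<delta> > 0" "\<And>s c. s \<in> span S \<Longrightarrow> \<bar>c\<bar> * \<delta> \<le> norm (s + c *\<^sub>R a)"
proof -
  have "closed (span S)" using assms(1) by (rule complete_imp_closed)
  then have "open (- span S)" by (rule open_Compl)
  then obtain \<delta> where \<delta>: "\<delta> > 0" "ball a \<delta> \<subseteq> - span S"
    using assms(2) open_contains_ball by blast
  show ?thesis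
  proof (rule that[OF \<delta>(1)])
    fix s c assume s: "s \<in> span S"
    show "\<bar>c\<bar> * \<delta> \<le> norm (s + c *\<^sub>R a)"
    proof (cases "c = 0")
      case False
      have "(- (1 / c)) *\<^sub>R s \<in> span S" using s by (rule span_scale)
      then have "\<delta> \<le> norm (a - (- (1 / c)) *\<^sub>R s)" using \<delta>(2) by (force simp: dist_norm subset_iff)
      also have "a - (- (1 / c)) *\<^sub>R s = (1 / c) *\<^sub>R (s + c *\<^sub>R a)"
        using False by (simp add: algebra_simps)
      also have "norm \<dots> = norm (s + c *\<^sub>R a) / \<bar>c\<bar>"
        by simp
      finally show ?thesis using False by (simp add: pos_le_divide_eq mult.commute)
    qed simp
  qed
qed

lemma span_insert_decomposition:
  assumes "a \<notin> span S"
  obtains \<phi> s where "\<And>x. x \<in> span (insert a S) \<Longrightarrow> s x \<in> span S \<and> x = s x + \<phi> x *\<^sub>R a"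
    "\<And>x y. x \<in> span (insert a S) \<Longrightarrow> y \<in> span (insert a S) \<Longrightarrow> s x - s y = s (x - y)"
    "\<And>x y. x \<in> span (insert a S) \<Longrightarrow> y \<in> span (insert a S) \<Longrightarrow> (\<phi> x :: real) - \<phi> y = \<phi> (x - y)"
proof -
  have "\<forall>x\<in>span (insert a S). \<exists>k. x - k *\<^sub>R a \<in> span S" using span_breakdown_eq by blast
  then obtain \<phi> where \<phi>: "\<And>x. x \<in> span (insert a S) \<Longrightarrow> x - \<phi> x *\<^sub>R a \<in> span S" by metis
  have \<phi>_diff: "\<phi> x - \<phi> y = \<phi> (x - y)" if x: "x \<in> span (insert a S)" and y: "y \<in> span (insert a S)" for x y
  proof (rule ccontr)
    assume ne: "\<phi> x - \<phi> y \<noteq> \<phi> (x - y)"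
    define k where "k = \<phi> x - \<phi> y - \<phi> (x - y)"
    have "(x - y - \<phi> (x - y) *\<^sub>R a) - ((x - \<phi> x *\<^sub>R a) - (y - \<phi> y *\<^sub>R a)) \<in> span S"
      by (intro span_diff \<phi> x y)
    then have "k *\<^sub>R a \<in> span S" by (simp add: k_def algebra_simps)
    then have "(1 / k) *\<^sub>R k *\<^sub>R a \<in> span S" by (rule span_scale)
    then show False using ne assms by (simp add: k_def)
  qed
  show ?thesis
    by (rule that[of "\<lambda>x. x - \<phi> x *\<^sub>R a" \<phi>])
       (use \<phi> \<phi>_diff in \<open>auto simp: algebra_simps simp flip: \<phi>_diff\<close>)
qed

lemma Cauchy_difference:
  fixes x y :: "nat \<Rightarrow> 'f::real_normed_vector"
  assumes "Cauchy x" "Cauchy y"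
  shows "Cauchy (\<lambda>n. x n - y n)"
proof (rule CauchyI)
  fix e :: real assume "e > 0"
  then have e: "e / 2 > 0" by simp
  obtain M N where M: "\<And>m n. m \<ge> M \<Longrightarrow> n \<ge> M \<Longrightarrow> norm (x m - x n) < e / 2"
    and N: "\<And>m n. m \<ge> N \<Longrightarrow> n \<ge> N \<Longrightarrow> norm (y m - y n) < e / 2"
    using CauchyD[OF assms(1) e] CauchyD[OF assms(2) e] by blast
  have "norm ((x m - y m) - (x n - y n)) < e" if "m \<ge> max M N" "n \<ge> max M N" for m n
  proof -
    have "(x m - y m) - (x n - y n) = (x m - x n) - (y m - y n)" by simp
    then have "norm ((x m - y m) - (x n - y n)) \<le> norm (x m - x n) + norm (y m - y n)"
      by (metis norm_triangle_ineq4)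
    then show ?thesis using M[of m n] N[of m n] that by simp
  qed
  then show "\<exists>M. \<forall>m\<ge>M. \<forall>n\<ge>M. norm ((x m - y m) - (x n - y n)) < e" by blast
qed

lemma complete_span_finite:
  fixes S :: "'f::real_normed_vector set"
  assumes "finite S"
  shows "complete (span S)"
  using assms
proof (induction S rule: finite_induct)
  case empty
  then show ?case by (simp add: complete_eq_closed compact_imp_complete)
next
  case (insert a S)
  show ?case
  proof (cases "a \<in> span S")
    case True
    then show ?thesis using insert.IH by (simp add: span_redundant)
  next
    case False
    obtain \<phi> s where d: "\<And>x. x \<in> span (insert a S) \<Longrightarrow> s x \<in> span S \<and> x = s x + \<phi> x *\<^sub>R a"
      "\<And>x y. x \<in> span (insert a S) \<Longrightarrow> y \<in> span (insert a S) \<Longrightarrow> s x - s y = s (x - y)"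
      "\<And>x y. x \<in> span (insert a S) \<Longrightarrow> y \<in> span (insert a S) \<Longrightarrow> \<phi> x - \<phi> y = \<phi> (x - y)"
      by (rule span_insert_decomposition[OF False]) (rule that)
    obtain \<delta> where \<delta>: "\<delta> > 0" "\<And>s c. s \<in> span S \<Longrightarrow> \<bar>c\<bar> * \<delta> \<le> norm (s + c *\<^sub>R a)"
      by (rule complete_span_insert_bound[OF insert.IH False]) (rule that)
    show ?thesis
    proof (rule completeI)
      fix x :: "nat \<Rightarrow> 'f" assume x: "\<forall>n. x n \<in> span (insert a S)" "Cauchy x"
      have \<phi>_le: "\<bar>\<phi> (x m) - \<phi> (x n)\<bar> * \<delta> \<le> norm (x m - x n)" for m n
      proof -
        have mem: "x m - x n \<in> span (insert a S)" using x(1) by (intro span_diff) auto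
        then show ?thesis using d(1)[OF mem] d(3)[of "x m" "x n"] x(1) \<delta>(2)[of "s (x m - x n)"] by metis
      qed
      have C\<phi>: "Cauchy (\<lambda>n. \<phi> (x n))"
        unfolding Cauchy_iff
      proof (intro allI impI)
        fix e :: real assume "e > 0"
        then have "e * \<delta> > 0" using \<delta>(1) by simp
        then obtain M where M: "\<And>m n. m \<ge> M \<Longrightarrow> n \<ge> M \<Longrightarrow> norm (x m - x n) < e * \<delta>"
          using x(2) unfolding Cauchy_iff by blast
        have "norm (\<phi> (x m) - \<phi> (x n)) < e" if "m \<ge> M" "n \<ge> M" for m n
        proof -
          have "\<bar>\<phi> (x m) - \<phi> (x n)\<bar> * \<delta> < e * \<delta>" using \<phi>_le[of m n] M[OF that] by linarith
          then show ?thesis using \<delta>(1) by simp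
        qed
        then show "\<exists>M. \<forall>m\<ge>M. \<forall>n\<ge>M. norm (\<phi> (x m) - \<phi> (x n)) < e" by blast
      qed
      then obtain k where k: "(\<lambda>n. \<phi> (x n)) \<longlonglongrightarrow> k" using Cauchy_convergent_iff convergent_def by blast
      have seq: "s (x n) = x n - \<phi> (x n) *\<^sub>R a" for n using d(1)[of "x n"] x(1) by (metis add_diff_cancel_right')
      have "Cauchy (\<lambda>n. \<phi> (x n) *\<^sub>R a)"
        using bounded_linear.Cauchy[OF bounded_linear_scaleR_left C\<phi>] .
      then have "Cauchy (\<lambda>n. s (x n))"
        unfolding seq using x(2) by (intro Cauchy_difference)
      then obtain l where l: "l \<in> span S" "(\<lambda>n. s (x n)) \<longlonglongrightarrow> l"
        using completeE[OF insert.IH, of "\<lambda>n. s (x n)"] d(1) x(1) by metis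
      have "(\<lambda>n. s (x n) + \<phi> (x n) *\<^sub>R a) \<longlonglongrightarrow> l + k *\<^sub>R a"
        by (intro tendsto_intros l k)
      then have "x \<longlonglongrightarrow> l + k *\<^sub>R a" unfolding seq by simp
      moreover have lS: "l \<in> span (insert a S)"
        using l(1) span_mono[OF subset_insertI[of S a]] by blast
      then have "l + k *\<^sub>R a \<in> span (insert a S)"
        by (intro span_add[OF lS] span_scale span_base insertI1)
      ultimately show "\<exists>l\<in>span (insert a S). x \<longlonglongrightarrow> l" by blast
    qed
  qed
qed

lemma linear_on_finite_span_continuous:
  fixes S :: "'f::real_normed_vector set" and L :: "'f \<Rightarrow> 'a::locally_convex_tvs"
  assumes "finite S" "linear_on (span S) Y L"
  shows "continuous_on (span S) L"
  using assms
proof (induction S rule: finite_induct)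
  case empty
  then show ?case by simp
next
  case (insert a S)
  note L = linear_onD[OF insert.prems subspace_span]
  have sub: "span S \<subseteq> span (insert a S)" by (intro span_mono) auto
  have "linear_on (span S) Y L" using insert.prems sub unfolding linear_on_def by blast
  then have IH: "continuous_on (span S) L" by (rule insert.IH)
  show ?case
  proof (cases "a \<in> span S")
    case True
    then show ?thesis using IH by (simp add: span_redundant)
  next
    case False
    obtain \<phi> s where d: "\<And>x. x \<in> span (insert a S) \<Longrightarrow> s x \<in> span S \<and> x = s x + \<phi> x *\<^sub>R a"
      "\<And>x y. x \<in> span (insert a S) \<Longrightarrow> y \<in> span (insert a S) \<Longrightarrow> s x - s y = s (x - y)"
      "\<And>x y. x \<in> span (insert a S) \<Longrightarrow> y \<in> span (insert a S) \<Longrightarrow> \<phi> x - \<phi> y = \<phi> (x - y)"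
      by (rule span_insert_decomposition[OF False]) (rule that)
    obtain \<delta> where \<delta>: "\<delta> > 0" "\<And>s c. s \<in> span S \<Longrightarrow> \<bar>c\<bar> * \<delta> \<le> norm (s + c *\<^sub>R a)"
      by (rule complete_span_insert_bound[OF complete_span_finite[OF insert.hyps(1)] False]) (rule that)
    have C\<phi>: "continuous_on (span (insert a S)) \<phi>"
      unfolding continuous_on_def
    proof
      fix x assume x: "x \<in> span (insert a S)"
      have "((\<lambda>y. \<phi> y - \<phi> x) \<longlongrightarrow> 0) (at x within span (insert a S))"
      proof (rule Lim_null_comparison)
        have "norm (\<phi> y - \<phi> x) \<le> norm (y - x) / \<delta>" if y: "y \<in> span (insert a S)" for y
        proof -
          have mem: "y - x \<in> span (insert a S)" using x y by (intro span_diff) auto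
          then have "\<bar>\<phi> y - \<phi> x\<bar> * \<delta> \<le> norm (y - x)"
            using d(1)[OF mem] d(3)[OF y x] \<delta>(2)[of "s (y - x)"] by metis
          then show ?thesis using \<delta>(1) by (simp add: field_simps)
        qed
        then show "\<forall>\<^sub>F y in at x within span (insert a S). norm (\<phi> y - \<phi> x) \<le> norm (y - x) / \<delta>"
          by (auto simp: eventually_at_filter)
        have "((\<lambda>y. norm (y - x) / \<delta>) \<longlongrightarrow> norm (x - x) / \<delta>) (at x within span (insert a S))"
          using \<delta>(1) by (intro tendsto_intros) auto
        then show "((\<lambda>y. norm (y - x) / \<delta>) \<longlongrightarrow> 0) (at x within span (insert a S))" by simp
      qed
      then show "(\<phi> \<longlongrightarrow> \<phi> x) (at x within span (insert a S))" using LIM_zero_iff by blast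
    qed
    have "continuous_on (span (insert a S)) (\<lambda>x. x - \<phi> x *\<^sub>R a)"
      by (intro continuous_intros C\<phi>)
    moreover have seq: "x - \<phi> x *\<^sub>R a = s x" if "x \<in> span (insert a S)" for x
      using d(1)[OF that] by (metis add_diff_cancel_right')
    ultimately have Cs: "continuous_on (span (insert a S)) s" by (simp cong: continuous_on_cong)
    have CL: "continuous_on (span (insert a S)) (\<lambda>x. L (s x))"
      by (rule continuous_on_compose2[OF IH Cs]) (use d(1) in auto)
    have "continuous_on (span (insert a S)) (\<lambda>x. L (s x) + \<phi> x *\<^sub>R L a)"
      unfolding continuous_on_def
      using CL C\<phi> by (auto simp: continuous_on_def intro!: tendsto_add tendsto_scaleR_lc)
    moreover have "L x = L (s x) + \<phi> x *\<^sub>R L a" if x: "x \<in> span (insert a S)" for x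
    proof -
      have a: "a \<in> span (insert a S)" by (intro span_base) auto
      have "s x \<in> span (insert a S)" "x = s x + \<phi> x *\<^sub>R a" using d(1)[OF x] sub by auto
      then show ?thesis using L(2)[of "s x" "\<phi> x *\<^sub>R a"] L(3)[OF a] span_scale[OF a] by metis
    qed
    ultimately show ?thesis by (simp cong: continuous_on_cong)
  qed
qed

text \<open>A basis of the image is extended to one of the target, and preimages are chosen for it; the resulting
linear maps are continuous because they live on finite-dimensional spaces.\<close>

lemma finite_dim_splitting:
  fixes S :: "'f::real_normed_vector set" and X :: "'a::locally_convex_tvs set"
  assumes S: "finite S" and X: "subspace X" and T: "linear_on X (span S) T"
  obtains \<pi> \<sigma> where "splitting X (span S) T \<pi> \<sigma>"
proof -
  note TD = linear_onD[OF T X]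
  obtain B where B: "B \<subseteq> T ` X" "independent B" "T ` X \<subseteq> span B"
    using maximal_independent_subset by blast
  have I: "subspace (T ` X)" by (rule linear_on_image_subspace[OF T X])
  have spB: "span B = T ` X" using B(1,3) span_minimal[OF B(1) I] by blast
  have TS: "T ` X \<subseteq> span S" using TD(1) by blast
  have finB: "finite B" using independent_span_bound[OF S B(2)] B(1) TS by blast
  obtain B' where B': "B \<subseteq> B'" "B' \<subseteq> span S" "independent B'" "span S \<subseteq> span B'"
    using maximal_independent_subset_extend[of B "span S"] B(1,2) TS by blast
  obtain \<pi> :: "'f \<Rightarrow> 'f" where \<pi>: "linear \<pi>" "\<And>b. b \<in> B' \<Longrightarrow> \<pi> b = (if b \<in> B then b else 0)"
    using linear_independent_extend[OF B'(3), of "\<lambda>b. if b \<in> B then b else 0"] by blast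
  have "\<forall>b\<in>B. \<exists>x. x \<in> X \<and> T x = b" using B(1) by blast
  then obtain h where h: "\<And>b. b \<in> B \<Longrightarrow> h b \<in> X \<and> T (h b) = b" by metis
  obtain \<sigma> where \<sigma>: "linear \<sigma>" "\<And>b. b \<in> B \<Longrightarrow> \<sigma> b = h b"
    using linear_independent_extend[OF B(2), of h] by blast
  have \<pi>_mem: "\<pi> y \<in> T ` X" if "y \<in> span S" for y
  proof -
    have "y \<in> span B'" using that B'(4) by blast
    then have "\<pi> y \<in> span B"
      by (induction rule: span_induct_alt)
        (use \<pi> in \<open>auto simp: linear_add linear_scale linear_0 span_0 span_add span_scale span_base\<close>)
    then show ?thesis by (simp add: spB)
  qed
  have \<pi>_id: "\<pi> y = y" if "y \<in> T ` X" for y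
  proof -
    have "y \<in> span B" using that spB by simp
    then show ?thesis
      by (induction rule: span_induct_alt)
        (use \<pi> B'(1) in \<open>auto simp: linear_add linear_scale linear_0 subset_iff\<close>)
  qed
  have \<sigma>_mem: "\<sigma> y \<in> X \<and> T (\<sigma> y) = y" if "y \<in> T ` X" for y
  proof -
    have "y \<in> span B" using that spB by simp
    then show ?thesis
    proof (induction rule: span_induct_alt)
      case base
      then show ?case using \<sigma>(1) TD(4) subspace_0[OF X] by (simp add: linear_0)
    next
      case (step c b y)
      then have "c *\<^sub>R \<sigma> b \<in> X" using h \<sigma>(2) X by (simp add: subspace_scale)
      then show ?case using step h[OF step(1)] \<sigma> X TD(2,3)
        by (simp add: linear_add linear_scale subspace_add)
    qed
  qed
  have "splitting X (span S) T \<pi> \<sigma>"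
    unfolding splitting_def
  proof (intro conjI ballI)
    show l1: "linear_on (span S) (T ` X) \<pi>"
      using \<pi>(1) \<pi>_mem by (auto simp: linear_on_def linear_add linear_scale)
    show "continuous_on (span S) \<pi>" by (rule linear_on_finite_span_continuous[OF S l1])
    show l2: "linear_on (T ` X) X \<sigma>"
      using \<sigma>(1) \<sigma>_mem by (auto simp: linear_on_def linear_add linear_scale)
    show "continuous_on (T ` X) \<sigma>"
      using linear_on_finite_span_continuous[OF finB, of X \<sigma>] l2 spB by simp
  qed (use \<pi>_id \<sigma>_mem in auto)
  then show ?thesis by (rule that)
qed


section \<open>Charts\<close>

lemma chart_inv_left: "is_chart c \<Longrightarrow> p \<in> chart_dom c \<Longrightarrow> chart_inv c (chart_map c p) = p"
  unfolding is_chart_def using homeomorphism_apply1 by blast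

lemma chart_mem: "is_chart c \<Longrightarrow> p \<in> chart_dom c \<Longrightarrow> chart_map c p \<in> chart_model c"
  unfolding is_chart_def using openin_imp_subset by blast

lemma local_rep_apply:
  "is_chart c \<Longrightarrow> p \<in> chart_dom c \<Longrightarrow> local_rep c d f (chart_map c p) = chart_map d (f p)"
  by (simp add: local_rep_def chart_inv_left)

lemma chart_image_open:
  assumes "is_chart c" "open W"
  shows "openin (top_of_set (chart_model c)) (chart_map c ` (chart_dom c \<inter> W))"
proof -
  have "openin (top_of_set (chart_dom c)) (chart_dom c \<inter> W)"
    using assms(2) by (rule openin_open_Int)
  then have "openin (top_of_set (chart_map c ` chart_dom c)) (chart_map c ` (chart_dom c \<inter> W))"
    using assms(1) homeomorphism_imp_open_map unfolding is_chart_def by blast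
  then show ?thesis using assms(1) openin_trans unfolding is_chart_def by blast
qed

lemma is_chartD:
  assumes "is_chart c"
  shows "open (chart_dom c)" "subspace (chart_model c)"
    "continuous_on (chart_dom c) (chart_map c)"
    "continuous_on (chart_map c ` chart_dom c) (chart_inv c)"
    "inj_on (chart_map c) (chart_dom c)"
  using assms chart_inv_left[OF assms] unfolding is_chart_def homeomorphism_def
  by (auto intro: inj_on_inverseI)

lemma atlas_change:
  assumes "smooth_atlas A" "c \<in> A" "d \<in> A"
  shows "mb_smooth_on (chart_model c) (chart_model d)
           (chart_map c ` (chart_dom c \<inter> chart_dom d)) (local_rep c d id)"
  using assms unfolding smooth_atlas_def smooth_local_rep_def by auto

definition change_chart :: "('m, 'e) chart \<Rightarrow> 'e set \<Rightarrow> ('e \<Rightarrow> 'e) \<Rightarrow> ('m, 'e) chart" where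
  "change_chart c V \<Theta> = \<lparr>chart_dom = {p \<in> chart_dom c. chart_map c p \<in> V},
     chart_model = chart_model c, chart_map = \<lambda>p. \<Theta> (chart_map c p)\<rparr>"

lemma change_chart_simps [simp]:
  "chart_dom (change_chart c V \<Theta>) = {p \<in> chart_dom c. chart_map c p \<in> V}"
  "chart_model (change_chart c V \<Theta>) = chart_model c"
  "chart_map (change_chart c V \<Theta>) = (\<lambda>p. \<Theta> (chart_map c p))"
  by (simp_all add: change_chart_def)

text \<open>The chart changes between \<open>c\<close> postcomposed with a diffeomorphism \<open>\<Theta>\<close> and the atlas are those of \<open>c\<close>, composed
with \<open>\<Theta>\<close> or its inverse \<open>\<Psi>\<close>.\<close>

lemma change_chart_compatible:
  fixes c :: "('m::t2_space, 'e::locally_convex_space) chart"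
  assumes A: "smooth_atlas A" and c: "c \<in> A"
    and V: "openin (top_of_set (chart_model c)) V" "V \<subseteq> chart_map c ` chart_dom c"
    and W: "openin (top_of_set (chart_model c)) W"
    and \<Theta>: "mb_smooth_on (chart_model c) (chart_model c) V \<Theta>"
    and \<Psi>: "mb_smooth_on (chart_model c) (chart_model c) W \<Psi>"
    and inv: "\<And>x. x \<in> V \<Longrightarrow> \<Theta> x \<in> W \<and> \<Psi> (\<Theta> x) = x" "\<And>y. y \<in> W \<Longrightarrow> \<Psi> y \<in> V \<and> \<Theta> (\<Psi> y) = y"
  shows "compatible_chart A (change_chart c V \<Theta>)"
    and "chart_map (change_chart c V \<Theta>) ` chart_dom (change_chart c V \<Theta>) = W"
proof -
  let ?k = "change_chart c V \<Theta>" and ?E = "chart_model c"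
  have ch: "is_chart c" using A c unfolding smooth_atlas_def by blast
  have E: "subspace ?E" by (rule is_chartD[OF ch])
  have chV: "chart_map c (chart_inv c x) = x" "chart_inv c x \<in> chart_dom c" if "x \<in> V" for x
    using that V(2) chart_inv_left[OF ch] by auto
  show img: "chart_map ?k ` chart_dom ?k = W"
  proof
    show "chart_map ?k ` chart_dom ?k \<subseteq> W" using inv(1) by auto
    show "W \<subseteq> chart_map ?k ` chart_dom ?k"
    proof
      fix y assume "y \<in> W"
      then have "\<Psi> y \<in> V" "\<Theta> (\<Psi> y) = y" using inv(2) by auto
      then show "y \<in> chart_map ?k ` chart_dom ?k"
        using chV[of "\<Psi> y"] by (intro image_eqI[of _ _ "chart_inv c (\<Psi> y)"]) auto
    qed
  qed
  have inj: "inj_on (chart_map ?k) (chart_dom ?k)"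
  proof (rule inj_onI)
    fix p q assume p: "p \<in> chart_dom ?k" and q: "q \<in> chart_dom ?k" and "chart_map ?k p = chart_map ?k q"
    then have "\<Psi> (\<Theta> (chart_map c p)) = \<Psi> (\<Theta> (chart_map c q))" by simp
    then have "chart_map c p = chart_map c q" using p q inv(1) by simp
    then show "p = q" using p q chart_inv_left[OF ch] by (metis (no_types, lifting) change_chart_simps(1) mem_Collect_eq)
  qed
  have cinv: "chart_inv ?k y = chart_inv c (\<Psi> y)" if "y \<in> W" for y
  proof -
    have y: "\<Psi> y \<in> V" "\<Theta> (\<Psi> y) = y" using inv(2) that by auto
    then have "chart_inv ?k (chart_map ?k (chart_inv c (\<Psi> y))) = chart_inv c (\<Psi> y)"
      unfolding chart_inv_def[of ?k] using chV[of "\<Psi> y"] inj by (intro inv_into_f_f) auto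
    then show ?thesis using y chV[of "\<Psi> y"] by simp
  qed
  have dom: "chart_dom ?k = chart_dom c \<inter> chart_map c -` V" by auto
  obtain V' where V': "open V'" "V = ?E \<inter> V'" using V(1) unfolding openin_open by blast
  have op: "open (chart_dom ?k)"
  proof -
    have "chart_dom ?k = chart_dom c \<inter> chart_map c -` V'"
      unfolding dom V'(2) using chart_mem[OF ch] by auto
    then show ?thesis
      using continuous_open_preimage[OF is_chartD(3)[OF ch] is_chartD(1)[OF ch] V'(1)] by simp
  qed
  have k: "is_chart ?k"
    unfolding is_chart_def
  proof (intro conjI op)
    show "subspace (chart_model ?k)" using E by simp
    show "openin (top_of_set (chart_model ?k)) (chart_map ?k ` chart_dom ?k)"
      using W img by simp
    have c1: "continuous_on (chart_dom ?k) (chart_map ?k)"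
      unfolding change_chart_simps(3)
      by (rule continuous_on_compose2[OF mb_smooth_continuous_on[OF \<Theta> E]
            continuous_on_subset[OF is_chartD(3)[OF ch]]]) auto
    have "continuous_on W (\<lambda>y. chart_inv c (\<Psi> y))"
      by (rule continuous_on_compose2[OF is_chartD(4)[OF ch] mb_smooth_continuous_on[OF \<Psi> E]])
        (use inv(2) V(2) in auto)
    then have c2: "continuous_on W (chart_inv ?k)"
      using cinv by (simp cong: continuous_on_cong)
    show "homeomorphism (chart_dom ?k) (chart_map ?k ` chart_dom ?k) (chart_map ?k) (chart_inv ?k)"
      unfolding img homeomorphism_def
    proof (intro conjI ballI c1 c2 img refl)
      show "chart_inv ?k (chart_map ?k p) = p" if "p \<in> chart_dom ?k" for p
        unfolding chart_inv_def using inj that by (rule inv_into_f_f)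
      show "chart_map ?k (chart_inv ?k y) = y" if "y \<in> W" for y
        using that inv(2)[OF that] cinv[OF that] chV[of "\<Psi> y"] by simp
      show "chart_inv ?k ` W = chart_dom ?k"
      proof
        show "chart_inv ?k ` W \<subseteq> chart_dom ?k"
          using cinv inv(2) chV by auto
        show "chart_dom ?k \<subseteq> chart_inv ?k ` W"
        proof
          fix p assume p: "p \<in> chart_dom ?k"
          then have "chart_map ?k p \<in> W" using img by blast
          moreover have "chart_inv ?k (chart_map ?k p) = p"
            unfolding chart_inv_def using inj p by (rule inv_into_f_f)
          ultimately show "p \<in> chart_inv ?k ` W" by (metis image_eqI)
        qed
      qed
    qed
  qed
  show "compatible_chart A ?k"
    unfolding compatible_chart_def
  proof (intro conjI ballI k)
    fix e assume e: "e \<in> A"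
    have che: "is_chart e" using A e unfolding smooth_atlas_def by blast
    have Ee: "subspace (chart_model e)" by (rule is_chartD[OF che])
    let ?Z = "chart_map ?k ` (chart_dom ?k \<inter> chart_dom e)"
    have Zop: "openin (top_of_set ?E) ?Z"
      using chart_image_open[OF k is_chartD(1)[OF che]] by (simp del: change_chart_simps(1,3))
    have Z: "z \<in> W \<and> \<Psi> z \<in> chart_map c ` (chart_dom c \<inter> chart_dom e)" if "z \<in> ?Z" for z
      using that inv(1) by auto
    have "mb_smooth_on ?E (chart_model e) ?Z (\<lambda>z. local_rep c e id (\<Psi> z))"
      by (rule mb_smooth_compose[OF atlas_change[OF A c e] mb_smooth_subset[OF \<Psi> Zop _ E E] _ E E Ee])
        (use Z in auto)
    then have "mb_smooth_on ?E (chart_model e) ?Z (local_rep ?k e id)"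
      by (rule mb_smooth_cong[OF _ E Ee]) (use Z cinv in \<open>auto simp: local_rep_def\<close>)
    then show "smooth_local_rep ?k e id"
      unfolding smooth_local_rep_def by (simp del: change_chart_simps(1,3))
    let ?Y = "chart_map e ` (chart_dom e \<inter> chart_dom ?k)"
    have Yop: "openin (top_of_set (chart_model e)) ?Y"
      by (rule chart_image_open[OF che op])
    have Y: "y \<in> chart_map e ` (chart_dom e \<inter> chart_dom c)" "local_rep e c id y \<in> V" if "y \<in> ?Y" for y
      using that by (auto simp: local_rep_apply[OF che])
    have "mb_smooth_on (chart_model e) ?E ?Y (\<lambda>y. \<Theta> (local_rep e c id y))"
      by (rule mb_smooth_compose[OF \<Theta> mb_smooth_subset[OF atlas_change[OF A e c] Yop _ Ee E] _ Ee E E])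
        (use Y in auto)
    then have "mb_smooth_on (chart_model e) ?E ?Y (local_rep e ?k id)"
      by (rule mb_smooth_cong[OF _ Ee E]) (auto simp: local_rep_def)
    then show "smooth_local_rep e ?k id"
      unfolding smooth_local_rep_def by (simp del: change_chart_simps(1,3))
  qed
qed

section \<open>Tangent spaces in a chart\<close>

text \<open>The inverse of the evaluation of tangent vectors at the chart \<open>c\<close>.\<close>

definition tangent_lift ::
  "('m::t2_space, 'e::locally_convex_space) chart set \<Rightarrow> 'm \<Rightarrow> ('m, 'e) chart \<Rightarrow> 'e \<Rightarrow> (('m, 'e) chart \<Rightarrow> 'e)" where
  "tangent_lift A m c e =
     (\<lambda>d. if d \<in> A \<and> m \<in> chart_dom d then dir_deriv (local_rep c d id) (chart_map c m) e else 0)"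

lemma dir_deriv_local_rep_chain:
  fixes A :: "('m::t2_space, 'e::locally_convex_space) chart set"
    and c' :: "('n::t2_space, 'f::locally_convex_space) chart"
    and d :: "('l::t2_space, 'g::locally_convex_space) chart"
  assumes c: "is_chart c" and c': "is_chart c'" and d: "subspace (chart_model d)"
    and m: "m \<in> chart_dom c" "f m \<in> chart_dom c'" "h (f m) \<in> chart_dom d" "e \<in> chart_model c"
    and f: "open (f -` chart_dom c')" "smooth_local_rep c c' f"
    and h: "open (h -` chart_dom d)" "smooth_local_rep c' d h"
    and hf: "open ((\<lambda>p. h (f p)) -` chart_dom d)"
  shows "dir_deriv (local_rep c d (\<lambda>p. h (f p))) (chart_map c m) e =
     dir_deriv (local_rep c' d h) (chart_map c' (f m)) (dir_deriv (local_rep c c' f) (chart_map c m) e)"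
proof -
  let ?Z = "chart_map c ` (chart_dom c \<inter> (f -` chart_dom c' \<inter> (\<lambda>p. h (f p)) -` chart_dom d))"
  note E = is_chartD(2)[OF c] and F = is_chartD(2)[OF c']
  have Zop: "openin (top_of_set (chart_model c)) ?Z"
    by (rule chart_image_open[OF c]) (intro open_Int f hf)
  have sf: "mb_smooth_on (chart_model c) (chart_model c') ?Z (local_rep c c' f)"
    by (rule mb_smooth_subset[OF f(2)[unfolded smooth_local_rep_def] Zop _ E F]) auto
  note sh = h(2)[unfolded smooth_local_rep_def]
  have maps: "local_rep c c' f z \<in> chart_map c' ` (chart_dom c' \<inter> h -` chart_dom d)" if "z \<in> ?Z" for z
    using that local_rep_apply[OF c] by auto
  have mZ: "chart_map c m \<in> ?Z" using m by auto
  have comp: "mb_smooth_on (chart_model c) (chart_model d) ?Z (\<lambda>z. local_rep c' d h (local_rep c c' f z))"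
    by (rule mb_smooth_compose[OF sh sf _ E F d]) (use maps in auto)
  have "dir_deriv (local_rep c d (\<lambda>p. h (f p))) (chart_map c m) e =
      dir_deriv (\<lambda>z. local_rep c' d h (local_rep c c' f z)) (chart_map c m) e"
    by (rule dir_deriv_cong[OF comp E mZ m(4)]) (auto simp: local_rep_apply[OF c] local_rep_apply[OF c'])
  also have "\<dots> = dir_deriv (local_rep c' d h) (local_rep c c' f (chart_map c m))
      (dir_deriv (local_rep c c' f) (chart_map c m) e)"
    by (rule dir_deriv_compose[OF sh sf maps[OF mZ] E F mZ m(4)])
  finally show ?thesis by (simp add: local_rep_apply[OF c m(1)])
qed

context
  fixes A :: "('m::t2_space, 'e::locally_convex_space) chart set" and m c
  assumes A: "smooth_atlas A" and c: "c \<in> A" "m \<in> chart_dom c"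
begin

lemma atlas_chart: "d \<in> A \<Longrightarrow> is_chart d"
  using A unfolding smooth_atlas_def by blast

lemma atlas_smooth: "d \<in> A \<Longrightarrow> d' \<in> A \<Longrightarrow> smooth_local_rep d d' id"
  using A unfolding smooth_atlas_def by blast

lemma tangent_lift_self: "e \<in> chart_model c \<Longrightarrow> tangent_lift A m c e c = e"
proof -
  assume e: "e \<in> chart_model c"
  note ch = atlas_chart[OF c(1)]
  note E = is_chartD(2)[OF ch]
  have op: "openin (top_of_set (chart_model c)) (chart_map c ` chart_dom c)"
    using ch unfolding is_chart_def by blast
  have id: "mb_smooth_on (chart_model c) (chart_model c) (chart_map c ` chart_dom c) (\<lambda>x. x)"
    by (rule mb_smooth_id[OF E op])
  have "dir_deriv (local_rep c c id) (chart_map c m) e = dir_deriv (\<lambda>x. x) (chart_map c m) e"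
    by (rule dir_deriv_cong[OF id E _ e]) (use c in \<open>auto simp: local_rep_apply[OF ch]\<close>)
  also have "\<dots> = e" by (rule has_velocity_dir_deriv[OF has_velocity_line])
  finally show ?thesis using c by (simp add: tangent_lift_def)
qed

text \<open>The cocycle condition in the definition of tangent vectors is the chain rule for chart changes.\<close>

lemma tangent_lift_change:
  assumes "d \<in> A" "m \<in> chart_dom d" "d' \<in> A" "m \<in> chart_dom d'" "e \<in> chart_model c"
  shows "tangent_lift A m c e d' = dir_deriv (local_rep d d' id) (chart_map d m) (tangent_lift A m c e d)"
  using dir_deriv_local_rep_chain[of c d d' m id id e] assms c atlas_chart atlas_smooth
    is_chartD(1)[OF atlas_chart[OF assms(1)]] is_chartD(1,2)[OF atlas_chart[OF assms(3)]]
  by (simp add: tangent_lift_def id_def)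

lemma tangent_lift_mem:
  assumes "e \<in> chart_model c"
  shows "tangent_lift A m c e \<in> tangent_space A m"
proof -
  have "dir_deriv (local_rep c d id) (chart_map c m) e \<in> chart_model d" if "d \<in> A" "m \<in> chart_dom d" for d
    by (rule dir_deriv_mem[OF atlas_change[OF A c(1) that(1)] _ assms]) (use that c in auto)
  then have "tangent_lift A m c e d \<in> chart_model d" if "d \<in> A" "m \<in> chart_dom d" for d
    using that by (simp add: tangent_lift_def)
  moreover have "tangent_lift A m c e d = 0" if "\<not> (d \<in> A \<and> m \<in> chart_dom d)" for d
    using that unfolding tangent_lift_def by (rule if_not_P)
  ultimately show ?thesis
    unfolding tangent_space_def using tangent_lift_change[OF _ _ _ _ assms] by blast
qed

lemma tangent_space_chart:
  assumes "\<xi> \<in> tangent_space A m"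
  shows "\<xi> c \<in> chart_model c"
  using assms c unfolding tangent_space_def by blast

lemma tangent_lift_linear: "linear_on (chart_model c) (tangent_space A m) (tangent_lift A m c)"
proof -
  have lin: "linear_on (chart_model c) (chart_model d) (dir_deriv (local_rep c d id) (chart_map c m))"
    if "d \<in> A" "m \<in> chart_dom d" for d
    by (rule dir_deriv_linear[OF atlas_change[OF A c(1) that(1)] is_chartD(2)[OF atlas_chart[OF c(1)]]])
      (use that c in auto)
  show ?thesis
    using tangent_lift_mem lin
    by (auto simp: linear_on_def tangent_lift_def fun_eq_iff scaleR_fun_def)
qed

lemma tangent_lift_continuous: "continuous_on (chart_model c) (tangent_lift A m c)"
proof (rule continuous_on_coordinatewise_then_product)
  fix d
  show "continuous_on (chart_model c) (\<lambda>e. tangent_lift A m c e d)"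
  proof (cases "d \<in> A \<and> m \<in> chart_dom d")
    case True
    then have "continuous_on (chart_model c) (dir_deriv (local_rep c d id) (chart_map c m))"
      by (intro dir_deriv_continuous[OF atlas_change[OF A c(1)]]) (use c in auto)
    then show ?thesis using True by (simp add: tangent_lift_def)
  next
    case False
    then have "tangent_lift A m c e d = 0" for e unfolding tangent_lift_def by (rule if_not_P)
    then show ?thesis by simp
  qed
qed

end

text \<open>Evaluation at a chart and \<open>tangent_lift\<close> are mutually inverse continuous linear maps which conjugate the
differential into \<open>T\<close>, so a splitting of the differential can be transported. The chart \<open>c\<close> has to be the one
selected in the definition of the differential.\<close>

lemma local_splitting:
  fixes A :: "('m::t2_space, 'e::locally_convex_space) chart set"
    and B :: "('n::t2_space, 'f::locally_convex_space) chart set"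
  assumes A: "smooth_atlas A" and B: "smooth_atlas B" and f: "smooth_map A B f"
    and reg: "regular_operator (tangent_space A m) (tangent_space B (f m)) (differential A B f m)"
  obtains c d \<pi> \<sigma> where "c \<in> A" "m \<in> chart_dom c" "d \<in> B" "f m \<in> chart_dom d"
    "splitting (chart_model c) (chart_model d) (dir_deriv (local_rep c d f) (chart_map c m)) \<pi> \<sigma>"
proof -
  define c where "c = (SOME c. c \<in> A \<and> m \<in> chart_dom c)"
  have "\<exists>c. c \<in> A \<and> m \<in> chart_dom c" "\<exists>d. d \<in> B \<and> f m \<in> chart_dom d"
    using A B unfolding smooth_atlas_def by blast+
  then obtain d where c: "c \<in> A" "m \<in> chart_dom c" and d: "d \<in> B" "f m \<in> chart_dom d"
    unfolding c_def by (metis (mono_tags, lifting) someI_ex)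
  note chc = atlas_chart[OF A c c(1)] and chd = atlas_chart[OF B d d(1)]
  define E where "E = chart_model c"
  define F where "F = chart_model d"
  define T where "T = dir_deriv (local_rep c d f) (chart_map c m)"
  define R where "R = differential A B f m"
  define lc where "lc = tangent_lift A m c"
  define ld where "ld = tangent_lift B (f m) d"
  have fc: "continuous_on UNIV f" and fs: "\<And>c d. c \<in> A \<Longrightarrow> d \<in> B \<Longrightarrow> smooth_local_rep c d f"
    using f unfolding smooth_map_def by auto
  have op: "open (f -` chart_dom d')" if "d' \<in> B" for d'
    using fc is_chartD(1)[OF atlas_chart[OF B d that]] by (simp add: continuous_on_open_vimage)
  have E: "subspace E" and F: "subspace F" using is_chartD(2) chc chd by (auto simp: E_def F_def)
  have T: "linear_on E F T"
    unfolding T_def E_def F_def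
    by (rule dir_deriv_linear[OF fs[OF c(1) d(1), unfolded smooth_local_rep_def] is_chartD(2)[OF chc]])
      (use c d in auto)
  have R_app: "R \<xi> d' = (if d' \<in> B \<and> f m \<in> chart_dom d' then dir_deriv (local_rep c d' f) (chart_map c m) (\<xi> c) else 0)"
    for \<xi> d' unfolding R_def differential_def Let_def by (simp add: c_def[symmetric])
  have Rd: "R \<xi> d = T (\<xi> c)" for \<xi> using d by (simp add: R_app T_def)
  have lift_c: "lc e c = e" if "e \<in> E" for e
    using tangent_lift_self[OF A c] that by (simp add: lc_def E_def)
  have lift_d: "ld y d = y" if "y \<in> F" for y
    using tangent_lift_self[OF B d] that by (simp add: ld_def F_def)
  have lcX: "lc e \<in> tangent_space A m" if "e \<in> E" for e
    using tangent_lift_mem[OF A c] that by (simp add: lc_def E_def)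
  have ldY: "ld y \<in> tangent_space B (f m)" if "y \<in> F" for y
    using tangent_lift_mem[OF B d] that by (simp add: ld_def F_def)
  have R_lift: "R \<xi> = ld (T (\<xi> c))" if "\<xi> c \<in> E" for \<xi>
  proof
    fix d'
    show "R \<xi> d' = ld (T (\<xi> c)) d'"
    proof (cases "d' \<in> B \<and> f m \<in> chart_dom d'")
      case True
      then show ?thesis
        using dir_deriv_local_rep_chain[of c d d' m f id "\<xi> c"] c d that chc chd
          fs[OF c(1) d(1)] op[of d] op[of d'] atlas_smooth[OF B d d(1), of d']
          is_chartD[OF atlas_chart[OF B d, of d']]
        by (simp add: R_app ld_def tangent_lift_def T_def E_def vimage_def)
    next
      case False
      then show ?thesis by (auto simp: R_app ld_def tangent_lift_def)
    qed
  qed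
  have TE: "T e \<in> F" if "e \<in> E" for e using linear_onD(1)[OF T E that] .
  have XE: "\<xi> c \<in> E" if "\<xi> \<in> tangent_space A m" for \<xi>
    using tangent_space_chart[OF A c that] by (simp add: E_def)
  have ld_image: "ld y \<in> R ` tangent_space A m" if y: "y \<in> T ` E" for y
  proof -
    obtain e where e: "e \<in> E" "y = T e" using y by blast
    then have "R (lc e) = ld y" using R_lift[of "lc e"] lift_c by simp
    then show ?thesis using lcX[OF e(1)] by (metis image_eqI)
  qed
  have Rimg: "z d \<in> T ` E" if "z \<in> R ` tangent_space A m" for z
    using that Rd XE by auto
  obtain \<pi> \<sigma> where split: "splitting (tangent_space A m) (tangent_space B (f m)) R \<pi> \<sigma>"
    using regular_operator_splitting[OF reg[folded R_def]] by blast
  let ?X = "tangent_space A m" and ?Y = "tangent_space B (f m)"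
  have \<pi>: "linear_on ?Y (R ` ?X) \<pi>" "continuous_on ?Y \<pi>" "\<And>y. y \<in> R ` ?X \<Longrightarrow> \<pi> y = y"
    and \<sigma>: "linear_on (R ` ?X) ?X \<sigma>" "continuous_on (R ` ?X) \<sigma>" "\<And>y. y \<in> R ` ?X \<Longrightarrow> R (\<sigma> y) = y"
    using split unfolding splitting_def by auto
  have ld: "linear_on F ?Y ld" "continuous_on F ld"
    unfolding F_def ld_def by (rule tangent_lift_linear[OF B d], rule tangent_lift_continuous[OF B d])
  have ev: "continuous_on Z (\<lambda>z. z k)" for k and Z :: "('k \<Rightarrow> 'v::topological_space) set"
    by (rule continuous_on_subset[OF continuous_on_product_coordinates]) simp
  have TEF: "T ` E \<subseteq> F" using TE by blast
  have "splitting E F T (\<lambda>y. \<pi> (ld y) d) (\<lambda>y. \<sigma> (ld y) c)"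
    unfolding splitting_def
  proof (intro conjI ballI)
    show "linear_on F (T ` E) (\<lambda>y. \<pi> (ld y) d)"
      using ld(1) \<pi>(1) ldY Rimg unfolding linear_on_def by (auto simp: scaleR_fun_def Pi_iff)
    show "continuous_on F (\<lambda>y. \<pi> (ld y) d)"
      by (rule continuous_on_compose2[OF ev[of UNIV d] continuous_on_compose2[OF \<pi>(2) ld(2)]])
        (use ldY in auto)
    show "\<pi> (ld y) d = y" if "y \<in> T ` E" for y
      using \<pi>(3)[OF ld_image[OF that]] lift_d that TEF by auto
    show "linear_on (T ` E) E (\<lambda>y. \<sigma> (ld y) c)"
      unfolding linear_on_def
    proof (intro conjI allI ballI Pi_I)
      have ld_add: "ld (x + y) = ld x + ld y" and ld_scale: "ld (k *\<^sub>R x) = k *\<^sub>R ld x"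
        if "x \<in> F" "y \<in> F" for x y k using ld(1) that unfolding linear_on_def by blast+
      have \<sigma>_add: "\<sigma> (u + v) = \<sigma> u + \<sigma> v" and \<sigma>_scale: "\<sigma> (k *\<^sub>R u) = k *\<^sub>R \<sigma> u"
        and \<sigma>_mem: "\<sigma> u \<in> ?X"
        if "u \<in> R ` ?X" "v \<in> R ` ?X" for u v k using \<sigma>(1) that unfolding linear_on_def by blast+
      fix x k assume x: "x \<in> T ` E"
      then have xF: "x \<in> F" using TEF by blast
      show "\<sigma> (ld x) c \<in> E" using XE \<sigma>_mem ld_image[OF x] by blast
      show "\<sigma> (ld (k *\<^sub>R x)) c = k *\<^sub>R \<sigma> (ld x) c"
        using ld_scale[OF xF xF, of k] \<sigma>_scale[OF ld_image[OF x] ld_image[OF x], of k]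
        by (simp add: scaleR_fun_def)
      fix y assume y: "y \<in> T ` E"
      then have yF: "y \<in> F" using TEF by blast
      show "\<sigma> (ld (x + y)) c = \<sigma> (ld x) c + \<sigma> (ld y) c"
        using ld_add[OF xF yF] \<sigma>_add[OF ld_image[OF x] ld_image[OF y]] by simp
    qed
    show "continuous_on (T ` E) (\<lambda>y. \<sigma> (ld y) c)"
      by (rule continuous_on_compose2[OF ev[of UNIV c] continuous_on_compose2[OF \<sigma>(2) continuous_on_subset[OF ld(2) TEF]]])
        (use ld_image in auto)
    show "T (\<sigma> (ld y) c) = y" if "y \<in> T ` E" for y
      using \<sigma>(3)[OF ld_image[OF that]] Rd[of "\<sigma> (ld y)"] lift_d that TEF by auto
  qed
  then show ?thesis using that[OF c d] by (simp add: E_def F_def T_def)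
qed


section \<open>The normal form\<close>

lemma openin_translate:
  fixes E :: "'e::locally_convex_space set"
  assumes "openin (top_of_set E) V" "subspace E" "a \<in> E"
  shows "openin (top_of_set E) {x \<in> E. a + x \<in> V}"
proof -
  obtain V' where V': "open V'" "V = E \<inter> V'" using assms(1) unfolding openin_open by blast
  have "{x \<in> E. a + x \<in> V} = E \<inter> {x. x + a \<in> V'}"
    using V'(2) assms(2,3) by (auto simp: subspace_add add.commute)
  then show ?thesis using open_translation_lc[OF V'(1), of a] by (metis openin_open_Int)
qed

lemma openin_preimage:
  assumes "continuous_on S h" "openin (top_of_set E) S" "openin (top_of_set F) V" "h \<in> S \<rightarrow> F"
  shows "openin (top_of_set E) {x \<in> S. h x \<in> V}"
proof -
  have "openin (top_of_set S) (S \<inter> h -` V)"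
    by (rule continuous_openin_preimage[OF assms(1) _ assms(3)]) (use assms(4) in auto)
  moreover have "S \<inter> h -` V = {x \<in> S. h x \<in> V}" by auto
  ultimately show ?thesis using openin_trans assms(2) by metis
qed

lemma continuous_on_minus_lc:
  fixes f g :: "'x::topological_space \<Rightarrow> 'a::locally_convex_tvs"
  assumes "continuous_on S f" "continuous_on S g"
  shows "continuous_on S (\<lambda>x. f x - g x)"
  using continuous_on_add[OF assms(1) continuous_on_minus[OF assms(2)]] by simp

text \<open>The decomposition is \<open>x = (x - P x) + P x\<close>; kernel and image are closed as zero sets of \<open>P\<close> and \<open>id - P\<close>.\<close>

lemma projection_direct_sum:
  fixes E :: "'e::locally_convex_space set"
  assumes E: "subspace E" and P: "linear_on E E P" "continuous_on E P" "\<And>x. x \<in> E \<Longrightarrow> P (P x) = P x"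
  shows "top_direct_sum E {x \<in> E. P x = 0} (P ` E)"
proof -
  note PD = linear_onD[OF P(1) E]
  let ?K = "{x \<in> E. P x = 0}"
  have K: "subspace ?K"
    by (rule subspaceI) (use E PD in \<open>auto simp: subspace_0 subspace_add subspace_scale\<close>)
  have img: "P ` E = {x \<in> E. x - P x = 0}"
    using PD(1) P(3) by (auto simp: image_iff)
  have c: "continuous_on E (\<lambda>x. x - P x)"
    by (intro continuous_on_minus_lc continuous_on_id P(2))
  have cl: "closedin (top_of_set E) ?K" "closedin (top_of_set E) (P ` E)"
    using continuous_closedin_preimage[OF P(2), of "{0}"] continuous_closedin_preimage[OF c, of "{0}"]
    unfolding img by (simp_all add: vimage_def Int_def)
  have mem: "x - P x \<in> ?K" if "x \<in> E" for x
    using that PD(1,5) P(3) E by (simp add: subspace_diff)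
  have "homeomorphism (?K \<times> P ` E) E (\<lambda>(a, b). a + b) (\<lambda>x. (x - P x, P x))"
  proof (rule homeomorphismI)
    show "continuous_on (?K \<times> P ` E) (\<lambda>(a, b). a + b)"
      unfolding case_prod_unfold by (intro continuous_on_add continuous_on_fst continuous_on_snd continuous_on_id)
    show "continuous_on E (\<lambda>x. (x - P x, P x))"
      by (intro continuous_on_Pair c P(2))
    show "(\<lambda>(a, b). a + b) ` (?K \<times> P ` E) \<subseteq> E"
      using E PD(1) by (auto intro: subspace_add)
    show "(\<lambda>x. (x - P x, P x)) ` E \<subseteq> ?K \<times> P ` E" using mem by auto
    fix ab assume "ab \<in> ?K \<times> P ` E"
    then obtain a x where "ab = (a, P x)" "a \<in> ?K" "x \<in> E" by auto
    then show "(\<lambda>x. (x - P x, P x)) ((\<lambda>(a, b). a + b) ab) = ab"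
      using PD(1,2) P(3) by simp
  qed auto
  then show ?thesis
    unfolding top_direct_sum_def using E K cl linear_on_image_subspace[OF P(1) E] by blast
qed

locale split_map =
  fixes E :: "'e::locally_convex_space set" and F :: "'f::real_normed_vector set"
    and T :: "'e \<Rightarrow> 'f" and \<pi> \<sigma>
  assumes E: "subspace E" and F: "subspace F" and complete: "complete F"
    and T: "linear_on E F T" "continuous_on E T"
    and split: "splitting E F T \<pi> \<sigma>"
begin

lemma I: "subspace (T ` E)"
  by (rule linear_on_image_subspace[OF T(1) E])

lemma \<pi>: "linear_on F (T ` E) \<pi>" "continuous_on F \<pi>" "x \<in> E \<Longrightarrow> \<pi> (T x) = T x"
  and \<sigma>: "linear_on (T ` E) E \<sigma>" "continuous_on (T ` E) \<sigma>" "x \<in> E \<Longrightarrow> T (\<sigma> (T x)) = T x"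
  using split unfolding splitting_def by auto

lemmas TD = linear_onD[OF T(1) E] and \<pi>D = linear_onD[OF \<pi>(1) F] and \<sigma>D = linear_onD[OF \<sigma>(1) I]

lemma \<pi>_id: "y \<in> T ` E \<Longrightarrow> \<pi> y = y" and T\<sigma>: "y \<in> T ` E \<Longrightarrow> T (\<sigma> y) = y"
  using \<pi>(3) \<sigma>(3) by auto

lemma IF: "y \<in> T ` E \<Longrightarrow> y \<in> F"
  using TD(1) by blast

definition Coker :: "'f set" where "Coker = {y \<in> F. \<pi> y = 0}"

definition P :: "'e \<Rightarrow> 'e" where "P x = \<sigma> (T x)"

lemma P: "linear_on E E P" "continuous_on E P" "x \<in> E \<Longrightarrow> P (P x) = P x" "x \<in> E \<Longrightarrow> T (P x) = T x"
proof -
  show "linear_on E E P"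
    unfolding linear_on_def P_def using TD \<sigma>D by auto
  show "continuous_on E P"
    unfolding P_def by (rule continuous_on_compose2[OF \<sigma>(2) T(2)]) auto
  show "x \<in> E \<Longrightarrow> P (P x) = P x" "x \<in> E \<Longrightarrow> T (P x) = T x"
    using \<sigma>(3) unfolding P_def by auto
qed

lemma \<pi>_FF: "linear_on F F \<pi>"
  using \<pi>(1) IF unfolding linear_on_def by blast

lemma \<pi>_image: "\<pi> ` F = T ` E"
  using \<pi>D(1) \<pi>_id IF by (auto simp: image_iff) metis

lemma \<pi>_idem: "y \<in> F \<Longrightarrow> \<pi> (\<pi> y) = \<pi> y"
  using \<pi>_id \<pi>D(1) by blast

lemma Y_sum: "top_direct_sum F Coker (T ` E)"
  using projection_direct_sum[OF F \<pi>_FF \<pi>(2) \<pi>_idem] unfolding Coker_def \<pi>_image .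

lemma X_sum: "top_direct_sum E {x \<in> E. T x = 0} (\<sigma> ` T ` E)"
proof -
  have "{x \<in> E. P x = 0} = {x \<in> E. T x = 0}"
    using P(4) TD(4) \<sigma>D(4) by (auto simp: P_def) metis
  moreover have "P ` E = \<sigma> ` T ` E" by (auto simp: P_def)
  ultimately show ?thesis using projection_direct_sum[OF E P(1-3)] by simp
qed

lemma complete_image: "complete (T ` E)"
proof -
  have "closedin (top_of_set F) (T ` E)" using Y_sum unfolding top_direct_sum_def by blast
  then show ?thesis using complete complete_Int_closed closedin_closed by metis
qed

lemma normal_form_map_eq:
  assumes "x \<in> E"
  shows "normal_form_map {x \<in> E. T x = 0} (\<sigma> ` T ` E) T h x = T x + h x"
proof -
  have "(THE x\<^sub>2. x\<^sub>2 \<in> \<sigma> ` T ` E \<and> (\<exists>x\<^sub>1\<in>{x \<in> E. T x = 0}. x = x\<^sub>1 + x\<^sub>2)) = P x"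
  proof (rule the_equality)
    have "x - P x \<in> {x \<in> E. T x = 0}"
      using assms linear_onD(1)[OF P(1) E] P(4) TD(5) E by (simp add: subspace_diff)
    then show "P x \<in> \<sigma> ` T ` E \<and> (\<exists>x\<^sub>1\<in>{x \<in> E. T x = 0}. x = x\<^sub>1 + P x)"
      using assms by (auto simp: P_def intro!: bexI[of _ "x - P x"])
    fix x2 assume "x2 \<in> \<sigma> ` T ` E \<and> (\<exists>x\<^sub>1\<in>{x \<in> E. T x = 0}. x = x\<^sub>1 + x2)"
    then obtain x1 z where z: "z \<in> E" "x2 = \<sigma> (T z)" "x1 \<in> E" "T x1 = 0" "x = x1 + x2" by auto
    then have "T x = T z" using TD(2)[OF z(3), of x2] \<sigma>D(1)[of "T z"] \<sigma>(3)[OF z(1)] by auto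
    then show "x2 = P x" using z(2) by (simp add: P_def)
  qed
  then show ?thesis unfolding normal_form_map_def using P(4)[OF assms] by simp
qed

lemma smooth_into_Coker:
  assumes "mb_smooth_on E F U h" "\<And>x. x \<in> U \<Longrightarrow> \<pi> (h x) = 0"
  shows "mb_smooth_on E Coker U h"
proof -
  have C: "subspace Coker" using Y_sum unfolding top_direct_sum_def by blast
  have "\<pi> (y - \<pi> y) = 0" if "y \<in> F" for y
    using \<pi>D(5)[OF that IF[OF \<pi>D(1)[OF that]]] \<pi>_idem[OF that] by simp
  then have "linear_on F Coker (\<lambda>y. y - \<pi> y)"
    unfolding linear_on_def Coker_def
    using \<pi>D(1-3) IF F by (auto simp: subspace_diff algebra_simps)
  moreover have "continuous_on F (\<lambda>y. y - \<pi> y)"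
    by (intro continuous_on_minus_lc continuous_on_id \<pi>(2))
  ultimately have "mb_smooth_on F Coker F (\<lambda>y. y - \<pi> y)"
    by (intro mb_smooth_linear F C) auto
  then have "mb_smooth_on E Coker U (\<lambda>x. h x - \<pi> (h x))"
    by (rule mb_smooth_compose[OF _ assms(1) _ E F C]) (use mb_smooth_maps[OF assms(1) E] in auto)
  then show ?thesis by (rule mb_smooth_cong[OF _ E C]) (use assms(2) in auto)
qed

text \<open>Here \<open>\<theta> x = x - \<sigma> (Q x)\<close> with \<open>Q = T - \<pi> \<circ> g\<close>, which is flat at \<open>0\<close>, so that \<open>perturbation_local_diffeo\<close>
applies. Since \<open>T \<circ> \<sigma>\<close> is the identity on the image, \<open>T (\<theta> x) = T x - Q x = \<pi> (g x)\<close>, hence \<open>\<pi> (g (\<psi> y)) = T y\<close> and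
the remainder \<open>h = g \<circ> \<psi> - T\<close> is annihilated by \<open>\<pi>\<close>. It is flat because \<open>\<psi>\<close> has derivative \<open>id\<close> at \<open>0\<close>.\<close>

lemma straighten_image_component:
  assumes g: "mb_smooth_on E F U g" and zero: "0 \<in> U" "g 0 = 0"
    and dg: "\<And>v. v \<in> E \<Longrightarrow> dir_deriv g 0 v = T v"
  obtains N D \<theta> \<psi> h where
    "openin (top_of_set E) N" "0 \<in> N" "N \<subseteq> U" "openin (top_of_set E) D" "0 \<in> D"
    "mb_smooth_on E E N \<theta>" "mb_smooth_on E E D \<psi>" "\<theta> 0 = 0"
    "\<forall>x\<in>N. \<theta> x \<in> D \<and> \<psi> (\<theta> x) = x" "\<forall>y\<in>D. \<psi> y \<in> N \<and> \<theta> (\<psi> y) = y"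
    "mb_smooth_on E Coker D h" "h 0 = 0" "\<forall>v\<in>E. dir_deriv h 0 v = 0"
    "\<forall>y\<in>D. g (\<psi> y) = T y + h y"
proof -
  note Uop = mb_smooth_openin[OF g]
  have UE: "x \<in> E" if "x \<in> U" for x using that openin_imp_subset[OF Uop] by blast
  note gF = mb_smooth_maps[OF g E]
  define Q where "Q x = T x - \<pi> (g x)" for x
  have "mb_smooth_on F (T ` E) F \<pi>" by (intro mb_smooth_linear \<pi> F I) auto
  then have \<pi>g: "mb_smooth_on E (T ` E) U (\<lambda>x. \<pi> (g x))"
    by (rule mb_smooth_compose[OF _ g _ E F I]) (use gF in auto)
  have TI: "linear_on E (T ` E) T" using T(1) unfolding linear_on_def by auto
  have Qs: "mb_smooth_on E (T ` E) U Q"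
    unfolding Q_def by (intro mb_smooth_diff mb_smooth_linear \<pi>g TI T(2) E I Uop)
  have T_vel: "has_velocity (\<lambda>t. T (0 + t *\<^sub>R v)) (T v)" if v: "v \<in> E" for v
  proof -
    have "(\<lambda>t. T (0 + t *\<^sub>R v)) = (\<lambda>t. 0 + t *\<^sub>R T v)" using TD(3)[OF v] by simp
    then show ?thesis using has_velocity_line[of 0 "T v"] by simp
  qed
  have dQ: "dir_deriv Q 0 v = 0" if v: "v \<in> E" for v
  proof (rule has_velocity_dir_deriv)
    have "has_velocity (\<lambda>t. \<pi> (g (0 + t *\<^sub>R v))) (\<pi> (T v))"
    proof (rule has_velocity_linear[OF \<pi>(1,2) F])
      show "has_velocity (\<lambda>t. g (0 + t *\<^sub>R v)) (T v)"
        using dir_deriv_velocity[OF g zero(1) v] dg[OF v] by simp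
      show "\<forall>\<^sub>F t in at 0. g (0 + t *\<^sub>R v) \<in> F"
        using line_eventually[OF Uop E zero(1) v] by eventually_elim (rule gF)
    qed (use TD(1)[OF v] zero(2) subspace_0[OF F] in auto)
    from has_velocity_diff[OF T_vel[OF v] this]
    show "has_velocity (\<lambda>t. Q (0 + t *\<^sub>R v)) 0" using \<pi>(3)[OF v] by (simp add: Q_def)
  qed
  have "perturbation E (T ` E) U Q \<sigma>"
    by unfold_locales (use E I complete_image Qs zero dQ \<sigma>(1,2) TD(4) \<pi>D(4) in \<open>auto simp: Q_def\<close>)
  then obtain N D \<psi> where ND:
    "openin (top_of_set E) N" "0 \<in> N" "N \<subseteq> U" "openin (top_of_set E) D" "0 \<in> D"
    "\<And>x. x \<in> N \<Longrightarrow> x - \<sigma> (Q x) \<in> D \<and> \<psi> (x - \<sigma> (Q x)) = x"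
    "\<And>y. y \<in> D \<Longrightarrow> \<psi> y \<in> N \<and> \<psi> y - \<sigma> (Q (\<psi> y)) = y"
    "mb_smooth_on E E D \<psi>"
    by (rule perturbation_local_diffeo) (rule that)
  define \<theta> where "\<theta> x = x - \<sigma> (Q x)" for x
  define h where "h y = g (\<psi> y) - T y" for y
  have Q0: "Q 0 = 0" using zero TD(4) \<pi>D(4) by (simp add: Q_def)
  have \<theta>0: "\<theta> 0 = 0" using Q0 \<sigma>D(4) by (simp add: \<theta>_def)
  have \<psi>0: "\<psi> 0 = 0" using ND(6)[OF ND(2)] \<theta>0 by (simp add: \<theta>_def)
  have QI: "Q x \<in> T ` E" if "x \<in> U" for x by (rule mb_smooth_maps[OF Qs E that])
  have T\<theta>: "T (\<theta> x) = \<pi> (g x)" if "x \<in> U" for x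
    using TD(5)[OF UE[OF that] \<sigma>D(1)[OF QI[OF that]]] T\<sigma>[OF QI[OF that]] by (simp add: \<theta>_def Q_def)
  have \<sigma>s: "mb_smooth_on (T ` E) E (T ` E) \<sigma>" by (intro mb_smooth_linear \<sigma> I E) auto
  have \<theta>s: "mb_smooth_on E E N \<theta>"
    unfolding \<theta>_def
  proof (intro mb_smooth_diff mb_smooth_id E ND(1))
    show "mb_smooth_on E E N (\<lambda>x. \<sigma> (Q x))"
      by (rule mb_smooth_compose[OF \<sigma>s mb_smooth_subset[OF Qs ND(1,3) E I] _ E I E]) (use QI ND(3) in auto)
  qed
  have g\<psi>: "mb_smooth_on E F D (\<lambda>y. g (\<psi> y))"
    by (rule mb_smooth_compose[OF g ND(8) _ E E F]) (use ND(3,7) in auto)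
  have "mb_smooth_on E F D h"
    unfolding h_def by (intro mb_smooth_diff g\<psi> mb_smooth_linear T E F ND(4))
  moreover have "\<pi> (h y) = 0" if "y \<in> D" for y
  proof -
    have y: "\<psi> y \<in> U" "\<theta> (\<psi> y) = y" "y \<in> E"
      using ND(3) ND(7)[of y] that openin_imp_subset[OF ND(4)] by (auto simp: \<theta>_def)
    then have "\<pi> (g (\<psi> y)) = T y" using T\<theta>[OF y(1)] by simp
    then show ?thesis
      using \<pi>D(5)[OF gF[OF y(1)] TD(1)[OF y(3)]] \<pi>(3)[OF y(3)] by (simp add: h_def)
  qed
  ultimately have hs: "mb_smooth_on E Coker D h" by (rule smooth_into_Coker)
  have dh: "dir_deriv h 0 v = 0" if v: "v \<in> E" for v
  proof -
    define w where "w = dir_deriv \<psi> 0 v"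
    have w: "w \<in> E" unfolding w_def by (rule dir_deriv_mem[OF ND(8,5) v])
    have \<psi>_vel: "has_velocity (\<lambda>t. \<psi> (0 + t *\<^sub>R v)) w"
      unfolding w_def by (rule dir_deriv_velocity[OF ND(8,5) v])
    note ev = line_eventually[OF ND(4) E ND(5) v]
    have evU: "\<forall>\<^sub>F t in at 0. \<psi> (0 + t *\<^sub>R v) \<in> U"
      using ev by eventually_elim (use ND(3,7) in blast)
    have "has_velocity (\<lambda>t. Q (\<psi> (0 + t *\<^sub>R v))) (dir_deriv Q (\<psi> (0 + 0 *\<^sub>R v)) w)"
      by (rule dir_deriv_chain_curve[OF Qs E \<psi>_vel w _ evU]) (simp add: \<psi>0 zero)
    then have "has_velocity (\<lambda>t. Q (\<psi> (0 + t *\<^sub>R v))) 0" using dQ[OF w] \<psi>0 by simp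
    then have "has_velocity (\<lambda>t. \<sigma> (Q (\<psi> (0 + t *\<^sub>R v)))) (\<sigma> 0)"
    proof (rule has_velocity_linear[OF \<sigma>(1,2) I])
      show "\<forall>\<^sub>F t in at 0. Q (\<psi> (0 + t *\<^sub>R v)) \<in> T ` E"
        using evU by eventually_elim (rule QI)
    qed (use I Q0 \<psi>0 in \<open>auto simp: subspace_0\<close>)
    from has_velocity_diff[OF \<psi>_vel this]
    have "has_velocity (\<lambda>t. \<theta> (\<psi> (0 + t *\<^sub>R v))) w" by (simp add: \<theta>_def \<sigma>D(4))
    moreover have "\<forall>\<^sub>F t in at 0. \<theta> (\<psi> (0 + t *\<^sub>R v)) = 0 + t *\<^sub>R v"
      using ev by eventually_elim (use ND(7) in \<open>auto simp: \<theta>_def\<close>)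
    ultimately have "has_velocity (\<lambda>t. 0 + t *\<^sub>R v) w"
      using has_velocity_cong[where \<gamma> = "\<lambda>t. \<theta> (\<psi> (0 + t *\<^sub>R v))" and \<delta> = "\<lambda>t. 0 + t *\<^sub>R v"]
        \<theta>0 \<psi>0 by simp
    then have "w = v" using has_velocity_line[of 0 v] by (rule has_velocity_unique)
    have "has_velocity (\<lambda>t. g (\<psi> (0 + t *\<^sub>R v))) (dir_deriv g (\<psi> (0 + 0 *\<^sub>R v)) w)"
      by (rule dir_deriv_chain_curve[OF g E \<psi>_vel w _ evU]) (simp add: \<psi>0 zero)
    then have "has_velocity (\<lambda>t. g (\<psi> (0 + t *\<^sub>R v))) (T v)" using dg[OF v] \<psi>0 \<open>w = v\<close> by simp
    from has_velocity_diff[OF this T_vel[OF v]]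
    show ?thesis by (intro has_velocity_dir_deriv) (simp add: h_def)
  qed
  show ?thesis
    by (rule that[of N D \<theta> \<psi> h])
      (use ND \<theta>s \<theta>0 hs dh \<psi>0 zero TD(4) in \<open>auto simp: \<theta>_def h_def\<close>)
qed

end

text \<open>The source chart is \<open>\<theta>\<close> after a translation. The target chart is the shear \<open>w \<mapsto> w - h (\<sigma> (\<pi> w))\<close> after a
translation; it is invertible because its displacement lies in \<open>Ker \<pi>\<close> and depends on \<open>\<pi> w\<close> only. The
singular part \<open>h y - h (P y)\<close> vanishes on the coimage, where the projection \<open>P = \<sigma> \<circ> T\<close> is the identity.\<close>

lemma normal_form_of_splitting:
  fixes A :: "('m::t2_space, 'e::locally_convex_space) chart set"
    and B :: "('n::t2_space, 'f::real_normed_vector) chart set"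
  assumes A: "smooth_atlas A" and B: "smooth_atlas B" and f: "smooth_map A B f"
    and c: "c \<in> A" "m \<in> chart_dom c" and d: "d \<in> B" "f m \<in> chart_dom d"
    and complete: "complete (chart_model d)"
    and split: "splitting (chart_model c) (chart_model d) (dir_deriv (local_rep c d f) (chart_map c m)) \<pi> \<sigma>"
  shows "has_normal_form_at A B f m"
proof -
  define E where "E = chart_model c"
  define F where "F = chart_model d"
  define x0 where "x0 = chart_map c m"
  define y0 where "y0 = chart_map d (f m)"
  define T where "T = dir_deriv (local_rep c d f) x0"
  define U0 where "U0 = chart_map c ` (chart_dom c \<inter> f -` chart_dom d)"
  have chc: "is_chart c" and chd: "is_chart d" using A B c d unfolding smooth_atlas_def by auto
  have E: "subspace E" and F: "subspace F" using is_chartD(2) chc chd by (auto simp: E_def F_def)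
  have x0: "x0 \<in> E" and y0: "y0 \<in> F" using chart_mem chc chd c d by (auto simp: E_def F_def x0_def y0_def)
  then have x0': "- x0 \<in> E" and y0': "- y0 \<in> F" using E F by (auto intro: subspace_neg)
  have L: "mb_smooth_on E F U0 (local_rep c d f)"
    using f c(1) d(1) unfolding smooth_map_def smooth_local_rep_def E_def F_def U0_def by blast
  have x0U: "x0 \<in> U0" using c d by (auto simp: U0_def x0_def)
  have T: "linear_on E F T" "continuous_on E T"
    unfolding T_def by (rule dir_deriv_linear[OF L E x0U], rule dir_deriv_continuous[OF L x0U])
  interpret split_map E F T \<pi> \<sigma>
    by unfold_locales (use E F T complete split in \<open>auto simp: E_def F_def T_def x0_def\<close>)
  define U where "U = {x \<in> E. x0 + x \<in> U0}"
  define g where "g x = local_rep c d f (x0 + x) - y0" for x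
  have Uop: "openin (top_of_set E) U"
    unfolding U_def by (rule openin_translate[OF mb_smooth_openin[OF L] E x0])
  have shift: "mb_smooth_on E E V (\<lambda>x. a + x)" if "a \<in> E" "openin (top_of_set E) V" for a V
    by (intro mb_smooth_add mb_smooth_const mb_smooth_id E that)
  have shiftF: "mb_smooth_on F F V (\<lambda>x. a + x)" if "a \<in> F" "openin (top_of_set F) V" for a V
    by (intro mb_smooth_add mb_smooth_const mb_smooth_id F that)
  have g: "mb_smooth_on E F U g"
    unfolding g_def
    by (intro mb_smooth_diff mb_smooth_const mb_smooth_compose[OF L shift[OF x0 Uop] _ E E F] E F Uop y0)
      (auto simp: U_def)
  have g0: "0 \<in> U" "g 0 = 0"
    using x0U x0 E local_rep_apply[OF chc c(2)] by (auto simp: U_def g_def x0_def y0_def subspace_0)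
  have dg: "dir_deriv g 0 v = T v" for v
    by (simp add: dir_deriv_def g_def T_def)
  obtain N D \<theta> \<psi> h where ND: "openin (top_of_set E) N" "0 \<in> N" "N \<subseteq> U"
    "openin (top_of_set E) D" "0 \<in> D"
    and \<theta>: "mb_smooth_on E E N \<theta>" and \<psi>: "mb_smooth_on E E D \<psi>" and \<theta>0: "\<theta> 0 = 0"
    and inv: "\<forall>x\<in>N. \<theta> x \<in> D \<and> \<psi> (\<theta> x) = x" "\<forall>y\<in>D. \<psi> y \<in> N \<and> \<theta> (\<psi> y) = y"
    and h: "mb_smooth_on E Coker D h" "h 0 = 0" "\<forall>v\<in>E. dir_deriv h 0 v = 0"
    and gh: "\<forall>y\<in>D. g (\<psi> y) = T y + h y"
    by (rule straighten_image_component[OF g g0 dg]) (rule that)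
  note PD = linear_onD[OF P(1) E]
  have DE: "y \<in> E" if "y \<in> D" for y using openin_imp_subset[OF ND(4)] that by blast
  have NE: "y \<in> E" if "y \<in> N" for y using openin_imp_subset[OF ND(1)] that by blast
  have Coker: "subspace Coker" using Y_sum unfolding top_direct_sum_def by blast
  have CF: "y \<in> F" "\<pi> y = 0" if "y \<in> Coker" for y using that by (auto simp: Coker_def)
  have hC: "h y \<in> Coker" if "y \<in> D" for y by (rule mb_smooth_maps[OF h(1) E that])
  have hF: "mb_smooth_on E F D h"
  proof -
    have "mb_smooth_on Coker F Coker (\<lambda>y. y)"
      by (rule mb_smooth_linear) (use CF Coker F in \<open>auto simp: linear_on_def\<close>)
    then show ?thesis by (rule mb_smooth_compose[OF _ h(1) _ E Coker F]) (use hC in auto)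
  qed
  \<comment> \<open>both terms of the singular part have to be defined\<close>
  define D' where "D' = {y \<in> D. P y \<in> D}"
  define fsing where "fsing y = h y - h (P y)" for y
  have D'op: "openin (top_of_set E) D'"
    unfolding D'_def
    by (rule openin_preimage[OF continuous_on_subset[OF P(2)] ND(4) ND(4)]) (use DE PD(1) in auto)
  have D'0: "0 \<in> D'" using ND(5) PD(4) by (simp add: D'_def)
  have D'E: "y \<in> E" if "y \<in> D'" for y using that DE by (simp add: D'_def)
  have hP: "mb_smooth_on E Coker D' (\<lambda>y. h (P y))"
    by (rule mb_smooth_compose[OF h(1) mb_smooth_linear[OF P(1,2) E E D'op] _ E E Coker])
      (auto simp: D'_def)
  have fs: "mb_smooth_on E Coker D' fsing"
    unfolding fsing_def
    by (intro mb_smooth_diff hP mb_smooth_subset[OF h(1) D'op] E Coker) (auto simp: D'_def)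
  have dfs: "dir_deriv fsing 0 v = 0" if v: "v \<in> E" for v
  proof (rule has_velocity_dir_deriv)
    have 1: "has_velocity (\<lambda>t. h (0 + t *\<^sub>R v)) 0"
      using dir_deriv_velocity[OF h(1) ND(5) v] h(3) v by simp
    have "(\<lambda>t. h (P (0 + t *\<^sub>R v))) = (\<lambda>t. h (0 + t *\<^sub>R P v))" using PD(3)[OF v] by simp
    then have 2: "has_velocity (\<lambda>t. h (P (0 + t *\<^sub>R v))) 0"
      using dir_deriv_velocity[OF h(1) ND(5) PD(1)[OF v]] h(3) PD(1)[OF v] by simp
    show "has_velocity (\<lambda>t. fsing (0 + t *\<^sub>R v)) 0"
      using has_velocity_diff[OF 1 2] by (simp add: fsing_def)
  qed
  have anf: "abstract_normal_form E {x \<in> E. T x = 0} (\<sigma> ` T ` E) F Coker (T ` E) T D' fsing"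
    unfolding abstract_normal_form_def
  proof (intro conjI ballI X_sum Y_sum D'op D'0 fs dfs)
    show "linear_on (\<sigma> ` T ` E) (T ` E) T"
      using TD \<sigma>D(1) unfolding linear_on_def by auto
    have "homeomorphism (\<sigma> ` T ` E) (T ` E) T \<sigma>"
      by (rule homeomorphismI)
        (use \<sigma>D(1) \<sigma>(2,3) in \<open>auto intro!: continuous_on_subset[OF T(2)]\<close>)
    then show "\<exists>g. homeomorphism (\<sigma> ` T ` E) (T ` E) T g" by blast
    show "fsing y = 0" if y: "y \<in> D' \<inter> \<sigma> ` T ` E" for y
    proof -
      obtain x where "x \<in> E" "y = P x" using y unfolding P_def by blast
      then show ?thesis using P(3) by (simp add: fsing_def)
    qed
  qed auto
  define N' where "N' = {x \<in> N. \<theta> x \<in> D'}"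
  define V where "V = {x \<in> E. - x0 + x \<in> N'}"
  define \<Theta> where "\<Theta> x = \<theta> (- x0 + x)" for x
  define \<kappa> where "\<kappa> = change_chart c V \<Theta>"
  have N'op: "openin (top_of_set E) N'"
    unfolding N'_def
    by (rule openin_preimage[OF mb_smooth_continuous_on[OF \<theta> E] ND(1) D'op]) (use inv DE in auto)
  have Vop: "openin (top_of_set E) V" unfolding V_def by (rule openin_translate[OF N'op E x0'])
  have VU0: "x \<in> U0" if "x \<in> V" for x using that ND(3) by (auto simp: V_def N'_def U_def)
  have \<Theta>s: "mb_smooth_on E E V \<Theta>"
    unfolding \<Theta>_def by (rule mb_smooth_compose[OF \<theta> shift[OF x0' Vop] _ E E E]) (auto simp: V_def N'_def)
  have \<Psi>s: "mb_smooth_on E E D' (\<lambda>y. x0 + \<psi> y)"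
    by (intro mb_smooth_add mb_smooth_const mb_smooth_subset[OF \<psi> D'op] E D'op x0) (auto simp: D'_def)
  have inv1: "\<Theta> x \<in> D' \<and> x0 + \<psi> (\<Theta> x) = x" if "x \<in> V" for x
    using that inv(1) by (auto simp: V_def N'_def \<Theta>_def)
  have inv2: "x0 + \<psi> y \<in> V \<and> \<Theta> (x0 + \<psi> y) = y" if "y \<in> D'" for y
  proof -
    have "y \<in> D" using that by (simp add: D'_def)
    then have "\<psi> y \<in> N" "\<theta> (\<psi> y) = y" using inv(2) by auto
    then show ?thesis using that x0 E NE by (simp add: V_def N'_def \<Theta>_def subspace_add)
  qed
  have "V \<subseteq> chart_map c ` chart_dom c" using VU0 unfolding U0_def by blast
  then have \<kappa>: "compatible_chart A \<kappa>" "chart_map \<kappa> ` chart_dom \<kappa> = D'"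
    using change_chart_compatible[OF A c(1) Vop[unfolded E_def] _ D'op[unfolded E_def]
        \<Theta>s[unfolded E_def] \<Psi>s[unfolded E_def] inv1 inv2]
    unfolding \<kappa>_def by blast+
  have mV: "x0 \<in> V" using x0 ND(2) \<theta>0 D'0 by (simp add: V_def N'_def)
  have \<kappa>_at: "chart_at A m \<kappa>"
    unfolding chart_at_def using \<kappa>(1) c(2) mV \<theta>0 by (simp add: \<kappa>_def x0_def \<Theta>_def)
  define W0 where "W0 = chart_map d ` chart_dom d"
  have W0op: "openin (top_of_set F) W0" using chd unfolding is_chart_def W0_def F_def by blast
  define s where "s w = h (\<sigma> (\<pi> w))" for w
  define O' where "O' = {w \<in> F. \<sigma> (\<pi> w) \<in> D}"
  have \<sigma>\<pi>: "linear_on F E (\<lambda>w. \<sigma> (\<pi> w))" "continuous_on F (\<lambda>w. \<sigma> (\<pi> w))"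
  proof -
    show "linear_on F E (\<lambda>w. \<sigma> (\<pi> w))" using \<pi>D \<sigma>D unfolding linear_on_def by auto
    show "continuous_on F (\<lambda>w. \<sigma> (\<pi> w))"
      by (rule continuous_on_compose2[OF \<sigma>(2) \<pi>(2)]) (use \<pi>D(1) in auto)
  qed
  have O'op: "openin (top_of_set F) O'"
    unfolding O'_def
    by (rule openin_preimage[OF \<sigma>\<pi>(2) _ ND(4)]) (use linear_onD(1)[OF \<sigma>\<pi>(1) F] in auto)
  have O'F: "w \<in> F" if "w \<in> O'" for w using that by (simp add: O'_def)
  have ss: "mb_smooth_on F F O' s"
    unfolding s_def
    by (rule mb_smooth_compose[OF hF mb_smooth_linear[OF \<sigma>\<pi> F E O'op] _ F E F]) (auto simp: O'_def)
  have sC: "s w \<in> F" "\<pi> (s w) = 0" if "w \<in> O'" for w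
    using that hC CF by (auto simp: s_def O'_def)
  \<comment> \<open>used with \<open>k = -1\<close> for the shear and \<open>k = 1\<close> for its inverse\<close>
  have shear: "w + k *\<^sub>R s w \<in> O'" "s (w + k *\<^sub>R s w) = s w" if "w \<in> O'" for w k
  proof -
    have "\<pi> (w + k *\<^sub>R s w) = \<pi> w"
      using \<pi>D(2)[OF O'F[OF that], of "k *\<^sub>R s w"] \<pi>D(3)[OF sC(1)[OF that], of k] sC[OF that] F
      by (simp add: subspace_scale)
    then show "w + k *\<^sub>R s w \<in> O'" "s (w + k *\<^sub>R s w) = s w"
      using that sC(1)[OF that] F by (auto simp: O'_def s_def subspace_add subspace_scale)
  qed
  define V2 where "V2 = {z \<in> F. - y0 + z \<in> O'} \<inter> W0"
  define \<Theta>2 where "\<Theta>2 z = (- y0 + z) - s (- y0 + z)" for z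
  define \<Psi>2 where "\<Psi>2 w = y0 + (w + s w)" for w
  define W2 where "W2 = {w \<in> O'. \<Psi>2 w \<in> W0}"
  define \<rho> where "\<rho> = change_chart d V2 \<Theta>2"
  have V2op: "openin (top_of_set F) V2"
    unfolding V2_def by (intro openin_Int[OF openin_translate[OF O'op F y0'] W0op])
  have \<Psi>2s: "mb_smooth_on F F O' \<Psi>2"
    unfolding \<Psi>2_def by (intro mb_smooth_add mb_smooth_const mb_smooth_id ss F O'op y0)
  have W2op: "openin (top_of_set F) W2"
    unfolding W2_def
    by (rule openin_preimage[OF mb_smooth_continuous_on[OF \<Psi>2s F] O'op W0op])
      (use mb_smooth_maps[OF \<Psi>2s F] in auto)
  have \<Theta>2s: "mb_smooth_on F F V2 \<Theta>2"
    unfolding \<Theta>2_def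
    by (intro mb_smooth_diff shiftF[OF y0' V2op] mb_smooth_compose[OF ss shiftF[OF y0' V2op] _ F F F] F)
      (auto simp: V2_def)
  have inv3: "\<Theta>2 z \<in> W2 \<and> \<Psi>2 (\<Theta>2 z) = z" if "z \<in> V2" for z
  proof -
    have z: "- y0 + z \<in> O'" "z \<in> W0" using that by (auto simp: V2_def)
    have "\<Theta>2 z \<in> O'" "s (\<Theta>2 z) = s (- y0 + z)"
      using shear[OF z(1), of "-1"] by (simp_all add: \<Theta>2_def)
    then show ?thesis using z by (simp add: W2_def \<Psi>2_def) (simp add: \<Theta>2_def)
  qed
  have inv4: "\<Psi>2 w \<in> V2 \<and> \<Theta>2 (\<Psi>2 w) = w" if "w \<in> W2" for w
  proof -
    have w: "w \<in> O'" "\<Psi>2 w \<in> W0" using that by (auto simp: W2_def)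
    have "w + s w \<in> O'" "s (w + s w) = s w" using shear[OF w(1), of 1] by simp_all
    moreover have "- y0 + \<Psi>2 w = w + s w" by (simp add: \<Psi>2_def)
    ultimately show ?thesis
      using w mb_smooth_maps[OF \<Psi>2s F w(1)] by (simp add: V2_def \<Theta>2_def)
  qed
  have \<rho>: "compatible_chart B \<rho>"
    unfolding \<rho>_def
    by (rule change_chart_compatible(1)[OF B d(1) V2op[unfolded F_def] _ W2op[unfolded F_def]
          \<Theta>2s[unfolded F_def] \<Psi>2s[THEN mb_smooth_subset, OF W2op _ F F, unfolded F_def] inv3 inv4])
      (auto simp: V2_def W0_def W2_def)
  have "0 \<in> O'" using ND(5) linear_onD(4)[OF \<sigma>\<pi>(1) F] F by (simp add: O'_def subspace_0)
  then have y0V: "y0 \<in> V2" using y0 d(2) by (auto simp: V2_def W0_def y0_def)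
  have "s 0 = 0" using linear_onD(4)[OF \<sigma>\<pi>(1) F] h(2) by (simp add: s_def)
  then have \<rho>_at: "chart_at B (f m) \<rho>"
    unfolding chart_at_def using \<rho> d(2) y0V by (simp add: \<rho>_def y0_def \<Theta>2_def)
  have rep: "f p \<in> chart_dom \<rho> \<and> chart_map \<rho> (f p) =
      normal_form_map {x \<in> E. T x = 0} (\<sigma> ` T ` E) T fsing (chart_map \<kappa> p)"
    if p: "p \<in> chart_dom \<kappa>" for p
  proof -
    have pc: "p \<in> chart_dom c" "chart_map c p \<in> V" using p by (auto simp: \<kappa>_def)
    from VU0[OF pc(2)] obtain q where q: "q \<in> chart_dom c" "f q \<in> chart_dom d" "chart_map c q = chart_map c p"
      by (auto simp: U0_def)
    then have "q = p" using is_chartD(5)[OF chc] pc(1) by (metis inj_onD)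
    then have fp: "f p \<in> chart_dom d" using q by simp
    define y where "y = \<Theta> (chart_map c p)"
    have y: "y \<in> D'" "x0 + \<psi> y = chart_map c p" using inv1[OF pc(2)] by (auto simp: y_def)
    have yD: "y \<in> D" "P y \<in> D" "y \<in> E" using y(1) D'E by (auto simp: D'_def)
    have z: "- y0 + chart_map d (f p) = T y + h y"
      using gh[rule_format, OF yD(1)] y(2) local_rep_apply[OF chc pc(1), of d f] by (simp add: g_def)
    have hy: "h y \<in> F" "\<pi> (h y) = 0" using CF hC[OF yD(1)] by auto
    have "\<pi> (T y + h y) = T y" using \<pi>D(2)[OF TD(1)[OF yD(3)] hy(1)] \<pi>(3)[OF yD(3)] hy(2) by simp
    then have \<sigma>z: "\<sigma> (\<pi> (T y + h y)) = P y" by (simp add: P_def)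
    have "T y + h y \<in> O'"
      unfolding O'_def using \<sigma>z yD(2) TD(1)[OF yD(3)] hy(1) F by (simp add: subspace_add)
    then have "chart_map d (f p) \<in> V2"
      using z fp chart_mem[OF chd fp] by (simp add: V2_def W0_def F_def)
    then have dom: "f p \<in> chart_dom \<rho>" using fp by (simp add: \<rho>_def)
    have "chart_map \<rho> (f p) = \<Theta>2 (chart_map d (f p))" by (simp add: \<rho>_def)
    also have "\<dots> = T y + h y - h (P y)" unfolding \<Theta>2_def z s_def \<sigma>z ..
    also have "\<dots> = T y + fsing y" by (simp add: fsing_def)
    also have "\<dots> = normal_form_map {x \<in> E. T x = 0} (\<sigma> ` T ` E) T fsing y"
      by (rule normal_form_map_eq[OF yD(3), symmetric])
    also have "y = chart_map \<kappa> p" by (simp add: y_def \<kappa>_def)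
    finally show ?thesis using dom by blast
  qed
  have "chart_model \<kappa> = E" "chart_model \<rho> = F" by (simp_all add: \<kappa>_def \<rho>_def E_def F_def)
  then show ?thesis
    unfolding has_normal_form_at_def using anf \<kappa>_at \<kappa>(2) \<rho>_at rep by blast
qed

theorem theorem2p2p9:
  fixes A :: "('m::t2_space, 'e::locally_convex_space) chart set"
    and B :: "('n::t2_space, 'f::real_normed_vector) chart set"
    and f :: "'m \<Rightarrow> 'n"
  assumes "smooth_atlas A" and "smooth_atlas B" and "smooth_map A B f"
  shows "(banach_manifold B \<longrightarrow>
            (\<forall>m. regular_operator (tangent_space A m) (tangent_space B (f m)) (differential A B f m)
                 \<longrightarrow> has_normal_form_at A B f m)) \<and>
         (finite_dim_manifold B \<longrightarrow> (\<forall>m. has_normal_form_at A B f m))"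
proof (intro conjI impI allI)
  fix m
  assume bm: "banach_manifold B"
    and reg: "regular_operator (tangent_space A m) (tangent_space B (f m)) (differential A B f m)"
  obtain c d \<pi> \<sigma> where cd: "c \<in> A" "m \<in> chart_dom c" "d \<in> B" "f m \<in> chart_dom d"
    "splitting (chart_model c) (chart_model d) (dir_deriv (local_rep c d f) (chart_map c m)) \<pi> \<sigma>"
    by (rule local_splitting[OF assms reg]) (rule that)
  have "complete (chart_model d)" using bm cd(3) unfolding banach_manifold_def by blast
  then show "has_normal_form_at A B f m"
    by (rule normal_form_of_splitting[OF assms cd(1-4) _ cd(5)])
next
  fix m
  assume fd: "finite_dim_manifold B"
  have "\<exists>c. c \<in> A \<and> m \<in> chart_dom c" "\<exists>d. d \<in> B \<and> f m \<in> chart_dom d"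
    using assms(1,2) unfolding smooth_atlas_def by blast+
  then obtain c d where cd: "c \<in> A" "m \<in> chart_dom c" "d \<in> B" "f m \<in> chart_dom d" by blast
  obtain S where S: "finite S" "chart_model d = span S"
    using fd cd(3) unfolding finite_dim_manifold_def by blast
  have ch: "is_chart c" using assms(1) cd(1) unfolding smooth_atlas_def by blast
  have "smooth_local_rep c d f" using assms(3) cd unfolding smooth_map_def by blast
  then have "linear_on (chart_model c) (chart_model d) (dir_deriv (local_rep c d f) (chart_map c m))"
    unfolding smooth_local_rep_def
    by (rule dir_deriv_linear[OF _ is_chartD(2)[OF ch]]) (use cd in auto)
  then obtain \<pi> \<sigma> where
    "splitting (chart_model c) (chart_model d) (dir_deriv (local_rep c d f) (chart_map c m)) \<pi> \<sigma>"
    using finite_dim_splitting[OF S(1) is_chartD(2)[OF ch]] S(2) by metis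
  moreover have "complete (chart_model d)" using complete_span_finite[OF S(1)] S(2) by simp
  ultimately show "has_normal_form_at A B f m"
    by (intro normal_form_of_splitting[OF assms cd])
qed

end
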